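(* Let $d\geq2$ be an integer. Then the set of all $\rho\in C_b(\mathbb{R}^d,\mathbb{R})$ for which there exists a Lipschitz regular function $f:\mathbb{R}^d\to\mathbb{R}^d$ solving at least one of the equations $$f\#(\rho\mathcal{L})=\mathcal{L}\qquad\text{or}\qquad f\#\mathcal{L}=\rho\mathcal{L}$$ is a $\sigma$-porous subset of the Banach space $(C_b(\mathbb{R}^d,\mathbb{R}),\|\cdot\|_\infty)$.
   Context: $C_b(\mathbb{R}^d,\mathbb{R})$ is the space of bounded continuous functions $\mathbb{R}^d\to\mathbb{R}$ with the supremum norm. $\mathcal{L}$ is Lebesgue measure on $\mathbb{R}^d$; $\rho\mathcal{L}(A)=\int_A\rho\,d\mathcal{L}$; the pushforward of a measure $\mu$ is $f\#\mu(A)=\mu(f^{-1}(A))$. If $\rho$ attains negative values, $\rho\mathcal{L}$ is a signed measure and $f\#(\rho\mathcal{L})$ denotes $f\#(\rho^+\mathcal{L})-f\#(\rho^-\mathcal{L})$, where $\rho^\pm$ are the positive and negative parts of $\rho$; in that case the equations are understood as equalities on all bounded Borel sets (preimages of bounded sets under a Lipschitz regular map are bounded, so all quantities are finite). A Lipschitz map $f:\mathbb{R}^d\to\mathbb{R}^d$ is Lipschitz regular if there is a positive integer $C$ such that for every ball $B\subset\mathbb{R}^d$ of radius $R>0$, the set $f^{-1}(B)$ can be covered by at most $C$ balls of radius $CR$. Let $(X,\|\cdot\|)$ be a Banach space. A set $P\subseteq X$ is porous at $x\in X$ if there exist $\epsilon_0>0$ and $\alpha\in(0,1)$ such that for every $\epsilon\in(0,\epsilon_0)$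 there exists $y\in X$ with $\|y-x\|<\epsilon$ and $B(y,\alpha\epsilon)\cap P=\varnothing$ ($B$ denotes an open ball of $X$). $P$ is porous if it is porous at every $x\in P$. A set $E\subseteq X$ is $\sigma$-porous if it is a countable union of porous subsets of $X$. *)

theory Defs
  imports "HOL-Analysis.Analysis"
begin

instance bcontfun :: (metric_space, banach) banach ..

definition lipschitz_regular :: "('a::euclidean_space \<Rightarrow> 'a) \<Rightarrow> bool" where
  "lipschitz_regular f \<longleftrightarrow>
     (\<exists>L. L-lipschitz_on UNIV f) \<and>
     (\<exists>C::nat. C > 0 \<and>
        (\<forall>x R. R > 0 \<longrightarrow>
          (\<exists>S. finite S \<and> card S \<le> C \<and> f -` ball x R \<subseteq> (\<Union>c\<in>S. ball c (real C * R)))))"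

definition pos_measure :: "('a::euclidean_space \<Rightarrow> real) \<Rightarrow> 'a measure" where
  "pos_measure \<rho> = density lborel (\<lambda>x. ennreal (max (\<rho> x) 0))"

definition neg_measure :: "('a::euclidean_space \<Rightarrow> real) \<Rightarrow> 'a measure" where
  "neg_measure \<rho> = density lborel (\<lambda>x. ennreal (max (- \<rho> x) 0))"

text \<open>For a density taking negative values, both sides are signed measures that are meaningful only
  on bounded Borel sets, so the equations are restricted to these. The function \<^const>\<open>measure\<close>
  sends infinite values to zero, but for a Lipschitz regular map the preimage of a bounded set is
  bounded and all the measures involved are finite.\<close>

definition pushes_density_to_lebesgue ::
    "('a::euclidean_space \<Rightarrow> 'a) \<Rightarrow> ('a \<Rightarrow> real) \<Rightarrow> bool" where
  "pushes_density_to_lebesgue f \<rho> \<longleftrightarrow>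
     (if \<forall>x. 0 \<le> \<rho> x then distr (density lborel (\<lambda>x. ennreal (\<rho> x))) borel f = lborel
      else \<forall>A\<in>sets borel. bounded A \<longrightarrow>
        measure (distr (pos_measure \<rho>) borel f) A - measure (distr (neg_measure \<rho>) borel f) A
          = measure lborel A)"

definition pushes_lebesgue_to_density ::
    "('a::euclidean_space \<Rightarrow> 'a) \<Rightarrow> ('a \<Rightarrow> real) \<Rightarrow> bool" where
  "pushes_lebesgue_to_density f \<rho> \<longleftrightarrow>
     (if \<forall>x. 0 \<le> \<rho> x then distr lborel borel f = density lborel (\<lambda>x. ennreal (\<rho> x))
      else \<forall>A\<in>sets borel. bounded A \<longrightarrow>
        measure (distr lborel borel f) A
          = measure (pos_measure \<rho>) A - measure (neg_measure \<rho>) A)"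

definition porous_at :: "'a::banach set \<Rightarrow> 'a \<Rightarrow> bool" where
  "porous_at P x \<longleftrightarrow>
     (\<exists>\<epsilon>0>0. \<exists>\<alpha>\<in>{0<..<1::real}. \<forall>\<epsilon>\<in>{0<..<\<epsilon>0}.
        \<exists>y. norm (y - x) < \<epsilon> \<and> ball y (\<alpha> * \<epsilon>) \<inter> P = {})"

definition porous :: "'a::banach set \<Rightarrow> bool" where
  "porous P \<longleftrightarrow> (\<forall>x\<in>P. porous_at P x)"

definition sigma_porous :: "'a::banach set \<Rightarrow> bool" where
  "sigma_porous E \<longleftrightarrow> (\<exists>F. countable F \<and> (\<forall>P\<in>F. porous P) \<and> E = \<Union>F)"

end

theory Submission
  imports Defs
begin

text \<open>Let \<open>f\<close> be Lipschitz regular. Its fibres have boundedly many points and the components of preimages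
  of small balls are small, so a dimension-theoretic argument shows that every ball contains a value
  that \<open>f\<close> cannot lose under small perturbations. Where the number of disjoint balls stably covering a
  common value is maximal, the preimage of a small ball \<open>V\<close> splits into finitely many sheets that \<open>f\<close> maps
  bi-Lipschitz homeomorphically onto \<open>V\<close>. On \<open>V\<close> (for \<open>f#L = \<rho>L\<close>) or on one of the sheets (for
  \<open>f#(\<rho>L) = L\<close>) the equation expresses integrals of \<open>\<rho>\<close> through volumes of images under, and
  integrals over images under, finitely many bi-Lipschitz maps \<open>h\<^sub>j\<close>.

  These are contradicted by an argument going back to Burago and Kleiner. Cut a thin row into \<open>N\<close> cubes.
  Either all \<open>h\<^sub>j\<close> are nearly translations from some cube of the row to the next, or a pair of grid
  points is stretched more than the endpoints of the row by a definite factor. The latter can be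
  iterated only boundedly often, so a perturbation of \<open>\<rho>\<close> that alternates along rows of all relevant
  scales meets a pair of adjacent cubes with nearly equal image volumes but different mass. Because
  \<open>d \<ge> 2\<close>, the rows of the next scale occupy a small part of each cube and do not spoil its mass. The
  contradiction persists under perturbations smaller by a constant factor depending only on the
  bi-Lipschitz data, of which countably many choices suffice; this gives \<open>\<sigma>\<close>-porosity.\<close>

section \<open>Stable covering by regular maps\<close>

text \<open>No Jacobians are used: the equation only enters through the masses of two neighbouring
  cubes, which are compared additively, so the sign of \<open>\<rho>\<close> does not matter. For
  \<open>f#(\<rho>L) = L\<close> the values of \<open>\<rho>\<close> on the other sheets enter as
  well. The perturbation is therefore confined to one sheet and to a cube so small that
  \<open>\<rho>\<close> is almost constant on each of the other images. The size of this cube and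
  the scales inside it depend on \<open>\<rho>\<close> and \<open>\<epsilon>\<close>, but the
  tolerance must be a fixed fraction of \<open>\<epsilon>\<close>. This works because the two cubes
  found differ in mass by a fixed fraction of \<open>\<epsilon>\<close> times their volume at
  whatever scale they occur. The volume discrepancy of their images can be made as small as desired
  beforehand. What remains is the tolerance, multiplied by a constant that depends only on the
  Lipschitz constant, the number of maps and the dimension. Different maps may be stretched at
  different stages. The squared increments are therefore summed over all maps, which gives one
  bounded quantity that grows by a definite factor at each stretching.\<close>

lemma connected_covered_by_balls_dist:
  fixes T :: "'a::metric_space set"
  assumes "connected T" "finite S" "card S \<le> C" "T \<subseteq> (\<Union>c\<in>S. ball c r)"
    and "p \<in> T" "q \<in> T" "0 \<le> r"
  shows "dist p q \<le> 2 * real C * r"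
proof -
  \<comment> \<open>\<open>dist p\<close> is 1-Lipschitz, so each ball goes into an interval of
    length \<open>2 * r\<close>, while the connected image contains the whole interval from 0 to
    \<open>dist p q\<close>. Comparing lengths turns the number of balls into a bound on the
    distance.\<close>
  let ?I = "\<lambda>c. cbox (dist p c - r) (dist p c + r)"
  have "connected (dist p ` T)"
    by (intro connected_continuous_image continuous_intros assms)
  then have "{dist p p..dist p q} \<subseteq> dist p ` T"
    by (intro connected_contains_Icc) (use assms in auto)
  also have "\<dots> \<subseteq> (\<Union>c\<in>S. ?I c)"
  proof
    fix t assume "t \<in> dist p ` T"
    then obtain x where x: "x \<in> T" "t = dist p x" by auto
    then obtain c where c: "c \<in> S" "dist c x < r"
      using assms(4) by (auto simp: subset_eq)
    have "\<bar>dist p x - dist p c\<bar> \<le> dist c x"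
      by (metis abs_dist_diff_le dist_commute)
    then have "t \<in> ?I c" using c x by (auto simp: abs_le_iff)
    then show "t \<in> (\<Union>c\<in>S. ?I c)" using c by blast
  qed
  finally have "measure lborel {0..dist p q} \<le> measure lborel (\<Union>c\<in>S. ?I c)"
    by (intro measure_mono_fmeasurable fmeasurable.finite_UN assms fmeasurable_cbox) auto
  also have "\<dots> \<le> (\<Sum>c\<in>S. measure lborel (?I c))"
    by (intro measure_UNION_le) (auto simp: assms)
  also have "\<dots> = real (card S) * (2 * r)"
    using assms by simp
  also have "\<dots> \<le> real C * (2 * r)"
    using assms by (intro mult_right_mono) auto
  finally show ?thesis by simp
qed

section \<open>Small covers of low order\<close>

lemma close_map_surj_ball:
  fixes h :: "'a::euclidean_space \<Rightarrow> 'a"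
  assumes "continuous_on (cball a r) h" "\<And>x. x \<in> cball a r \<Longrightarrow> dist (h x) x \<le> \<kappa>" "0 < r"
  shows "cball a (r - \<kappa>) \<subseteq> h ` cball a r"
proof
  fix y assume y: "y \<in> cball a (r - \<kappa>)"
  \<comment> \<open>A fixed point of \<open>x \<mapsto> y + (x - h x)\<close> is a preimage of
    \<open>y\<close>; this map preserves the ball because \<open>y\<close> keeps distance
    \<open>\<kappa>\<close> from its boundary.\<close>
  have "\<exists>x\<in>cball a r. h x = y"
  proof (rule brouwer_surjective_cball[where S = "{y}"])
    fix z x assume "z \<in> {y}" and x: "x \<in> cball a r"
    have "dist a (y + (x - h x)) \<le> dist a y + dist (h x) x"
      by (metis (no_types, opaque_lifting) add.commute add_diff_cancel_left' diff_add_cancel dist_commute dist_norm dist_triangle)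
    then show "z + (x - h x) \<in> cball a r"
      using y assms(2)[OF x] \<open>z \<in> {y}\<close> by auto
  qed (use assms in auto)
  then show "y \<in> h ` cball a r" by blast
qed

lemma negligible_convex_hull_few:
  fixes F :: "'a::euclidean_space set"
  assumes "finite F" "card F \<le> DIM('a)"
  shows "negligible (convex hull F)"
  using assms empty_interior_convex_hull[of F] negligible_convex_interior[of "convex hull F"] by simp

text \<open>\<open>p\<close> is constant on components of \<open>W\<close>, hence locally constant
  there, but may jump arbitrarily at the boundary. The weight vanishes at the boundary and outside,
  and the displacement \<open>p x - x\<close> stays bounded on \<open>W\<close>, so the product is
  continuous everywhere.\<close>

lemma continuous_at_component_selector:
  fixes p :: "'a::euclidean_space \<Rightarrow> 'a"
  assumes W: "open W"
    and const: "\<And>x y. x \<in> W \<Longrightarrow> connected_component W x y \<Longrightarrow> p y = p x"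
    and near: "\<And>x. x \<in> W \<Longrightarrow> dist (p x) x \<le> \<kappa>"
  shows "isCont (\<lambda>x. infdist x (- W) *\<^sub>R (p x - x)) x"
proof (cases "x \<in> W")
  case True
  let ?U = "connected_component_set W x"
  have U: "open ?U" "x \<in> ?U"
    using W True by (auto simp: open_connected_component)
  have "continuous_on ?U (\<lambda>y. infdist y (- W) *\<^sub>R (p x - y))"
    by (intro continuous_intros)
  then have "continuous_on ?U (\<lambda>y. infdist y (- W) *\<^sub>R (p y - y))"
    by (rule continuous_on_eq) (use const[OF True] in auto)
  then show ?thesis using U by (simp add: continuous_on_eq_continuous_at)
next
  case False
  have *: "norm (infdist y (- W) *\<^sub>R (p y - y)) \<le> infdist y (- W) * \<bar>\<kappa>\<bar>" for y
  proof (cases "y \<in> W")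
    case True
    then show ?thesis using near[OF True]
      by (auto simp: dist_norm infdist_nonneg intro!: mult_left_mono)
  qed (simp add: infdist_nonneg)
  have "isCont (\<lambda>y. infdist y (- W) * \<bar>\<kappa>\<bar>) x" by (intro continuous_intros)
  then have "((\<lambda>y. infdist y (- W) * \<bar>\<kappa>\<bar>) \<longlongrightarrow> 0) (at x)"
    using False by (simp add: isCont_def)
  then have "((\<lambda>y. infdist y (- W) *\<^sub>R (p y - y)) \<longlongrightarrow> 0) (at x)"
    by (rule Lim_null_comparison[rotated]) (use * in auto)
  then show ?thesis using False by (simp add: isCont_def)
qed

text \<open>A form of the Lebesgue covering theorem in which only the components of the members have
  to be small. A partition of unity moves each point into the convex hull of at most
  \<open>DIM('a)\<close> nearby points taken from a countable set. The image is thus contained in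
  countably many degenerate simplices and is null. But points move by at most
  \<open>\<kappa>\<close>, so the image also contains a ball.\<close>

lemma small_cover_order:
  fixes a :: "'a::euclidean_space"
  assumes fin: "finite \<W>" and opn: "\<And>W. W \<in> \<W> \<Longrightarrow> open W" and bdd: "\<And>W. W \<in> \<W> \<Longrightarrow> bounded W"
    and cov: "cball a r \<subseteq> \<Union>\<W>"
    and ord: "\<And>x. x \<in> cball a r \<Longrightarrow> card {W \<in> \<W>. x \<in> W} \<le> DIM('a)"
    and diam: "\<And>W x y. W \<in> \<W> \<Longrightarrow> connected_component W x y \<Longrightarrow> dist x y \<le> \<kappa>"
    and "0 < r" "\<kappa> < r"
  shows False
proof -
  obtain D :: "'a set" where D: "countable D" "\<And>X. open X \<Longrightarrow> X \<noteq> {} \<Longrightarrow> \<exists>d\<in>D. d \<in> X"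
    using countable_dense_exists by blast
  \<comment> \<open>The choice depends on the component alone, so \<open>p W\<close> is constant on
    components; choosing inside \<open>D\<close> keeps the number of possible simplices
    countable.\<close>
  define p where "p W x = (SOME d. d \<in> D \<and> d \<in> connected_component_set W x)" for W x
  have p: "p W x \<in> D" "connected_component W x (p W x)" if "W \<in> \<W>" "x \<in> W" for W x
  proof -
    have "\<exists>d. d \<in> D \<and> d \<in> connected_component_set W x"
      using D(2)[of "connected_component_set W x"] open_connected_component[OF opn] that
      by (metis connected_component_eq_empty)
    from someI_ex[OF this] show "p W x \<in> D" "connected_component W x (p W x)"
      by (auto simp: p_def)
  qed
  have pconst: "p W y = p W x" if "connected_component W x y" for W x y
    unfolding p_def using connected_component_eq[of y W x] that by simp
  have near: "dist (p W x) x \<le> \<kappa>" if "W \<in> \<W>" "x \<in> W" for W x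
    using diam[OF that(1) p(2)[OF that]] by (simp add: dist_commute)
  let ?l = "\<lambda>W x. infdist x (- W)"
  have lpos: "?l W x > 0" if "W \<in> \<W>" "x \<in> W" for W x
  proof -
    have "- W \<noteq> {}" using bdd[OF that(1)] not_bounded_UNIV by (metis Compl_empty_eq double_complement)
    moreover have "closed (- W)" using opn[OF that(1)] by auto
    ultimately show ?thesis
      using in_closed_iff_infdist_zero[of "- W" x] that infdist_nonneg[of x "- W"] by force
  qed
  have l0: "?l W x = 0" if "x \<notin> W" for W x using that by simp
  define s where "s x = (\<Sum>W\<in>\<W>. ?l W x)" for x
  have spos: "s x > 0" if "x \<in> cball a r" for x
  proof -
    from cov that obtain W where W: "W \<in> \<W>" "x \<in> W" by blast
    show ?thesis unfolding s_def
      using fin W(1) lpos[OF W] infdist_nonneg by (intro sum_pos2[where i = W]) auto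
  qed
  \<comment> \<open>The barycentric combination of the points \<open>p W x\<close>, written as a
    displacement of \<open>x\<close>: outside \<open>W\<close> the meaningless value
    \<open>p W x\<close> carries weight zero, and each summand is continuous.\<close>
  define h where "h x = x + (\<Sum>W\<in>\<W>. ?l W x *\<^sub>R (p W x - x)) /\<^sub>R s x" for x
  have "continuous_on (cball a r) h"
    unfolding h_def s_def
    by (intro continuous_intros continuous_at_imp_continuous_on ballI
         continuous_at_component_selector[where \<kappa> = \<kappa>] opn pconst near)
       (use spos in \<open>force simp: s_def\<close>)+
  moreover have hull: "h x \<in> convex hull ((\<lambda>W. p W x) ` {W\<in>\<W>. x \<in> W})" if x: "x \<in> cball a r" for x
  proof -
    let ?V = "{W\<in>\<W>. x \<in> W}"
    have sV: "s x = (\<Sum>W\<in>?V. ?l W x)"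
      unfolding s_def by (rule sum.mono_neutral_right) (use fin l0 in auto)
    have "(\<Sum>W\<in>\<W>. ?l W x *\<^sub>R (p W x - x)) = (\<Sum>W\<in>?V. ?l W x *\<^sub>R (p W x - x))"
      by (rule sum.mono_neutral_right) (use fin l0 in auto)
    also have "\<dots> = (\<Sum>W\<in>?V. ?l W x *\<^sub>R p W x) - s x *\<^sub>R x"
      by (simp add: scaleR_diff_right sum_subtractf sV scaleR_sum_left)
    finally have "h x = (\<Sum>W\<in>?V. (?l W x / s x) *\<^sub>R p W x)"
      using spos[OF x] by (simp add: h_def scaleR_diff_right scaleR_sum_right divide_inverse mult.commute)
    moreover have "\<dots> \<in> convex hull ((\<lambda>W. p W x) ` ?V)"
    proof (rule convex_sum)
      show "(\<Sum>W\<in>?V. ?l W x / s x) = 1"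
        using spos[OF x] by (simp add: sV flip: sum_divide_distrib)
    qed (use fin spos[OF x] in \<open>auto simp: infdist_nonneg intro: hull_inc\<close>)
    ultimately show ?thesis by simp
  qed
  have "dist (h x) x \<le> \<kappa>" if x: "x \<in> cball a r" for x
  proof -
    have "convex hull ((\<lambda>W. p W x) ` {W\<in>\<W>. x \<in> W}) \<subseteq> cball x \<kappa>"
      by (rule hull_minimal) (use near in \<open>auto simp: dist_commute\<close>)
    then show ?thesis using hull[OF x] by (auto simp: dist_commute)
  qed
  ultimately have "cball a (r - \<kappa>) \<subseteq> h ` cball a r"
    using close_map_surj_ball \<open>0 < r\<close> by blast
  also have "\<dots> \<subseteq> (\<Union>F\<in>{F. F \<subseteq> D \<and> finite F \<and> card F \<le> DIM('a)}. convex hull F)"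
  proof
    fix y assume "y \<in> h ` cball a r"
    then obtain x where x: "x \<in> cball a r" "y = h x" by auto
    have "card ((\<lambda>W. p W x) ` {W\<in>\<W>. x \<in> W}) \<le> DIM('a)"
      using card_image_le[of "{W\<in>\<W>. x \<in> W}" "\<lambda>W. p W x"] fin ord[OF x(1)] by auto
    then show "y \<in> (\<Union>F\<in>{F. F \<subseteq> D \<and> finite F \<and> card F \<le> DIM('a)}. convex hull F)"
      using hull[OF x(1)] x fin p by (intro UN_I[of "(\<lambda>W. p W x) ` {W\<in>\<W>. x \<in> W}"]) auto
  qed
  finally have "negligible (cball a (r - \<kappa>))"
  proof (rule negligible_subset[rotated])
    have "countable {F. F \<subseteq> D \<and> finite F \<and> card F \<le> DIM('a)}"
      by (rule countable_subset[OF _ countable_Collect_finite_subset[OF D(1)]]) auto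
    then show "negligible (\<Union>F\<in>{F. F \<subseteq> D \<and> finite F \<and> card F \<le> DIM('a)}. convex hull F)"
      by (intro negligible_countable_Union) (auto intro: negligible_convex_hull_few)
  qed
  moreover have "ball a (r - \<kappa>) \<subseteq> cball a (r - \<kappa>)" by auto
  ultimately have "negligible (ball a (r - \<kappa>))" using negligible_subset by blast
  then show False using open_not_negligible[of "ball a (r-\<kappa>)"] assms by auto
qed

text \<open>Open stars of the barycentres of faces in the barycentric subdivision of the integer grid: \<open>I\<close> is the
  set of coordinates that are constant on the face. For \<open>I \<noteq> {}\<close> they cover everything but the centres of
  the unit cubes, and stars of faces of the same dimension are disjoint, so their order is at most the
  dimension of the space.\<close>

definition face_nbhd :: "'n set \<Rightarrow> ('n \<Rightarrow> int) \<Rightarrow> (real^'n) set" where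
  "face_nbhd I n = {y. (\<forall>i\<in>I. \<bar>y $ i - of_int (n i)\<bar> < 1/2) \<and>
     (\<forall>j. j \<notin> I \<longrightarrow> of_int (n j) < y $ j \<and> y $ j < of_int (n j) + 1 \<and>
       (\<forall>i\<in>I. \<bar>y $ i - of_int (n i)\<bar> < y $ j - of_int (n j) \<and>
              \<bar>y $ i - of_int (n i)\<bar> < of_int (n j) + 1 - y $ j))}"

lemma open_face_nbhd: "open (face_nbhd I n :: (real^'n::finite) set)"
proof -
  have *: "open {y::real^'n. P \<longrightarrow> Q y}" if "open {y. Q y}" for P Q using that by (cases P) auto
  have **: "open {y::real^'n. \<forall>i\<in>J. Q i y}" if "\<And>i. open {y. Q i y}" for J :: "'n set" and Q
  proof -
    have "{y. \<forall>i\<in>J. Q i y} = (\<Inter>i\<in>J. {y. Q i y})" by auto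
    then show ?thesis using that by (auto intro!: open_INT)
  qed
  have ***: "open {y::real^'n. \<forall>i. Q i y}" if "\<And>i::'n. open {y. Q i y}" for Q
    using **[of Q UNIV] that by simp
  show ?thesis
    unfolding face_nbhd_def
    by (intro open_Collect_conj * ** *** open_Collect_less continuous_intros)
qed

lemma face_nbhd_dist:
  assumes "x \<in> face_nbhd I n" "y \<in> face_nbhd I n"
  shows "dist x (y::real^'n::finite) \<le> CARD('n)"
proof -
  have "\<bar>(x - y) $ k\<bar> \<le> 1" for k
  proof (cases "k \<in> I")
    case True
    then have "\<bar>x $ k - of_int (n k)\<bar> < 1/2" "\<bar>y $ k - of_int (n k)\<bar> < 1/2"
      using assms by (auto simp: face_nbhd_def)
    then show ?thesis by (simp add: abs_if split: if_splits)
  next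
    case False
    then have "of_int (n k) < x $ k \<and> x $ k < of_int (n k) + 1" "of_int (n k) < y $ k \<and> y $ k < of_int (n k) + 1"
      using assms by (auto simp: face_nbhd_def)
    then show ?thesis by (simp add: abs_if)
  qed
  then have "(\<Sum>k\<in>UNIV. \<bar>(x - y) $ k\<bar>) \<le> (\<Sum>k\<in>(UNIV::'n set). 1)" by (intro sum_mono)
  then show ?thesis using norm_le_l1_cart[of "x - y"] by (simp add: dist_norm)
qed

text \<open>Lying in the star of \<open>I\<close> ranks the coordinates: those in \<open>I\<close>
  are closer to the integers than those outside. Two different index sets of equal size each contain
  an index missing from the other, and the two rankings of this pair contradict each other. Once
  \<open>I\<close> is known, the inequalities determine \<open>n\<close>.\<close>

lemma face_nbhd_card_inj:
  assumes y: "y \<in> face_nbhd I n" "y \<in> face_nbhd I' n'" and card: "card I = card I'"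
  shows "I = I' \<and> n = (n' :: 'n::finite \<Rightarrow> int)"
proof -
  have sub: "I \<subseteq> I'" if y: "y \<in> face_nbhd I n" "y \<in> face_nbhd I' n'" and card: "card I = card I'"
    for I I' :: "'n set" and n n'
  proof (rule ccontr)
    assume "\<not> I \<subseteq> I'"
    then obtain i where i: "i \<in> I" "i \<notin> I'" by auto
    have "\<not> I' \<subseteq> I" using i card by (metis card_subset_eq finite)
    then obtain k where k: "k \<in> I'" "k \<notin> I" by auto
    have min_le: "min (t - of_int a) (of_int a + 1 - t) \<le> \<bar>t - of_int b\<bar>"
      for t :: real and a b :: int
    proof (cases "b \<le> a")
      case True
      then have "real_of_int b \<le> of_int a" by simp
      then show ?thesis by linarith
    next
      case False
      then have "of_int a + 1 \<le> real_of_int b" by linarith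
      then show ?thesis by linarith
    qed
    have "\<bar>y $ i - of_int (n i)\<bar> < min (y $ k - of_int (n k)) (of_int (n k) + 1 - y $ k)"
      using y(1) i k by (auto simp: face_nbhd_def)
    moreover have "\<bar>y $ k - of_int (n' k)\<bar> < min (y $ i - of_int (n' i)) (of_int (n' i) + 1 - y $ i)"
      using y(2) i k by (auto simp: face_nbhd_def)
    ultimately show False using min_le[of "y $ k" "n k" "n' k"] min_le[of "y $ i" "n' i" "n i"] by linarith
  qed
  have "I = I'" using sub[OF y card] sub[OF y(2,1)] card by auto
  moreover have "n k = n' k" for k
  proof (cases "k \<in> I")
    case True
    then have "\<bar>y $ k - of_int (n k)\<bar> < 1/2" "\<bar>y $ k - of_int (n' k)\<bar> < 1/2"
      using y \<open>I = I'\<close> by (auto simp: face_nbhd_def)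
    then show ?thesis by linarith
  next
    case False
    then have "of_int (n k) < y $ k \<and> y $ k < of_int (n k) + 1" "of_int (n' k) < y $ k \<and> y $ k < of_int (n' k) + 1"
      using y \<open>I = I'\<close> by (auto simp: face_nbhd_def)
    then show ?thesis by linarith
  qed
  ultimately show ?thesis by auto
qed

text \<open>Let \<open>I\<close> consist of the coordinates at minimal distance \<open>\<mu>\<close>
  from the integers. The strict inequalities for the other coordinates then hold automatically, and
  \<open>\<mu> < 1/2\<close> unless \<open>y\<close> is the centre of a unit cube. The bound on
  \<open>n\<close> lets finitely many stars suffice for a bounded set.\<close>

lemma face_nbhd_cover:
  fixes y :: "real^'n::finite"
  assumes "\<not> (\<forall>k. y $ k - 1/2 \<in> \<int>)"
  obtains I n where "I \<noteq> {}" "y \<in> face_nbhd I n" "\<And>k. \<bar>of_int (n k) - y $ k\<bar> \<le> 1"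
proof -
  define t where "t k = min (y $ k - of_int \<lfloor>y $ k\<rfloor>) (of_int \<lfloor>y $ k\<rfloor> + 1 - y $ k)" for k
  define \<mu> where "\<mu> = Min (range t)"
  have mu: "\<mu> \<le> t k" for k by (simp add: \<mu>_def)
  have "\<mu> \<in> range t" unfolding \<mu>_def by (rule Min_in) auto
  then obtain k0 where k0: "\<mu> = t k0" by auto
  obtain k where k: "y $ k - 1/2 \<notin> \<int>" using assms by auto
  have "t k < 1/2"
  proof (rule ccontr)
    assume "\<not> t k < 1/2"
    moreover have "s - 1/2 = u" if "\<not> min (s - u) (u + 1 - s) < 1/2" for s u :: real
      using that by (auto simp: min_def split: if_splits)
    ultimately have "y $ k - 1/2 = of_int \<lfloor>y $ k\<rfloor>" by (simp add: t_def)
    then show False using k by (metis Ints_of_int)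
  qed
  then have mulo: "\<mu> < 1/2" using mu[of k] by linarith
  define I where "I = {k. t k = \<mu>}"
  define n where "n k = (if k \<in> I then (if y $ k - of_int \<lfloor>y $ k\<rfloor> \<le> of_int \<lfloor>y $ k\<rfloor> + 1 - y $ k then \<lfloor>y $ k\<rfloor> else \<lfloor>y $ k\<rfloor> + 1) else \<lfloor>y $ k\<rfloor>)" for k
  have fl: "of_int \<lfloor>y $ k\<rfloor> \<le> y $ k" "y $ k < of_int \<lfloor>y $ k\<rfloor> + 1" for k by linarith+
  have "I \<noteq> {}" using k0 by (auto simp: I_def)
  moreover have "\<bar>y $ i - of_int (n i)\<bar> = \<mu>" if "i \<in> I" for i
  proof -
    have "t i = \<mu>" using that by (simp add: I_def)
    then have t: "min (y $ i - of_int \<lfloor>y $ i\<rfloor>) (of_int \<lfloor>y $ i\<rfloor> + 1 - y $ i) = \<mu>"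
      by (simp only: t_def)
    have gen: "\<bar>s - (if s - u \<le> u + 1 - s then u else u + 1)\<bar> = m"
      if "u \<le> s" "s < u + 1" "min (s - u) (u + 1 - s) = m" for u s m :: real
      using that by (auto simp: min_def split: if_splits)
    have ni: "real_of_int (n i) = (if y $ i - of_int \<lfloor>y $ i\<rfloor> \<le> of_int \<lfloor>y $ i\<rfloor> + 1 - y $ i
        then of_int \<lfloor>y $ i\<rfloor> else of_int \<lfloor>y $ i\<rfloor> + 1)"
      using that by (simp add: n_def)
    show ?thesis unfolding ni by (rule gen[OF fl t])
  qed
  moreover have "\<mu> < y $ j - of_int (n j) \<and> \<mu> < of_int (n j) + 1 - y $ j" if "j \<notin> I" for j
  proof -
    have "\<mu> < t j" using mu[of j] that by (force simp: I_def)
    then show ?thesis using that unfolding t_def n_def by auto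
  qed
  moreover have "\<mu> \<ge> 0" using fl[of k0] by (auto simp: k0 t_def)
  ultimately have "y \<in> face_nbhd I n"
    unfolding face_nbhd_def using mulo by (auto; force)
  moreover have "\<bar>of_int (n k) - y $ k\<bar> \<le> 1" for k
  proof -
    have "n k = \<lfloor>y $ k\<rfloor> \<or> n k = \<lfloor>y $ k\<rfloor> + 1" by (simp add: n_def)
    then have "real_of_int (n k) = of_int \<lfloor>y $ k\<rfloor> \<or> real_of_int (n k) = of_int \<lfloor>y $ k\<rfloor> + 1" by auto
    then show ?thesis using fl[of k] by linarith
  qed
  ultimately show ?thesis using that \<open>I \<noteq> {}\<close> by blast
qed

section \<open>Stably covered values\<close>

definition stably_covers :: "('a::metric_space \<Rightarrow> 'b::metric_space) \<Rightarrow> 'a set \<Rightarrow> 'b \<Rightarrow> real \<Rightarrow> bool" where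
  "stably_covers f B y \<delta> \<longleftrightarrow>
     (\<forall>g. continuous_on B g \<longrightarrow> (\<forall>x\<in>B. dist (g x) (f x) \<le> \<delta>) \<longrightarrow> y \<in> g ` B)"

definition regular_with :: "nat \<Rightarrow> ('a::metric_space \<Rightarrow> 'a) \<Rightarrow> bool" where
  "regular_with C f \<longleftrightarrow> C > 0 \<and> (\<forall>x R. R > 0 \<longrightarrow>
      (\<exists>S. finite S \<and> card S \<le> C \<and> f -` ball x R \<subseteq> (\<Union>c\<in>S. ball c (real C * R))))"

lemma regular_with_connected_dist:
  assumes "regular_with C f" "connected T" "T \<subseteq> f -` ball x R" "0 < R" "p \<in> T" "q \<in> T"
  shows "dist p q \<le> 2 * (real C)\<^sup>2 * R"
proof -
  obtain S where "finite S" "card S \<le> C" "f -` ball x R \<subseteq> (\<Union>c\<in>S. ball c (real C * R))"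
    using assms(1,4) unfolding regular_with_def by blast
  then have "dist p q \<le> 2 * real C * (real C * R)"
    using assms by (intro connected_covered_by_balls_dist[of T S]) auto
  then show ?thesis by (simp add: power2_eq_square)
qed

text \<open>The perturbations avoiding the single values are glued by bumps
  \<open>\<theta> c\<close> around \<open>c\<close>, whose supports are disjoint because
  \<open>Z\<close> is \<open>R\<close>-separated. A point that \<open>g\<close> sends to
  \<open>c\<close> has its \<open>f\<close>-value within \<open>\<delta> < R/4\<close> of
  \<open>c\<close>, where the bump is 1 and \<open>g\<close> agrees with the map avoiding
  \<open>c\<close>.\<close>

lemma perturb_avoiding:
  fixes f :: "'a::metric_space \<Rightarrow> 'b::real_normed_vector"
  assumes f: "continuous_on B f" and Z: "finite Z" and sep: "\<And>c c'. c \<in> Z \<Longrightarrow> c' \<in> Z \<Longrightarrow> c \<noteq> c' \<Longrightarrow> R \<le> dist c c'"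
    and "0 < R" "0 < \<delta>" "\<delta> < R/4"
    and unst: "\<And>c. c \<in> Z \<Longrightarrow> \<not> stably_covers f B c \<delta>"
  obtains g where "continuous_on B g" "\<And>x. x \<in> B \<Longrightarrow> dist (g x) (f x) \<le> \<delta>" "g ` B \<inter> Z = {}"
proof -
  have "\<forall>c\<in>Z. \<exists>g. continuous_on B g \<and> (\<forall>x\<in>B. dist (g x) (f x) \<le> \<delta>) \<and> c \<notin> g ` B"
    using unst by (auto simp: stably_covers_def)
  then obtain G where G: "\<And>c. c \<in> Z \<Longrightarrow> continuous_on B (G c)" 
      "\<And>c x. c \<in> Z \<Longrightarrow> x \<in> B \<Longrightarrow> dist (G c x) (f x) \<le> \<delta>" "\<And>c. c \<in> Z \<Longrightarrow> c \<notin> G c ` B"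
    by metis
  define \<theta> where "\<theta> c y = max 0 (min 1 (2 - 4 / R * dist y c))" for c y :: 'b
  have th: "0 \<le> \<theta> c y" "\<theta> c y \<le> 1" for c y by (auto simp: \<theta>_def)
  have th0: "\<theta> c y = 0" if "R/2 \<le> dist y c" for c y
  proof -
    have "2 \<le> 4 / R * dist y c" using that \<open>0 < R\<close> by (simp add: field_simps)
    then show ?thesis by (simp add: \<theta>_def)
  qed
  have th1: "\<theta> c y = 1" if "dist y c \<le> R/4" for c y
  proof -
    have "4 / R * dist y c \<le> 1" using that \<open>0 < R\<close> by (simp add: field_simps)
    then show ?thesis by (simp add: \<theta>_def)
  qed
  define g where "g x = f x + (\<Sum>c\<in>Z. \<theta> c (f x) *\<^sub>R (G c x - f x))" for x
  have g1: "g x = f x + \<theta> c (f x) *\<^sub>R (G c x - f x)" if "c \<in> Z" "dist (f x) c < R/2" for c x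
  proof -
    have "\<theta> c' (f x) = 0" if "c' \<in> Z" "c' \<noteq> c" for c'
    proof (rule th0)
      have "R \<le> dist c c'" using sep that \<open>c \<in> Z\<close> by auto
      then show "R/2 \<le> dist (f x) c'"
        using \<open>dist (f x) c < R/2\<close> dist_triangle[of c c' "f x"] by (simp add: dist_commute)
    qed
    then have "(\<Sum>c\<in>Z. \<theta> c (f x) *\<^sub>R (G c x - f x)) = (\<Sum>c'\<in>{c}. \<theta> c' (f x) *\<^sub>R (G c' x - f x))"
      using Z that by (intro sum.mono_neutral_right) auto
    then show ?thesis by (simp add: g_def)
  qed
  have close: "dist (g x) (f x) \<le> \<delta>" if "x \<in> B" for x
  proof (cases "\<exists>c\<in>Z. dist (f x) c < R/2")
    case True
    then obtain c where c: "c \<in> Z" "dist (f x) c < R/2" by auto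
    have "dist (g x) (f x) = \<theta> c (f x) * dist (G c x) (f x)"
      using th by (simp add: g1[OF c] dist_norm)
    also have "\<dots> \<le> 1 * dist (G c x) (f x)" by (intro mult_right_mono th) auto
    finally show ?thesis using G(2)[OF c(1) that] by simp
  next
    case False
    then have "g x = f x" unfolding g_def by (auto intro!: sum.neutral th0 simp: not_less)
    then show ?thesis using \<open>0 < \<delta>\<close> by simp
  qed
  show thesis
  proof
    show "continuous_on B g"
      unfolding g_def \<theta>_def by (intro continuous_intros f G)
    show "g ` B \<inter> Z = {}"
    proof (safe)
      fix x assume x: "x \<in> B" "g x \<in> Z"
      show "g x \<in> {}"
      proof (cases "dist (f x) (g x) \<le> R/4")
        case True
        then have "g x = G (g x) x"
          using g1[of "g x" x] x th1[of "f x" "g x"] \<open>0 < R\<close> by auto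
        then show ?thesis using G(3)[OF x(2)] x(1) by (metis imageI)
      next
        case False
        then show ?thesis using close[OF x(1)] \<open>\<delta> < R/4\<close> by (simp add: dist_commute)
      qed
    qed
  qed (use close in auto)
qed

lemma finite_bounded_int_functions: "finite {n :: 'n::finite \<Rightarrow> int. \<forall>k. \<bar>n k\<bar> \<le> K}"
proof -
  have "{n :: 'n \<Rightarrow> int. \<forall>k. \<bar>n k\<bar> \<le> K} \<subseteq> (UNIV \<rightarrow>\<^sub>E {- K..K})"
    by (auto simp: abs_le_iff PiE_def extensional_def) (smt (verit))
  then show ?thesis by (rule finite_subset) (auto intro: finite_PiE)
qed

text \<open>If no value were stable, \<open>f\<close> could be perturbed to a map \<open>g\<close>
  that misses the centres of a fine grid. The preimages under \<open>g\<close> of the remaining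
  stars would then cover a ball with order at most the dimension, and regularity makes their
  components small, contrary to \<open>small_cover_order\<close>.\<close>

theorem regular_stably_covers:
  fixes f :: "real^'n::finite \<Rightarrow> real^'n"
  assumes cf: "continuous_on UNIV f" and reg: "regular_with C f" and "0 < r"
  shows "\<exists>y. \<exists>\<delta>>0. stably_covers f (cball a r) y \<delta>"
proof (rule ccontr)
  assume no: "\<not> ?thesis"
  define d where "d = real CARD('n)"
  have "C > 0" using reg by (simp add: regular_with_def)
  have "d > 0" by (simp add: d_def)
  \<comment> \<open>A star has diameter at most \<open>d * R\<close> in the scaled grid, and passing
    from \<open>g\<close> back to \<open>f\<close> costs less than \<open>2 * R\<close>. This
    \<open>R\<close> makes the regularity bound for components over a ball of radius
    \<open>(d + 2) * R\<close> equal to \<open>r / 4\<close>.\<close>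
  define R where "R = r / (8 * (real C)\<^sup>2 * (d + 2))"
  have "R > 0" using \<open>0 < r\<close> \<open>C > 0\<close> \<open>d > 0\<close> by (simp add: R_def)
  have Rr: "2 * (real C)\<^sup>2 * ((d + 2) * R) = r / 4"
  proof -
    have "2 * q * (e * (r / (8 * q * e))) = r / 4" if "q > 0" "e > 0" for q e :: real
      using that by (simp add: field_simps)
    from this[of "(real C)\<^sup>2" "d + 2"] show ?thesis using \<open>C > 0\<close> \<open>d > 0\<close> by (simp add: R_def)
  qed
  \<comment> \<open>The centres of all grid cubes. Only those near a value of \<open>f\<close> can
    be hit by a perturbation of size \<open>R/8\<close>, so it is enough to avoid the finite set
    \<open>Z\<close>.\<close>
  define Z0 where "Z0 = {c::real^'n. \<forall>k. c $ k / R - 1/2 \<in> \<int>}"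
  define Z where "Z = {c\<in>Z0. \<exists>x\<in>cball a r. dist (f x) c < R/2}"
  have "bounded (f ` cball a r)"
    by (intro compact_imp_bounded compact_continuous_image) (auto intro: continuous_on_subset[OF cf])
  then obtain N where N: "\<And>x. x \<in> cball a r \<Longrightarrow> norm (f x) \<le> N"
    unfolding bounded_iff by blast
  define K where "K = \<lceil>(N + R) / R\<rceil> + 1"
  have K: "\<bar>y $ k / R\<bar> \<le> of_int K - 1" if "norm y \<le> N + R" for y :: "real^'n" and k
  proof -
    have "\<bar>y $ k / R\<bar> \<le> (N + R) / R"
      using component_le_norm_cart[of y k] that \<open>R > 0\<close> by (simp add: divide_right_mono)
    then show ?thesis unfolding K_def by linarith
  qed
  have near: "norm y \<le> N + R" if "x \<in> cball a r" "dist (f x) y \<le> R" for x y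
    using norm_triangle_sub[of y "f x"] N[OF that(1)] that(2) by (simp add: dist_norm norm_minus_commute)
  have "finite Z"
  proof (rule finite_subset)
    show "Z \<subseteq> (\<lambda>n. \<chi> k. R * (of_int (n k) + 1/2)) ` {n. \<forall>k. \<bar>n k\<bar> \<le> K}"
    proof
      fix c assume c: "c \<in> Z"
      then obtain x where x: "x \<in> cball a r" "dist (f x) c < R/2" by (auto simp: Z_def)
      have cK: "\<bar>c $ k / R\<bar> \<le> of_int K - 1" for k
        using K near[OF x(1)] x(2) \<open>R > 0\<close> by auto
      have "\<forall>k. \<exists>m. c $ k / R - 1/2 = of_int m" using c by (auto simp: Z_def Z0_def Ints_def)
      then obtain n where n: "\<And>k. c $ k / R - 1/2 = of_int (n k)" by metis
      have "c = (\<chi> k. R * (of_int (n k) + 1/2))"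
        using \<open>R > 0\<close> by (simp add: vec_eq_iff flip: n)
      moreover have "\<bar>n k\<bar> \<le> K" for k
      proof -
        have "\<bar>of_int (n k)\<bar> \<le> real_of_int K" using cK[of k] n[of k] by linarith
        then show ?thesis by linarith
      qed
      ultimately show "c \<in> (\<lambda>n. \<chi> k. R * (of_int (n k) + 1/2)) ` {n. \<forall>k. \<bar>n k\<bar> \<le> K}" by blast
    qed
  qed (intro finite_imageI finite_bounded_int_functions)
  have sep: "R \<le> dist c c'" if "c \<in> Z" "c' \<in> Z" "c \<noteq> c'" for c c'
  proof -
    obtain k where k: "c $ k \<noteq> c' $ k" using \<open>c \<noteq> c'\<close> by (auto simp: vec_eq_iff)
    have "c $ k / R - 1/2 \<in> \<int>" "c' $ k / R - 1/2 \<in> \<int>" using that by (auto simp: Z_def Z0_def)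
    then have "(c $ k / R - 1/2) - (c' $ k / R - 1/2) \<in> \<int>" by (rule Ints_diff)
    then have "(c - c') $ k / R \<in> \<int>" by (simp add: diff_divide_distrib)
    moreover have "(c - c') $ k / R \<noteq> 0" using k \<open>R > 0\<close> by simp
    ultimately have "1 \<le> \<bar>(c - c') $ k / R\<bar>" by (rule Ints_nonzero_abs_ge1)
    then have "R \<le> \<bar>(c - c') $ k\<bar>" using \<open>R > 0\<close> by (simp add: field_simps)
    then show ?thesis using component_le_norm_cart[of "c - c'" k] by (simp add: dist_norm)
  qed
  obtain g where g: "continuous_on (cball a r) g" "\<And>x. x \<in> cball a r \<Longrightarrow> dist (g x) (f x) \<le> R/8"
      "g ` cball a r \<inter> Z = {}"
    by (rule perturb_avoiding[of "cball a r" f Z R "R/8"])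
       (use no \<open>finite Z\<close> \<open>R > 0\<close> sep in \<open>auto intro: continuous_on_subset[OF cf]\<close>)
  have gZ: "g x \<notin> Z0" if x: "x \<in> cball a r" for x
  proof
    assume "g x \<in> Z0"
    moreover have "dist (f x) (g x) < R/2" using g(2)[OF x] \<open>R > 0\<close> by (simp add: dist_commute)
    ultimately have "g x \<in> Z" using x by (auto simp: Z_def)
    then show False using g(3) x by blast
  qed
  define P where "P = {(I :: 'n set, n :: 'n \<Rightarrow> int). I \<noteq> {} \<and> n \<in> {n. \<forall>k. \<bar>n k\<bar> \<le> K}}"
  have "finite P"
  proof (rule finite_subset)
    show "P \<subseteq> UNIV \<times> {n. \<forall>k. \<bar>n k\<bar> \<le> K}" by (auto simp: P_def)
  qed (intro finite_cartesian_product finite_bounded_int_functions, simp)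
  define W where "W = (\<lambda>(I, n). {x \<in> ball a r. (1/R) *\<^sub>R g x \<in> face_nbhd I n})"
  show False
  proof (rule small_cover_order[of "W ` P" a "r/2" "r/4"])
    fix V assume "V \<in> W ` P"
    then obtain I n where V: "V = {x \<in> ball a r. (1/R) *\<^sub>R g x \<in> face_nbhd I n}"
      by (auto simp: W_def P_def)
    have "continuous_on (ball a r) (\<lambda>x. (1/R) *\<^sub>R g x)"
      by (intro continuous_intros continuous_on_subset[OF g(1)]) auto
    then have "open ((\<lambda>x. (1/R) *\<^sub>R g x) -` face_nbhd I n \<inter> ball a r)"
      using open_face_nbhd unfolding continuous_on_open_vimage[OF open_ball] by blast
    then show "open V" by (simp add: V vimage_def Int_def conj_commute)
    show "bounded V" by (rule bounded_subset[OF bounded_ball[of a r]]) (auto simp: V)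
    fix x y assume "connected_component V x y"
    then obtain T where T: "connected T" "T \<subseteq> V" "x \<in> T" "y \<in> T"
      by (auto simp: connected_component_def)
    have "T \<subseteq> f -` ball (f x) ((d + 2) * R)"
    proof
      fix z assume "z \<in> T"
      then have z: "z \<in> cball a r" "(1/R) *\<^sub>R g z \<in> face_nbhd I n"
        and x: "x \<in> cball a r" "(1/R) *\<^sub>R g x \<in> face_nbhd I n" using T by (auto simp: V)
      have "dist ((1/R) *\<^sub>R g x) ((1/R) *\<^sub>R g z) \<le> d" unfolding d_def by (rule face_nbhd_dist[OF x(2) z(2)])
      moreover have "dist ((1/R) *\<^sub>R g x) ((1/R) *\<^sub>R g z) = norm ((1/R) *\<^sub>R (g x - g z))"
        by (simp only: dist_norm scaleR_diff_right)
      ultimately have "dist (g x) (g z) \<le> d * R"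
        using \<open>R > 0\<close> by (simp add: dist_norm divide_le_eq)
      then have "dist (f x) (f z) \<le> R/8 + d * R + R/8"
        using g(2)[OF x(1)] g(2)[OF z(1)] dist_triangle[of "f x" "f z" "g x"] dist_triangle[of "g x" "f z" "g z"]
        by (simp add: dist_commute)
      also have "\<dots> < (d + 2) * R" using \<open>R > 0\<close> by (simp add: field_simps)
      finally show "z \<in> f -` ball (f x) ((d + 2) * R)" by simp
    qed
    from regular_with_connected_dist[OF reg T(1) this _ T(3,4)]
    show "dist x y \<le> r/4" using Rr \<open>R > 0\<close> \<open>d > 0\<close> by simp
  next
    show "cball a (r/2) \<subseteq> \<Union>(W ` P)"
    proof
      fix x assume "x \<in> cball a (r/2)"
      then have x: "x \<in> cball a r" "x \<in> ball a r" using \<open>0 < r\<close> by auto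
      have "\<not> (\<forall>k. ((1/R) *\<^sub>R g x) $ k - 1/2 \<in> \<int>)" using gZ[OF x(1)] by (simp add: Z0_def)
      then obtain I n where In: "I \<noteq> {}" "(1/R) *\<^sub>R g x \<in> face_nbhd I n" "\<And>k. \<bar>of_int (n k) - ((1/R) *\<^sub>R g x) $ k\<bar> \<le> 1"
        by (rule face_nbhd_cover) blast
      have "\<bar>n k\<bar> \<le> K" for k
      proof -
        have "\<bar>g x $ k / R\<bar> \<le> of_int K - 1"
          using K near[OF x(1)] g(2)[OF x(1)] \<open>R > 0\<close> by (auto simp: dist_commute)
        moreover have "((1/R) *\<^sub>R g x) $ k = g x $ k / R" by simp
        ultimately have "\<bar>of_int (n k)\<bar> \<le> real_of_int K" using In(3)[of k] by linarith
        then show ?thesis by linarith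
      qed
      then have "(I, n) \<in> P" using In by (auto simp: P_def)
      moreover have "x \<in> W (I, n)" using x In by (auto simp: W_def)
      ultimately show "x \<in> \<Union>(W ` P)" by blast
    qed
    fix x
    let ?Q = "{p\<in>P. (1/R) *\<^sub>R g x \<in> face_nbhd (fst p) (snd p)}"
    \<comment> \<open>Stars through one point differ in the size of \<open>I\<close>, which ranges
      from 1 to the dimension since \<open>I\<close> is nonempty. This gives the order.\<close>
    have "inj_on (card \<circ> fst) ?Q"
    proof (rule inj_onI)
      fix p q assume "p \<in> ?Q" "q \<in> ?Q" "(card \<circ> fst) p = (card \<circ> fst) q"
      then show "p = q"
        using face_nbhd_card_inj[of "(1/R) *\<^sub>R g x" "fst p" "snd p" "fst q" "snd q"]
        by (simp add: prod_eq_iff)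
    qed
    moreover have "(card \<circ> fst) ` ?Q \<subseteq> {1..CARD('n)}"
    proof
      fix c assume "c \<in> (card \<circ> fst) ` ?Q"
      then obtain p where "c = card (fst p)" "p \<in> P" by auto
      moreover have "fst p \<noteq> {}" using \<open>p \<in> P\<close> by (simp add: P_def case_prod_unfold)
      ultimately have "0 < c" "c \<le> CARD('n)" by (simp_all add: card_gt_0_iff card_mono)
      then show "c \<in> {1..CARD('n)}" by simp
    qed
    ultimately have "card ?Q \<le> CARD('n)"
      using card_inj_on_le[of "card \<circ> fst" ?Q "{1..CARD('n)}"] by simp
    moreover have "card {V \<in> W ` P. x \<in> V} \<le> card ?Q"
    proof -
      have "{V \<in> W ` P. x \<in> V} \<subseteq> W ` ?Q" by (auto simp: W_def split: prod.splits)
      moreover have "finite ?Q" using \<open>finite P\<close> by simp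
      ultimately show ?thesis by (rule surj_card_le[rotated])
    qed
    ultimately show "card {V \<in> W ` P. x \<in> V} \<le> DIM(real^'n)" by simp
  qed (use \<open>finite P\<close> \<open>0 < r\<close> in auto)
qed

section \<open>Branches of the inverse of a regular map\<close>

lemma stably_covers_mono:
  assumes "stably_covers f B y \<delta>" "\<delta>' \<le> \<delta>"
  shows "stably_covers f B y \<delta>'"
  using assms unfolding stably_covers_def by (meson order_trans)

text \<open>Translating the competitor by \<open>y - y'\<close> costs \<open>\<epsilon>\<close> of
  the margin; hence a stably covered value comes with a neighbourhood of such values.\<close>

lemma stably_covers_shift:
  fixes f :: "'a::metric_space \<Rightarrow> 'b::real_normed_vector"
  assumes "stably_covers f B y \<delta>" "dist y y' \<le> \<epsilon>"
  shows "stably_covers f B y' (\<delta> - \<epsilon>)"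
  unfolding stably_covers_def
proof (intro allI impI)
  fix g assume g: "continuous_on B g" "\<forall>x\<in>B. dist (g x) (f x) \<le> \<delta> - \<epsilon>"
  have "continuous_on B (\<lambda>x. g x + (y - y'))" by (intro continuous_intros g)
  moreover have "dist (g x + (y - y')) (f x) \<le> \<delta>" if "x \<in> B" for x
  proof -
    have "dist (g x + (y - y')) (f x) \<le> dist (g x) (f x) + dist y y'"
      using norm_triangle_ineq[of "g x - f x" "y - y'"] by (simp add: dist_norm algebra_simps)
    then show ?thesis using g(2) that assms(2) by force
  qed
  ultimately have "y \<in> (\<lambda>x. g x + (y - y')) ` B"
    using assms(1) unfolding stably_covers_def by blast
  then show "y' \<in> g ` B" by (auto simp: algebra_simps)
qed

lemma stably_covers_imp_mem:
  assumes "stably_covers f B y \<delta>" "0 \<le> \<delta>" "continuous_on B f"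
  shows "y \<in> f ` B"
  using assms unfolding stably_covers_def by force

text \<open>The radius \<open>R\<close> is chosen so small that a covering ball of radius
  \<open>C * R\<close> cannot contain two points of \<open>F\<close>.\<close>

lemma regular_with_fibre_card:
  fixes f :: "'a::metric_space \<Rightarrow> 'a"
  assumes reg: "regular_with C f" and F: "finite F" "F \<subseteq> f -` {y}"
  shows "card F \<le> C"
proof -
  have "C > 0" using reg by (simp add: regular_with_def)
  have "\<exists>e>0. \<forall>p\<in>F. \<forall>q\<in>F. p \<noteq> q \<longrightarrow> e \<le> dist p q"
  proof -
    let ?D = "insert 1 ((\<lambda>(p,q). dist p q) ` {(p,q). p \<in> F \<and> q \<in> F \<and> p \<noteq> q})"
    have fin: "finite ?D"
    proof (intro finite.insertI finite_imageI)
      show "finite {(p, q). p \<in> F \<and> q \<in> F \<and> p \<noteq> q}"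
        by (rule finite_subset[of _ "F \<times> F"]) (use F in auto)
    qed
    have "Min ?D \<in> ?D" using fin by (intro Min_in) auto
    then have "Min ?D > 0" by auto
    moreover have "Min ?D \<le> dist p q" if "p \<in> F" "q \<in> F" "p \<noteq> q" for p q
      by (rule Min_le[OF fin]) (use that in auto)
    ultimately show ?thesis by blast
  qed
  then obtain e where e: "e > 0" "\<And>p q. p \<in> F \<Longrightarrow> q \<in> F \<Longrightarrow> p \<noteq> q \<Longrightarrow> e \<le> dist p q" by blast
  define R where "R = e / (2 * real C)"
  have "R > 0" using e \<open>C > 0\<close> by (simp add: R_def)
  have CR: "real C * R = e / 2" using \<open>C > 0\<close> by (simp add: R_def)
  obtain S where S: "finite S" "card S \<le> C" "f -` ball y R \<subseteq> (\<Union>c\<in>S. ball c (e/2))"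
    using reg \<open>R > 0\<close> CR unfolding regular_with_def by metis
  have "\<exists>c\<in>S. dist c p < e/2" if "p \<in> F" for p
  proof -
    have "p \<in> f -` ball y R" using F that \<open>R > 0\<close> by auto
    then obtain c where "c \<in> S" "p \<in> ball c (e/2)" using S(3) by blast
    then show ?thesis by auto
  qed
  then obtain c where c: "\<And>p. p \<in> F \<Longrightarrow> c p \<in> S \<and> dist (c p) p < e/2" by metis
  have "inj_on c F"
  proof (rule inj_onI, rule ccontr)
    fix p q assume pq: "p \<in> F" "q \<in> F" "c p = c q" "p \<noteq> q"
    then have "dist p q < e"
      using c[of p] c[of q] dist_triangle[of p q "c p"] by (simp add: dist_commute)
    then show False using e(2)[of p q] pq by simp
  qed
  then have "card F \<le> card S" using c S(1) by (intro card_inj_on_le[of c]) auto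
  then show ?thesis using S by simp
qed

lemma separated_compact_family:
  fixes B :: "nat \<Rightarrow> 'a::heine_borel set"
  assumes "\<And>i. i < m \<Longrightarrow> compact (B i)"
    and "\<And>i j. i < m \<Longrightarrow> j < m \<Longrightarrow> i \<noteq> j \<Longrightarrow> B i \<inter> B j = {}"
  obtains \<sigma> where "\<sigma> > 0" "\<And>i j x y. i < m \<Longrightarrow> j < m \<Longrightarrow> i \<noteq> j \<Longrightarrow> x \<in> B i \<Longrightarrow> y \<in> B j \<Longrightarrow> \<sigma> \<le> dist x y"
proof -
  let ?P = "{(i,j). i < m \<and> j < m \<and> i \<noteq> j}"
  have "\<exists>d>0. \<forall>x\<in>B i. \<forall>y\<in>B j. d \<le> dist x y" if "i < m" "j < m" "i \<noteq> j" for i j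
    using separate_compact_closed[of "B i" "B j"] assms that by (auto simp: compact_imp_closed)
  then have "\<forall>i j. \<exists>d. i < m \<and> j < m \<and> i \<noteq> j \<longrightarrow> d > 0 \<and> (\<forall>x\<in>B i. \<forall>y\<in>B j. d \<le> dist x y)"
    by blast
  then obtain d where d: "\<And>i j. i < m \<and> j < m \<and> i \<noteq> j \<Longrightarrow> d i j > 0 \<and> (\<forall>x\<in>B i. \<forall>y\<in>B j. d i j \<le> dist x y)"
    by metis
  have fin: "finite ?P" by (rule finite_subset[of _ "{..<m} \<times> {..<m}"]) auto
  let ?D = "insert 1 ((\<lambda>(i, j). d i j) ` ?P)"
  have finD: "finite ?D" using fin by blast
  show thesis
  proof
    have "Min ?D \<in> ?D" by (rule Min_in[OF finD]) auto
    then show "Min ?D > 0" using d by auto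
    fix i j x y assume ij: "i < m" "j < m" "i \<noteq> j" "x \<in> B i" "y \<in> B j"
    then have "Min ?D \<le> d i j" by (intro Min_le[OF finD]) force
    then show "Min ?D \<le> dist x y" using d[of i j] ij by force
  qed
qed

definition ball_family :: "'a::metric_space set set \<Rightarrow> bool" where
  "ball_family \<B> \<longleftrightarrow> finite \<B> \<and> disjoint \<B> \<and> (\<forall>B\<in>\<B>. \<exists>a r. 0 < r \<and> B = cball a r)"

lemma ball_family_insert:
  assumes "ball_family \<B>" "0 < r" "\<And>B. B \<in> \<B> \<Longrightarrow> cball x r \<inter> B = {}"
  shows "ball_family (insert (cball x r) \<B>)"
  using assms by (auto simp: ball_family_def pairwise_insert disjnt_def)

lemma ball_family_subset:
  assumes "ball_family \<B>" "\<B>' \<subseteq> \<B>"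
  shows "ball_family \<B>'"
  using assms by (auto simp: ball_family_def intro: finite_subset pairwise_subset)

text \<open>Each ball of the family contains its own preimage of \<open>y\<close>. The bound ensures
  that a family of maximal size exists.\<close>

lemma stable_family_card:
  fixes f :: "'a::real_normed_vector \<Rightarrow> 'a"
  assumes "regular_with C f" "continuous_on UNIV f" "ball_family \<B>" "0 < \<delta>"
    and st: "\<And>B. B \<in> \<B> \<Longrightarrow> stably_covers f B y \<delta>"
  shows "card \<B> \<le> C"
proof -
  have "\<exists>x\<in>B. f x = y" if "B \<in> \<B>" for B
    using stably_covers_imp_mem[OF st[OF that]] assms by (force intro: continuous_on_subset)
  then obtain p where p: "\<And>B. B \<in> \<B> \<Longrightarrow> p B \<in> B \<and> f (p B) = y" by metis
  have "inj_on p \<B>"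
  proof (rule inj_onI, rule ccontr)
    fix B B' assume B: "B \<in> \<B>" "B' \<in> \<B>" "p B = p B'" "B \<noteq> B'"
    then have "B \<inter> B' = {}" using assms(3) by (auto simp: ball_family_def disjoint_def)
    then show False using p[OF B(1)] p[OF B(2)] B(3) by auto
  qed
  then have "card \<B> = card (p ` \<B>)" by (simp add: card_image)
  also have "\<dots> \<le> C"
    by (rule regular_with_fibre_card[OF assms(1), of _ y]) (use p assms(3) in \<open>auto simp: ball_family_def\<close>)
  finally show ?thesis .
qed

text \<open>The sheets are recorded by their inverse maps \<open>\<phi> j\<close>: by
  \<open>inv\<close> and \<open>cover\<close> the preimage of the ball is the union of their images.
  The uniform gap \<open>\<sigma>\<close> lets a point over the ball be assigned to a sheet merely
  because it is close to it.\<close>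

locale branches =
  fixes f :: "real^'n::finite \<Rightarrow> real^'n" and C' :: real and y :: "real^'n" and \<delta> :: real and m :: nat
    and \<phi> :: "nat \<Rightarrow> real^'n \<Rightarrow> real^'n" and \<sigma> :: real
  assumes pos: "0 < \<delta>" "0 < m" "0 < \<sigma>" "0 < C'"
    and inv: "\<And>j v. j < m \<Longrightarrow> v \<in> ball y \<delta> \<Longrightarrow> f (\<phi> j v) = v"
    and cover: "\<And>x. f x \<in> ball y \<delta> \<Longrightarrow> \<exists>j<m. x = \<phi> j (f x)"
    and sep: "\<And>i j v w. i < m \<Longrightarrow> j < m \<Longrightarrow> i \<noteq> j \<Longrightarrow> v \<in> ball y \<delta> \<Longrightarrow> w \<in> ball y \<delta> \<Longrightarrow> \<sigma> \<le> dist (\<phi> i v) (\<phi> j w)"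
    and \<phi>_dist: "\<And>j v w. j < m \<Longrightarrow> v \<in> ball y \<delta> \<Longrightarrow> w \<in> ball y \<delta> \<Longrightarrow> dist (\<phi> j v) (\<phi> j w) \<le> C' * dist v w"

text \<open>Injectivity on a ball \<open>B\<close> of a maximal family: if \<open>f p = f q\<close> with \<open>p \<noteq> q\<close> in \<open>B\<close>, then over a small
  ball \<open>W\<close> around this value the preimage in \<open>B\<close> splits into a part near \<open>p\<close> and the rest. Some value \<open>y0\<close>
  in \<open>W\<close> is taken in \<open>B\<close> only near \<open>p\<close>, and some \<open>y1\<close> only away from \<open>p\<close>. Following \<open>f\<close> near \<open>p\<close> by the radial
  projection of \<open>W\<close> from \<open>y1\<close> to its boundary loses the value \<open>y0\<close>, so \<open>B\<close> would not cover stably. This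
  replaces an argument with the local degree.\<close>

theorem regular_branches:
  fixes f :: "real^'n::finite \<Rightarrow> real^'n"
  assumes cf: "continuous_on UNIV f" and reg: "regular_with C f"
  obtains y \<delta> m \<phi> \<sigma> where "branches f (4 * (real C)\<^sup>2) y \<delta> m \<phi> \<sigma>"
proof -
  have cfS: "continuous_on S f" for S using cf continuous_on_subset by blast
  define Q where "Q k \<longleftrightarrow> (\<exists>\<B> y. \<exists>\<delta>>0. ball_family \<B> \<and> card \<B> = k \<and> (\<forall>B\<in>\<B>. stably_covers f B y \<delta>))" for k
  have Qb: "k \<le> C" if "Q k" for k
    using that stable_family_card[OF reg cf] unfolding Q_def by blast
  have "Q 1"
  proof -
    obtain y \<delta> where "\<delta> > 0" "stably_covers f (cball 0 1) y \<delta>"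
      using regular_stably_covers[OF cf reg, of 1 0] by auto
    moreover have "ball_family (insert (cball 0 1) {} :: (real^'n) set set)"
      by (rule ball_family_insert) (simp_all add: ball_family_def)
    ultimately show ?thesis unfolding Q_def
      by (intro exI[of _ "{cball 0 1}"] exI[of _ y] exI[of _ \<delta>]) auto
  qed
  obtain m where m: "Q m" "\<And>k. Q k \<Longrightarrow> k \<le> m"
    using Qb \<open>Q 1\<close> Nat.ex_has_greatest_nat[of Q 1 C] by auto
  have "m > 0" using m(2)[OF \<open>Q 1\<close>] by simp
  obtain \<B> y \<delta> where \<delta>: "\<delta> > 0" and \<B>: "ball_family \<B>" "card \<B> = m"
    and st: "\<And>B. B \<in> \<B> \<Longrightarrow> stably_covers f B y \<delta>" using m(1) unfolding Q_def by blast
  \<comment> \<open>Maximality in the form used below. If \<open>m\<close> disjoint balls stably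
    cover every value that \<open>f\<close> takes on an open set \<open>U\<close> disjoint from
    them, then a small ball inside \<open>U\<close> stably covers such a value too and raises the
    count to \<open>m + 1\<close>.\<close>
  have no_extra: False
    if "open U" "x \<in> U" and \<B>': "ball_family \<B>'" "card \<B>' = m" and "U \<inter> \<Union>\<B>' = {}" "\<epsilon> > 0"
      and st': "\<And>z B. z \<in> U \<Longrightarrow> B \<in> \<B>' \<Longrightarrow> stably_covers f B (f z) \<epsilon>" for U x \<B>' \<epsilon>
  proof -
    from that(1,2) obtain r where r: "r > 0" "cball x r \<subseteq> U" using open_contains_cball by blast
    obtain y' \<delta>' where y': "\<delta>' > 0" "stably_covers f (cball x r) y' \<delta>'"
      using regular_stably_covers[OF cf reg r(1)] by blast
    then obtain z where z: "z \<in> cball x r" "y' = f z"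
      using stably_covers_imp_mem[OF y'(2)] cfS by force
    have "x \<in> cball x r" using r by simp
    then have new: "cball x r \<notin> \<B>'" using that(2,5) by blast
    have "Q (Suc m)"
      unfolding Q_def
    proof (intro exI conjI ballI)
      show "0 < min \<epsilon> \<delta>'" using that y' by simp
      show "ball_family (insert (cball x r) \<B>')"
        by (rule ball_family_insert[OF \<B>'(1) r(1)]) (use r(2) that(5) in blast)
      show "card (insert (cball x r) \<B>') = Suc m"
        using \<B>' new by (simp add: ball_family_def)
      fix B assume "B \<in> insert (cball x r) \<B>'"
      then have "B = cball x r \<or> B \<in> \<B>'" by simp
      then show "stably_covers f B y' (min \<epsilon> \<delta>')"
      proof
        assume "B = cball x r"
        then show ?thesis using y'(2) by (auto intro: stably_covers_mono)
      next
        assume "B \<in> \<B>'"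
        moreover have "z \<in> U" using r z by blast
        ultimately show ?thesis using st'[of z B] z(2) by (auto intro: stably_covers_mono)
      qed
    qed
    then show False using m(2)[of "Suc m"] by simp
  qed
  let ?V = "ball y (\<delta>/2)"
  have fV: "open (f -` U)" if "open U" for U using cf that by (simp add: open_vimage)
  have stV: "stably_covers f B v (\<delta>/2)" if "B \<in> \<B>" "v \<in> ?V" for B v
    using stably_covers_shift[OF st[OF that(1)], of v "\<delta>/2"] that by simp
  have closed\<B>: "closed B" if "B \<in> \<B>" for B using \<B> that by (auto simp: ball_family_def)
  have compact\<B>: "compact B" if "B \<in> \<B>" for B using \<B> that by (auto simp: ball_family_def)
  have fin\<B>: "finite \<B>" using \<B> by (simp add: ball_family_def)
  have disj: "B \<inter> B' = {}" if "B \<in> \<B>" "B' \<in> \<B>" "B \<noteq> B'" for B B'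
    using \<B> that by (auto simp: ball_family_def disjoint_def)
  have in\<B>: "x \<in> \<Union>\<B>" if "f x \<in> ?V" for x
  proof (rule ccontr)
    assume "x \<notin> \<Union>\<B>"
    show False
      by (rule no_extra[of "f -` ?V - \<Union>\<B>" x \<B> "\<delta>/2"])
         (use that \<open>x \<notin> \<Union>\<B>\<close> \<B> \<delta> stV fV closed\<B> fin\<B> in \<open>auto intro!: open_Diff closed_Union\<close>)
  qed
  have interior\<B>: "x \<in> interior B" if "f x \<in> ?V" "x \<in> B" "B \<in> \<B>" for x B
  proof (rule interiorI)
    show "open (f -` ?V - \<Union>(\<B> - {B}))"
      using fV closed\<B> fin\<B> by (auto intro!: open_Diff closed_Union)
    show "x \<in> f -` ?V - \<Union>(\<B> - {B})" using that disj by blast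
    show "f -` ?V - \<Union>(\<B> - {B}) \<subseteq> B" using in\<B> by fastforce
  qed
  \<comment> \<open>A small ball around \<open>p\<close> stably covers some \<open>y0\<close> and
    can replace \<open>B\<close> in the family. Another preimage of \<open>y0\<close> in
    \<open>B\<close>, outside the small ball, would leave room for one ball more.\<close>
  have localize: "\<exists>y0\<in>W. \<forall>x\<in>B. f x = y0 \<longrightarrow> x \<in> A"
    if B: "B \<in> \<B>" and p: "p \<in> B" "p \<in> A" "open A" "f p \<in> W" "open W" "W \<subseteq> ?V" for B p A W
  proof -
    have "p \<in> interior B" using interior\<B> that by blast
    with p have "p \<in> A \<inter> f -` W \<inter> interior B" by auto
    moreover have "open (A \<inter> f -` W \<inter> interior B)" using p fV by (intro open_Int) auto
    ultimately obtain s where s: "s > 0" "cball p s \<subseteq> A \<inter> f -` W \<inter> interior B"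
      using open_contains_cball by blast
    obtain y0 \<delta>0 where y0: "\<delta>0 > 0" "stably_covers f (cball p s) y0 \<delta>0"
      using regular_stably_covers[OF cf reg s(1)] by blast
    then have "y0 \<in> f ` cball p s" using stably_covers_imp_mem[OF y0(2)] cfS by force
    then have y0W: "y0 \<in> W" using s by auto
    have "x \<in> A" if x: "x \<in> B" "f x = y0" for x
    proof (rule ccontr)
      assume "x \<notin> A"
      then have xs: "x \<notin> cball p s" using s by auto
      have sub: "cball p s \<subseteq> B" using s interior_subset by blast
      let ?U = "f -` (?V \<inter> ball y0 (\<delta>0/2)) \<inter> interior B - cball p s"
      let ?\<B> = "insert (cball p s) (\<B> - {B})"
      have dj: "cball p s \<inter> B' = {}" if "B' \<in> \<B> - {B}" for B' using sub disj[OF B] that by blast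
      have "p \<in> cball p s" using s(1) by auto
      then have new: "cball p s \<notin> \<B> - {B}" using dj by blast
      show False
      proof (rule no_extra[of ?U x ?\<B> "min (\<delta>/2) (\<delta>0/2)"])
        show "open ?U" using fV by (intro open_Diff open_Int) auto
        show "x \<in> ?U" 
        proof -
          have "f x \<in> ?V" using x(2) y0W \<open>W \<subseteq> ?V\<close> by blast
          moreover from this have "x \<in> interior B" using interior\<B> x(1) B by blast
          moreover have "f x \<in> ball y0 (\<delta>0/2)" using x(2) y0(1) by simp
          ultimately show ?thesis using xs by blast
        qed
        show "ball_family ?\<B>"
          by (rule ball_family_insert[OF ball_family_subset[OF \<B>(1)] s(1) dj]) auto
        show "card ?\<B> = m" using \<B>(2) fin\<B> new B \<open>m > 0\<close> by (simp add: card_Diff_singleton)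
        show "?U \<inter> \<Union>?\<B> = {}" using disj[OF B] interior_subset[of B] by blast
        fix z B' assume zB: "z \<in> ?U" "B' \<in> ?\<B>"
        have "stably_covers f (cball p s) (f z) (\<delta>0/2)"
          using stably_covers_shift[OF y0(2), of "f z" "\<delta>0/2"] zB(1) by simp
        moreover have "stably_covers f B' (f z) (\<delta>/2)" if "B' \<in> \<B>"
          using stV[OF that, of "f z"] zB(1) by blast
        ultimately show "stably_covers f B' (f z) (min (\<delta>/2) (\<delta>0/2))"
          using zB(2) by (auto intro: stably_covers_mono)
      qed (use \<delta> y0 in auto)
    qed
    then show ?thesis using y0W by blast
  qed
  have inj: "p = q" if B: "B \<in> \<B>" and p: "p \<in> B" "f p \<in> ?V" and q: "q \<in> B" "f q = f p" for B p q
  proof (rule ccontr)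
    assume "p \<noteq> q"
    define y' where "y' = f p"
    have "finite (B \<inter> f -` {y'}) \<and> card (B \<inter> f -` {y'}) \<le> C"
      by (intro finite_if_finite_subsets_card_bdd regular_with_fibre_card[OF reg, of _ y']) auto
    then have "finite (dist p ` (B \<inter> f -` {y'}))" by blast
    moreover have "infinite {0<..<dist p q}" using \<open>p \<noteq> q\<close> by simp
    ultimately obtain r where r: "0 < r" "r < dist p q" "r \<notin> dist p ` (B \<inter> f -` {y'})"
      by (metis Diff_eq_empty_iff Diff_infinite_finite finite.emptyI greaterThanLessThan_iff subsetI)
    have "compact (f ` (B \<inter> sphere p r))"
      by (intro compact_continuous_image cfS compact_Int_closed compact\<B> B closed_sphere)
    moreover have "y' \<notin> f ` (B \<inter> sphere p r)" 
    proof
      assume "y' \<in> f ` (B \<inter> sphere p r)"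
      then obtain x where "x \<in> B" "dist p x = r" "f x = y'" by auto
      then have "r \<in> dist p ` (B \<inter> f -` {y'})" by blast
      then show False using r(3) by simp
    qed
    ultimately have "\<exists>\<mu>>0. \<forall>v\<in>f ` (B \<inter> sphere p r). \<mu> \<le> dist y' v"
      using separate_point_closed[OF compact_imp_closed] by blast
    then obtain \<mu> where \<mu>0: "\<mu> > 0" "\<And>v. v \<in> f ` (B \<inter> sphere p r) \<Longrightarrow> \<mu> \<le> dist y' v" by blast
    have \<mu>: "\<mu> \<le> dist y' (f x)" if "x \<in> B" "dist p x = r" for x
      using \<mu>0(2)[of "f x"] that by simp
    have "open ?V" "y' \<in> ?V" using p by (auto simp: y'_def)
    then obtain R0 where R0: "R0 > 0" "cball y' R0 \<subseteq> ?V" using open_contains_cball by blast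
    \<comment> \<open>\<open>R < \<mu>\<close> keeps the separating sphere out of the preimage of
      \<open>cball y' R\<close>, which therefore splits; \<open>2 * R \<le> \<delta>/2\<close> keeps
      the modified map within the tolerance.\<close>
    define R where "R = Min {R0, \<mu>/2, \<delta>/4}"
    have R: "R > 0" "cball y' R \<subseteq> ?V" "R < \<mu>" "2 * R \<le> \<delta>/2"
      using R0 \<mu>0 \<delta> by (auto simp: R_def min_def)
    have sphere_out: "dist p x \<noteq> r" if "x \<in> B" "f x \<in> cball y' R" for x
      using \<mu>[OF that(1)] that(2) R by force
    have ballV: "ball y' R \<subseteq> ?V" using R(2) ball_subset_cball by blast
    have pB: "p \<in> ball p r" "f p \<in> ball y' R" "f q \<in> ball y' R" using r R q by (auto simp: y'_def)
    obtain y0 where y0: "y0 \<in> ball y' R" "\<And>x. x \<in> B \<Longrightarrow> f x = y0 \<Longrightarrow> x \<in> ball p r"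
      using localize[OF B p(1) pB(1) open_ball pB(2) open_ball ballV] by blast
    have "open {x. r < dist p x}" by (intro open_Collect_less continuous_intros)
    then obtain y1 where y1: "y1 \<in> ball y' R" "\<And>x. x \<in> B \<Longrightarrow> f x = y1 \<Longrightarrow> r < dist p x"
      using localize[OF B q(1), of "{x. r < dist p x}", OF _ _ pB(3) open_ball ballV] r(2) by blast
    have "frontier (cball y' R) retract_of (- {y1})"
      using y1 R by (intro frontier_retract_of_punctured_universe) auto
    then obtain \<pi> where ret: "retraction (- {y1}) (sphere y' R) \<pi>"
      by (auto simp: retract_of_def)
    have \<pi>: "continuous_on (- {y1}) \<pi>" "\<And>v. v \<noteq> y1 \<Longrightarrow> \<pi> v \<in> sphere y' R"
        "\<And>v. v \<in> sphere y' R \<Longrightarrow> \<pi> v = v"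
      using ret unfolding retraction_def by blast+
    \<comment> \<open>\<open>?G\<close> and \<open>?H\<close> are closed and cover \<open>B\<close>.
      On their overlap the distance to \<open>p\<close> is not \<open>r\<close>, so
      \<open>f x\<close> lies on the sphere around \<open>y'\<close>, where the retraction is the
      identity and the two definitions of \<open>g\<close> agree.\<close>
    let ?G = "{x\<in>B. f x \<in> cball y' R \<and> dist p x \<le> r}"
    let ?H = "{x\<in>B. R \<le> dist y' (f x) \<or> r \<le> dist p x}"
    define g where "g x = (if x \<in> ?G then \<pi> (f x) else f x)" for x
    have BGH: "B = ?G \<union> ?H" by (auto simp: not_le)
    have contD: "continuous_on S (\<lambda>x. dist y' (f x))" for S by (intro continuous_intros cfS)
    have Gclosed: "closed ?G"
    proof -
      have "closed (B \<inter> {x. dist y' (f x) \<le> R} \<inter> {x. dist p x \<le> r})"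
        by (intro closed_Int closed\<B> B closed_Collect_le continuous_intros contD)
      then show ?thesis by (simp add: Int_def conj_assoc)
    qed
    have Hclosed: "closed ?H"
    proof -
      have "closed (B \<inter> ({x. R \<le> dist y' (f x)} \<union> {x. r \<le> dist p x}))"
        by (intro closed_Int closed_Un closed\<B> B closed_Collect_le continuous_intros contD)
      moreover have "?H = B \<inter> ({x. R \<le> dist y' (f x)} \<union> {x. r \<le> dist p x})" by auto
      ultimately show ?thesis by simp
    qed
    have Gy1: "f x \<noteq> y1" if "x \<in> ?G" for x using y1(2)[of x] that by force
    have "continuous_on (?G \<union> ?H) g"
      unfolding g_def
    proof (rule continuous_on_cases[OF Gclosed Hclosed])
      show "continuous_on ?G (\<lambda>x. \<pi> (f x))"
        by (rule continuous_on_compose2[OF \<pi>(1) cfS]) (use Gy1 in auto)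
      show "\<forall>x. x \<in> ?G \<and> x \<notin> ?G \<or> x \<in> ?H \<and> x \<in> ?G \<longrightarrow> \<pi> (f x) = f x"
      proof (intro allI impI)
        fix x assume "x \<in> ?G \<and> x \<notin> ?G \<or> x \<in> ?H \<and> x \<in> ?G"
        then have "x \<in> B" "f x \<in> cball y' R" "dist p x \<le> r" "R \<le> dist y' (f x) \<or> r \<le> dist p x" by auto
        with sphere_out[of x] have "f x \<in> sphere y' R" by force
        then show "\<pi> (f x) = f x" by (rule \<pi>(3))
      qed
    qed (rule cfS)
    then have "continuous_on B g" using BGH by simp
    moreover have "dist (g x) (f x) \<le> \<delta>/2" if "x \<in> B" for x
    proof (cases "x \<in> ?G")
      case True
      then have "\<pi> (f x) \<in> sphere y' R" using \<pi>(2) Gy1[OF True] by blast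
      then have "dist (\<pi> (f x)) (f x) \<le> 2 * R"
        using True dist_triangle2[of "\<pi> (f x)" "f x" y'] by (simp add: dist_commute)
      then show ?thesis using True R by (simp add: g_def)
    next
      case False
      then have "g x = f x" unfolding g_def by (rule if_not_P)
      then show ?thesis using \<delta> by simp
    qed
    moreover have "stably_covers f B y0 (\<delta>/2)" using stV[OF B] y0 R by force
    ultimately obtain x where x: "x \<in> B" "g x = y0" unfolding stably_covers_def by blast
    \<comment> \<open>On \<open>?G\<close> the values of \<open>g\<close> lie on the sphere and
      differ from \<open>y0\<close>; outside \<open>?G\<close> the map is still \<open>f\<close>,
      which takes the value \<open>y0\<close> only at points of \<open>?G\<close>.\<close>
    show False
    proof (cases "x \<in> ?G")
      case True
      then have "\<pi> (f x) \<in> sphere y' R" using \<pi>(2) Gy1[OF True] by blast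
      then show False using x y0(1) True by (auto simp: g_def)
    next
      case False
      then have "g x = f x" unfolding g_def by (rule if_not_P)
      then have fx: "f x = y0" using x by simp
      then show False using False y0 x by force
    qed
  qed
  obtain e where e: "bij_betw e {0..<m} \<B>"
    using ex_bij_betw_nat_finite[OF fin\<B>] \<B>(2) by auto
  have eB: "e j \<in> \<B>" if "j < m" for j using e that by (auto simp: bij_betw_def)
  obtain \<sigma> where \<sigma>: "\<sigma> > 0" "\<And>i j x x'. i < m \<Longrightarrow> j < m \<Longrightarrow> i \<noteq> j \<Longrightarrow> x \<in> e i \<Longrightarrow> x' \<in> e j \<Longrightarrow> \<sigma> \<le> dist x x'"
  proof (rule separated_compact_family[of m e])
    show "e i \<inter> e j = {}" if "i < m" "j < m" "i \<noteq> j" for i j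
    proof -
      have "e i \<noteq> e j" using that e by (auto simp: bij_betw_def inj_on_def)
      then show ?thesis using disj[OF eB eB] that by blast
    qed
  qed (use eB compact\<B> in auto)
  define \<phi> where "\<phi> j v = (SOME x. x \<in> e j \<and> f x = v)" for j v
  have \<phi>: "\<phi> j v \<in> e j" "f (\<phi> j v) = v" if "j < m" "v \<in> ?V" for j v
  proof -
    have "v \<in> f ` e j" using stably_covers_imp_mem[OF stV[OF eB[OF that(1)] that(2)]] \<delta> cfS by auto
    then have "\<exists>x. x \<in> e j \<and> f x = v" by auto
    from someI_ex[OF this] show "\<phi> j v \<in> e j" "f (\<phi> j v) = v" by (auto simp: \<phi>_def)
  qed
  have \<phi>f: "\<phi> j (f x) = x" if "j < m" "x \<in> e j" "f x \<in> ?V" for j x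
    using inj[OF eB[OF that(1)], of x "\<phi> j (f x)"] \<phi>[OF that(1,3)] that by simp
  \<comment> \<open>Continuity of the inverse comes from compactness of the preimage of a closed
    ball in \<open>e j\<close>, which is why the radius shrinks once more, to
    \<open>\<delta>/4\<close>.\<close>
  have cont\<phi>: "continuous_on (ball y (\<delta>/4)) (\<phi> j)" if "j < m" for j
  proof -
    let ?K = "e j \<inter> f -` cball y (\<delta>/4)"
    have sub: "cball y (\<delta>/4) \<subseteq> ?V" using \<delta> by auto
    have "closed (f -` cball y (\<delta>/4))" using cf by (simp add: closed_vimage)
    then have "compact ?K" using compact\<B>[OF eB[OF that]] by (simp add: compact_Int_closed)
    then have "continuous_on (f ` ?K) (\<phi> j)"
      by (rule continuous_on_inv[OF cfS]) (use \<phi>f[OF that] sub in auto)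
    moreover have "ball y (\<delta>/4) \<subseteq> f ` ?K"
    proof
      fix v assume v: "v \<in> ball y (\<delta>/4)"
      then have vc: "v \<in> cball y (\<delta>/4)" by simp
      then have "v \<in> ?V" using sub by blast
      then show "v \<in> f ` ?K" using \<phi>[OF that, of v] vc by (intro image_eqI[of _ _ "\<phi> j v"]) auto
    qed
    ultimately show ?thesis by (rule continuous_on_subset)
  qed
  show thesis
  proof (rule that[of y "\<delta>/4" m \<phi> \<sigma>], unfold_locales)
    have V4: "v \<in> ?V" if "v \<in> ball y (\<delta>/4)" for v using that \<delta> by auto
    show "f (\<phi> j v) = v" if "j < m" "v \<in> ball y (\<delta>/4)" for j v using \<phi> that V4 by blast
    show "\<exists>j<m. x = \<phi> j (f x)" if "f x \<in> ball y (\<delta>/4)" for x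
    proof -
      have "x \<in> \<Union>\<B>" using in\<B> V4 that by blast
      then obtain j where "j < m" "x \<in> e j" using e by (auto simp: bij_betw_def)
      then show ?thesis using \<phi>f V4 that by metis
    qed
    show "\<sigma> \<le> dist (\<phi> i v) (\<phi> j w)"
      if "i < m" "j < m" "i \<noteq> j" "v \<in> ball y (\<delta>/4)" "w \<in> ball y (\<delta>/4)" for i j v w
      using \<sigma>(2)[OF that(1-3)] \<phi> that V4 by blast
    show "dist (\<phi> j v) (\<phi> j w) \<le> 4 * (real C)\<^sup>2 * dist v w"
      if "j < m" "v \<in> ball y (\<delta>/4)" "w \<in> ball y (\<delta>/4)" for j v w
    proof (cases "v = w")
      case False
      \<comment> \<open>The lifted segment is connected and lies over the ball of radius
        \<open>2 * dist v w\<close> around \<open>v\<close>, so regularity bounds its diameter. The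
        factor 2 makes room for the endpoint \<open>w\<close> in an open ball and produces the
        constant \<open>4 * C\<^sup>2\<close>.\<close>
      have seg: "closed_segment v w \<subseteq> ball y (\<delta>/4)"
        using that by (intro closed_segment_subset convex_ball)
      have "connected (\<phi> j ` closed_segment v w)"
        by (intro connected_continuous_image continuous_on_subset[OF cont\<phi>[OF that(1)] seg]) auto
      moreover have "\<phi> j ` closed_segment v w \<subseteq> f -` ball v (2 * dist v w)"
      proof
        fix x assume "x \<in> \<phi> j ` closed_segment v w"
        then obtain u where u: "u \<in> closed_segment v w" "x = \<phi> j u" by auto
        then have "f x = u" using \<phi>[OF that(1), of u] V4 seg by auto
        moreover have "dist v u \<le> dist v w"
          using dist_in_closed_segment[OF u(1)] by (simp add: dist_commute)
        ultimately show "x \<in> f -` ball v (2 * dist v w)" using False by simp (smt (verit) zero_less_dist_iff)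
      qed
      ultimately have "dist (\<phi> j v) (\<phi> j w) \<le> 2 * (real C)\<^sup>2 * (2 * dist v w)"
        using False by (intro regular_with_connected_dist[OF reg]) auto
      then show ?thesis by simp
    qed simp
    show "0 < 4 * (real C)\<^sup>2" using reg by (simp add: regular_with_def)
  qed (use \<delta> \<sigma> \<open>m > 0\<close> in auto)
qed

section \<open>A multiscale density\<close>

definition cube :: "real^'n \<Rightarrow> real \<Rightarrow> (real^'n) set" where
  "cube x s = {z. \<forall>i. x $ i \<le> z $ i \<and> z $ i \<le> x $ i + s}"

lemma cube_eq_cbox: "cube x s = cbox x (\<chi> i. x $ i + s)"
  by (auto simp: cube_def mem_box_cart)

lemma compact_cube: "compact (cube x s)"
  by (simp add: cube_eq_cbox)

definition slab :: "'n \<Rightarrow> real \<Rightarrow> real \<Rightarrow> real^'n \<Rightarrow> real \<Rightarrow> (real^'n) set" where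
  "slab b p q x s = cbox (\<chi> c. if c = b then p else x $ c) (\<chi> c. if c = b then q else x $ c + s)"

lemma mem_slab: "z \<in> slab b p q x s \<longleftrightarrow> p \<le> z $ b \<and> z $ b \<le> q \<and> (\<forall>c. c \<noteq> b \<longrightarrow> x $ c \<le> z $ c \<and> z $ c \<le> x $ c + s)"
  by (auto simp: slab_def mem_box_cart)

lemma content_slab:
  fixes x :: "real^'n::finite"
  assumes "p \<le> q" "0 \<le> s"
  shows "measure lborel (slab b p q x s) = (q - p) * s ^ (CARD('n) - 1)"
proof -
  let ?l = "\<chi> c. if c = b then p else x $ c" and ?u = "\<chi> c. if c = b then q else x $ c + s"
  have "?l \<in> cbox ?l ?u" using assms by (auto simp: mem_box_cart)
  then have "cbox ?l ?u \<noteq> {}" by blast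
  then have "measure lborel (slab b p q x s) = (\<Prod>c\<in>UNIV. ?u $ c - ?l $ c)"
    unfolding slab_def by (rule content_cbox_cart)
  also have "\<dots> = (q - p) * (\<Prod>c\<in>UNIV-{b}. s)"
    by (subst prod.remove[of _ b]) auto
  finally show ?thesis by (simp add: card_Diff_singleton)
qed

lemma cube_eq_slab: "cube x s = slab b (x $ b) (x $ b + s) x s"
  by (auto simp: mem_slab cube_def)

lemma content_cube:
  fixes x :: "real^'n::finite"
  assumes "0 \<le> s"
  shows "measure lborel (cube x s) = s ^ CARD('n)"
proof -
  have "s * s ^ (CARD('n) - 1) = s ^ CARD('n)" by (metis Suc_diff_1 power_Suc zero_less_card_finite)
  then show ?thesis using assms by (simp add: cube_eq_slab[of x s undefined] content_slab)
qed

section \<open>Oscillating functions and cut-offs\<close>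

lemma sin_ge_half:
  assumes "1/6 \<le> t" "t \<le> 5/6"
  shows "1/2 \<le> sin (pi * t)"
proof (cases "t \<le> 1/2")
  case True
  then have "pi * t \<le> pi * (1/2)" "pi * (1/6) \<le> pi * t" using assms by (intro mult_left_mono; simp)+
  then have "sin (pi / 6) \<le> sin (pi * t)" by (intro sin_monotone_2pi_le) auto
  then show ?thesis by (simp add: sin_30)
next
  case False
  have "pi * (1 - t) \<le> pi * (1/2)" "pi * (1/6) \<le> pi * (1 - t)" using assms False by (intro mult_left_mono; simp)+
  then have "sin (pi / 6) \<le> sin (pi * (1 - t))" by (intro sin_monotone_2pi_le) auto
  also have "sin (pi * (1 - t)) = sin (pi * t)" by (simp add: right_diff_distrib)
  finally show ?thesis by (simp add: sin_30)
qed

text \<open>The sine has half-period \<open>s\<close>, so its sign is constant on each aligned cube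
  and alternates with \<open>k\<close>. On the middle two thirds of the cube its modulus is at least
  \<open>1/2\<close>, whence the third of the volume.\<close>

lemma integral_sin_cube:
  fixes x :: "real^'n::finite"
  assumes "0 < s" "x $ a = s * of_int k"
  shows "s ^ CARD('n) / 3 \<le> (if even k then 1 else -1) * integral (cube x s) (\<lambda>z. sin (pi * z $ a / s))"
proof -
  define \<sigma> :: real where "\<sigma> = (if even k then 1 else -1)"
  define G where "G z = \<sigma> * sin (pi * z $ a / s)" for z :: "real^'n"
  have G: "G z = sin (pi * (z $ a / s - of_int k))" for z
  proof -
    have "pi * z $ a / s = pi * of_int k + pi * (z $ a / s - of_int k)" by (simp add: algebra_simps)
    then have "sin (pi * z $ a / s) = \<sigma> * sin (pi * (z $ a / s - of_int k))"
      by (simp only: sin_add cos_npi_int sin_npi_int \<sigma>_def)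
    then show ?thesis by (simp add: G_def \<sigma>_def)
  qed
  let ?S = "slab a (x $ a + s/6) (x $ a + 5 * s / 6) x s"
  have int: "G integrable_on cbox p q" for p q
    unfolding G_def by (intro integrable_continuous continuous_intros) (use assms in auto)
  have sub: "?S \<subseteq> cube x s" using assms by (auto simp: mem_slab cube_eq_slab[of x s a])
  have "s ^ CARD('n) / 3 = integral ?S (\<lambda>z. 1/2)"
  proof -
    have "integral ?S (\<lambda>z. 1/2) = measure lborel ?S * (1/2)" by (simp add: slab_def)
    also have "measure lborel ?S = (2 * s / 3) * s ^ (CARD('n) - 1)"
      using assms by (subst content_slab) auto
    also have "\<dots> * (1/2) = s * s ^ (CARD('n) - 1) / 3" by simp
    also have "s * s ^ (CARD('n) - 1) = s ^ CARD('n)" by (metis Suc_diff_1 power_Suc zero_less_card_finite)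
    finally show ?thesis by simp
  qed
  also have "\<dots> \<le> integral ?S G"
  proof (rule integral_le)
    show "(\<lambda>z. 1/2) integrable_on ?S" "G integrable_on ?S" using int by (auto simp: slab_def integrable_const)
    fix z assume "z \<in> ?S"
    then have "s * of_int k + s/6 \<le> z $ a" "z $ a \<le> s * of_int k + 5 * s / 6" using assms(2) by (auto simp: mem_slab)
    then have "1/6 \<le> z $ a / s - of_int k" "z $ a / s - of_int k \<le> 5/6" using assms(1) by (simp_all add: field_simps)
    then show "1/2 \<le> G z" unfolding G by (rule sin_ge_half)
  qed
  also have "\<dots> \<le> integral (cube x s) G"
  proof (rule integral_subset_le[OF sub])
    show "G integrable_on ?S" "G integrable_on cube x s" using int by (auto simp: slab_def cube_eq_cbox)
    show "\<forall>z\<in>cube x s. 0 \<le> G z"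
    proof
      fix z assume "z \<in> cube x s"
      then have "s * of_int k \<le> z $ a" "z $ a \<le> s * of_int k + s" unfolding cube_def assms(2)[symmetric] by auto
      then have "0 \<le> z $ a / s - of_int k" "z $ a / s - of_int k \<le> 1" using assms(1) by (simp_all add: field_simps)
      then show "0 \<le> G z" unfolding G by (intro sin_ge_zero) (auto simp: mult_le_cancel_left1)
    qed
  qed
  also have "\<dots> = \<sigma> * integral (cube x s) (\<lambda>z. sin (pi * z $ a / s))"
    unfolding G_def by (rule integral_mult_right)
  finally show ?thesis by (simp add: \<sigma>_def)
qed

text \<open>A continuous cut-off of period \<open>p\<close>, equal to 1 on the teeth and 0 at
  distance \<open>w\<close> from them. The teeth are where the finer scales live.\<close>

definition comb :: "real \<Rightarrow> real \<Rightarrow> real \<Rightarrow> real" where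
  "comb p w t = max 0 (1 - infdist t (\<Union>k::int. {of_int k * p..of_int k * p + w}) / w)"

lemma comb_bounds: "0 < w \<Longrightarrow> 0 \<le> comb p w t" "0 < w \<Longrightarrow> comb p w t \<le> 1"
  by (auto simp: comb_def infdist_nonneg)

lemma continuous_on_comb [continuous_intros]:
  assumes "continuous_on S f" "0 < w"
  shows "continuous_on S (\<lambda>x. comb p w (f x))"
  unfolding comb_def by (intro continuous_intros assms) (use assms in auto)

lemma comb_eq_1:
  assumes "of_int k * p \<le> t" "t \<le> of_int k * p + w"
  shows "comb p w t = 1"
proof -
  have "t \<in> (\<Union>k::int. {of_int k * p..of_int k * p + w})" using assms by auto
  then show ?thesis by (simp add: comb_def)
qed

lemma comb_nonzero:
  assumes "0 < w" "comb p w t \<noteq> 0"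
  obtains k :: int where "of_int k * p - w < t" "t < of_int k * p + 2 * w"
proof -
  let ?L = "\<Union>k::int. {of_int k * p..of_int k * p + w}"
  have ne: "?L \<noteq> {}" using assms(1) by (auto intro!: exI[of _ 0] exI[of _ 0])
  have "infdist t ?L < w" using assms by (auto simp: comb_def max_def field_simps split: if_splits)
  then have "\<exists>y\<in>?L. dist t y < w"
    unfolding infdist_notempty[OF ne] by (subst (asm) cINF_less_iff) (use ne in \<open>auto intro!: bdd_belowI2[where m = 0]\<close>)
  then obtain y where y: "y \<in> ?L" "dist t y < w" by blast
  then obtain k :: int where "of_int k * p \<le> y" "y \<le> of_int k * p + w" by auto
  then show thesis using y(2) by (intro that[of k]) (auto simp: dist_real_def)
qed

text \<open>A cube of side \<open>M * p\<close> aligned with the comb meets only the teeth numbered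
  \<open>q\<close> to \<open>q + M\<close>. A tooth with its two ramps fits into a slab of thickness
  \<open>3 * w\<close>.\<close>

lemma integral_comb_cube:
  fixes x :: "real^'n::finite"
  assumes "0 < w" "2 * w \<le> p" "x $ b = of_int q * p" "s = real M * p"
  shows "integral (cube x s) (\<lambda>z. comb p w (z $ b)) \<le> (real M + 1) * (3 * w * s ^ (CARD('n) - 1))"
proof -
  have "p > 0" "s \<ge> 0" using assms by auto
  let ?B = "\<lambda>k. slab b (of_int k * p - w) (of_int k * p + 2 * w) x s"
  have "integral (cube x s) (\<lambda>z. comb p w (z $ b)) \<le> integral (cube x s) (\<lambda>z. \<Sum>k\<in>{q..q + int M}. indicat_real (?B k) z)"
  proof (rule integral_le)
    show "(\<lambda>z. comb p w (z $ b)) integrable_on cube x s"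
      unfolding cube_eq_cbox by (intro integrable_continuous continuous_intros assms)
    show "(\<lambda>z. \<Sum>k\<in>{q..q + int M}. indicat_real (?B k) z) integrable_on cube x s"
      by (intro integrable_sum) (auto simp: integrable_on_indicator slab_def cube_eq_cbox intro: lmeasurable_compact compact_Int)
    fix z assume z: "z \<in> cube x s"
    show "comb p w (z $ b) \<le> (\<Sum>k\<in>{q..q + int M}. indicat_real (?B k) z)"
    proof (cases "comb p w (z $ b) = 0")
      case False
      then obtain k :: int where k: "of_int k * p - w < z $ b" "z $ b < of_int k * p + 2 * w"
        using comb_nonzero[OF assms(1)] by blast
      have zb: "of_int q * p \<le> z $ b" "z $ b \<le> of_int q * p + real M * p"
        using z assms(3,4) by (auto simp: cube_def; metis)+
      have "of_int k * p < (of_int q + real M + 1) * p" using k(1) zb(2) assms(1,2) by (simp add: algebra_simps)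
      then have "real_of_int k < of_int q + real M + 1" using \<open>p > 0\<close> by simp
      moreover have "(of_int q - 1) * p < of_int k * p" using k(2) zb(1) assms(1,2) by (simp add: algebra_simps)
      then have "real_of_int q - 1 < of_int k" using \<open>p > 0\<close> by simp
      ultimately have "k \<in> {q..q + int M}" by auto
      moreover have "indicat_real (?B k) z = 1" using k z by (auto simp: mem_slab cube_def)
      ultimately have "1 \<le> (\<Sum>k\<in>{q..q + int M}. indicat_real (?B k) z)"
        by (metis (no_types, lifting) finite_atLeastAtMost_int indicator_pos_le member_le_sum)
      then show ?thesis using comb_bounds(2)[OF assms(1), of p "z $ b"] by linarith
    qed (auto intro: sum_nonneg)
  qed
  also have "\<dots> = (\<Sum>k\<in>{q..q + int M}. integral (cube x s) (indicat_real (?B k)))"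
    by (intro integral_sum) (auto simp: integrable_on_indicator slab_def cube_eq_cbox intro: lmeasurable_compact compact_Int)
  also have "\<dots> \<le> (\<Sum>k\<in>{q..q + int M}. 3 * w * s ^ (CARD('n) - 1))"
  proof (rule sum_mono)
    fix k
    have cpt: "compact (?B k)" "compact (?B k \<inter> cube x s)" by (auto simp: slab_def cube_eq_cbox intro: compact_Int)
    have "integral (cube x s) (indicat_real (?B k)) = measure lebesgue (?B k \<inter> cube x s)"
      by (rule integral_indicator) (use cpt in \<open>auto intro: lmeasurable_compact\<close>)
    also have "\<dots> \<le> measure lebesgue (?B k)"
      by (intro measure_mono_fmeasurable) (use cpt in \<open>auto intro: lmeasurable_compact fmeasurableD\<close>)
    also have "\<dots> = measure lborel (?B k)" by (simp add: slab_def)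
    also have "\<dots> = 3 * w * s ^ (CARD('n) - 1)" using assms \<open>s \<ge> 0\<close> by (subst content_slab) auto
    finally show "integral (cube x s) (indicat_real (?B k)) \<le> 3 * w * s ^ (CARD('n) - 1)" .
  qed
  also have "\<dots> = (real M + 1) * (3 * w * s ^ (CARD('n) - 1))" by simp
  finally show ?thesis .
qed

section \<open>Nearly equal increments or stretching along a row\<close>

definition sq_incr :: "nat \<Rightarrow> (nat \<Rightarrow> 'a \<Rightarrow> 'b::real_normed_vector) \<Rightarrow> 'a \<Rightarrow> 'a \<Rightarrow> real" where
  "sq_incr m h x y = (\<Sum>j<m. (norm (h j y - h j x))\<^sup>2)"

lemma norm_le_card_bound:
  fixes v :: "real^'n::finite" and t :: real
  assumes "\<And>c. \<bar>v $ c\<bar> \<le> t"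
  shows "norm v \<le> CARD('n) * t"
proof -
  have "norm v \<le> (\<Sum>c\<in>UNIV. \<bar>v $ c\<bar>)" by (rule norm_le_l1_cart)
  also have "\<dots> \<le> (\<Sum>c\<in>(UNIV::'n set). t)" by (intro sum_mono assms)
  finally show ?thesis by simp
qed

lemma norm_axis_real: "norm (axis a t :: real^'n::finite) = \<bar>t\<bar>"
proof -
  have "axis a t = (t *\<^sub>R axis a 1 :: real^'n)" by (simp add: vec_eq_iff axis_def)
  then show ?thesis by simp
qed

text \<open>If no grid increment is longer than the average by the factor \<open>1 + \<kappa>\<close> (in the square mean over
  \<open>j\<close>), then the increments have small variance, so that many consecutive ones are almost equal.\<close>

lemma sum_deviation_bound:
  fixes a :: "nat \<Rightarrow> nat \<Rightarrow> 'b::real_inner" and u :: "nat \<Rightarrow> 'b"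
  assumes tot: "\<And>j. j < m \<Longrightarrow> norm ((\<Sum>i<n. a i j) - (real n + 1) *\<^sub>R u j) \<le> c"
    and u: "\<And>j. j < m \<Longrightarrow> norm (u j) \<le> U" and "0 \<le> c" "0 \<le> U" "0 \<le> \<kappa>"
    and small: "\<And>i. i < n \<Longrightarrow> (\<Sum>j<m. (norm (a i j))\<^sup>2) \<le> (1 + \<kappa>) * (\<Sum>j<m. (norm (u j))\<^sup>2)"
  shows "(\<Sum>i<n. \<Sum>j<m. (norm (a i j - u j))\<^sup>2) \<le> real n * \<kappa> * (real m * U\<^sup>2) + 2 * real m * c * U"
proof -
  define V where "V = (\<Sum>j<m. (norm (u j))\<^sup>2)"
  have "V \<ge> 0" by (auto simp: V_def intro: sum_nonneg)
  have "V \<le> (\<Sum>j<m. U\<^sup>2)" unfolding V_def by (intro sum_mono power_mono u) auto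
  then have V: "V \<le> real m * U\<^sup>2" by simp
  \<comment> \<open>The factor is \<open>n + 1\<close> and not \<open>n\<close>: in the application
    there are \<open>N - 1\<close> increments between neighbouring cubes, while \<open>u j\<close>
    is the N-th part of the whole displacement.\<close>
  have dot: "(norm (u j))\<^sup>2 * (real n + 1) - c * U \<le> (\<Sum>i<n. a i j) \<bullet> u j" if "j < m" for j
  proof -
    let ?e = "(\<Sum>i<n. a i j) - (real n + 1) *\<^sub>R u j"
    have "\<bar>?e \<bullet> u j\<bar> \<le> norm ?e * norm (u j)" by (rule Cauchy_Schwarz_ineq2)
    also have "\<dots> \<le> c * U" using tot[OF that] u[OF that] \<open>0 \<le> c\<close> by (intro mult_mono) auto
    finally have "- (c * U) \<le> ?e \<bullet> u j" by linarith
    then show ?thesis by (simp add: inner_diff_left power2_norm_eq_inner mult.commute)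
  qed
  have "(\<Sum>i<n. \<Sum>j<m. (norm (a i j - u j))\<^sup>2)
      = (\<Sum>i<n. \<Sum>j<m. (norm (a i j))\<^sup>2) + (\<Sum>i<n. V) - 2 * (\<Sum>j<m. (\<Sum>i<n. a i j) \<bullet> u j)"
  proof -
    have "(norm (a i j - u j))\<^sup>2 = (norm (a i j))\<^sup>2 + (norm (u j))\<^sup>2 - 2 * (a i j \<bullet> u j)" for i j
      by (simp add: power2_norm_eq_inner inner_diff_left inner_diff_right inner_commute)
    then have "(\<Sum>i<n. \<Sum>j<m. (norm (a i j - u j))\<^sup>2)
        = (\<Sum>i<n. \<Sum>j<m. (norm (a i j))\<^sup>2) + (\<Sum>i<n. V) - 2 * (\<Sum>i<n. \<Sum>j<m. a i j \<bullet> u j)"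
      by (simp add: sum.distrib sum_subtractf V_def sum_distrib_left)
    also have "(\<Sum>i<n. \<Sum>j<m. a i j \<bullet> u j) = (\<Sum>j<m. (\<Sum>i<n. a i j) \<bullet> u j)"
      by (subst sum.swap) (simp add: inner_sum_left)
    finally show ?thesis .
  qed
  also have "\<dots> \<le> (\<Sum>i<n. (1 + \<kappa>) * V) + (\<Sum>i<n. V) - 2 * (\<Sum>j<m. (norm (u j))\<^sup>2 * (real n + 1) - c * U)"
    using small dot unfolding V_def by (intro diff_mono add_mono mult_left_mono sum_mono) auto
  also have "(\<Sum>j<m. (norm (u j))\<^sup>2 * (real n + 1) - c * U) = V * (real n + 1) - real m * (c * U)"
    by (simp add: V_def sum_subtractf sum_distrib_right)
  also have "(\<Sum>i<n. (1 + \<kappa>) * V) + (\<Sum>i<n. V) - 2 * (V * (real n + 1) - real m * (c * U))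
      = real n * \<kappa> * V - 2 * V + 2 * real m * c * U"
    by (simp add: algebra_simps)
  also have "\<dots> \<le> real n * \<kappa> * (real m * U\<^sup>2) + 2 * real m * c * U"
    using mult_left_mono[OF V, of "real n * \<kappa>"] \<open>0 \<le> \<kappa>\<close> \<open>V \<ge> 0\<close> by simp
  finally show ?thesis .
qed

lemma finite_grid: "finite {w :: 'n::finite \<Rightarrow> nat. \<forall>c. w c < M}"
proof -
  have "{w :: 'n \<Rightarrow> nat. \<forall>c. w c < M} \<subseteq> (UNIV \<rightarrow>\<^sub>E {..<M})"
    by (auto simp: PiE_def extensional_def)
  then show ?thesis by (rule finite_subset) (auto intro: finite_PiE)
qed

text \<open>One index \<open>i\<close> serves all maps in the first alternative, and in the second
  the stretching is measured for all maps together by \<open>sq_incr\<close>. The starting point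
  \<open>x'\<close> is taken from a grid of mesh \<open>s / M\<close>, so that a row starting there
  fits the periodic density of the next scale.\<close>

definition translates_or_stretches ::
    "nat \<Rightarrow> real \<Rightarrow> real \<Rightarrow> 'n::finite \<Rightarrow> nat \<Rightarrow> real \<Rightarrow> nat \<Rightarrow> bool" where
  "translates_or_stretches m K \<eta> a M \<kappa> N \<longleftrightarrow>
    (\<forall>(h :: nat \<Rightarrow> real^'n \<Rightarrow> real^'n) x l s. 0 < l \<longrightarrow> s = l / real N \<longrightarrow>
      (\<forall>j<m. K-lipschitz_on (cube x l) (h j)) \<longrightarrow>
      (\<exists>i u. i + 1 < N \<and> (\<forall>j<m. \<forall>z\<in>cube (x + axis a (real i * s)) s.
          norm (h j (z + axis a s) - h j z - u j) \<le> \<eta> * s)) \<or>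
      (\<exists>i w. i + 1 < N \<and> (\<forall>c. w c < M) \<and>
         (let x' = x + axis a (real i * s) + (\<chi> c. s * real (w c) / real M) in
           (1 + \<kappa>) * (sq_incr m h x (x + axis a l) / l\<^sup>2) \<le> sq_incr m h x' (x' + axis a s) / s\<^sup>2)))"

text \<open>If no pair is stretched, \<open>sum_deviation_bound\<close> applies along each line
  through a grid point of the first cube. Averaging over \<open>i\<close> gives a cube in which all
  increments, for all grid points and all maps, are close to the mean; Lipschitz continuity passes
  from the grid to the whole cube. It matters for the later induction that \<open>M\<close> and
  \<open>\<kappa>\<close> are fixed before \<open>N\<close>.\<close>

lemma translation_or_stretch:
  fixes K \<eta> :: real and m :: nat and a :: "'n::finite"
  assumes "0 < K" "0 < \<eta>"
  obtains M N0 :: nat and \<kappa> :: real where "0 < M" "0 < \<kappa>"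
    "\<forall>N\<ge>N0. translates_or_stretches m K \<eta> a M \<kappa> N"
proof -
  define d where "d = real CARD('n)"
  have d: "d \<ge> 1" unfolding d_def by (simp add: Suc_leI)
  \<comment> \<open>Moving a point and its translate to the grid costs \<open>K * d * s / M\<close>
    each; this \<open>M\<close> limits both together to \<open>\<eta> * s / 2\<close>.\<close>
  obtain M :: nat where M: "4 * K * d / \<eta> < real M" using reals_Archimedean2 by blast
  have "0 < 4 * K * d / \<eta>" using assms d by simp
  then have "real M > 0" using M by linarith
  then have "M > 0" by simp
  define G where "G = {w :: 'n \<Rightarrow> nat. \<forall>c. w c < M}"
  have finG: "finite G" unfolding G_def by (rule finite_grid)
  define g where "g = real (card G)"
  have "g \<ge> 0" by (simp add: g_def)
  \<comment> \<open>Summed over the \<open>g\<close> grid lines, the part of the deviation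
    proportional to \<open>\<kappa>\<close> stays below \<open>N * \<eta>\<^sup>2 / 16\<close>, in
    units of \<open>s\<^sup>2\<close>.\<close>
  define \<kappa> where "\<kappa> = \<eta>\<^sup>2 / (16 * (g * real m * K\<^sup>2 + 1))"
  have den: "g * real m * K\<^sup>2 + 1 > 0" using \<open>g \<ge> 0\<close> by (simp add: add_nonneg_pos)
  then have "\<kappa> > 0" using assms by (simp add: \<kappa>_def)
  have g\<kappa>: "g * \<kappa> * real m * K\<^sup>2 \<le> \<eta>\<^sup>2 / 16"
  proof -
    have "\<kappa> * (g * real m * K\<^sup>2) \<le> \<kappa> * (g * real m * K\<^sup>2 + 1)" using \<open>\<kappa> > 0\<close> by simp
    also have "\<dots> = \<eta>\<^sup>2 / 16" using den unfolding \<kappa>_def by (simp add: field_simps)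
    finally show ?thesis by (simp add: mult_ac)
  qed
  \<comment> \<open>The error from the two ends of a grid line does not grow with the number of
    cubes, so for large \<open>N\<close> it is absorbed as well. At least two cubes are needed to
    have a neighbouring pair.\<close>
  obtain N0' :: nat where N0': "16 * (g * (6 * real m * d * K\<^sup>2)) / \<eta>\<^sup>2 < real N0'" using reals_Archimedean2 by blast
  define N0 where "N0 = max 2 N0'"
  show thesis
  proof (rule that[OF \<open>M > 0\<close> \<open>\<kappa> > 0\<close>, of N0], unfold translates_or_stretches_def, intro allI impI)
    fix N :: nat and h :: "nat \<Rightarrow> real^'n \<Rightarrow> real^'n" and x l s
    assume N: "N0 \<le> N" and l: "0 < l" and s: "s = l / real N"
      and lip0: "\<forall>j<m. K-lipschitz_on (cube x l) (h j)"
    have lip: "K-lipschitz_on (cube x l) (h j)" if "j < m" for j using lip0 that by blast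
    have N2: "2 \<le> N" "N0' \<le> N" using N by (auto simp: N0_def)
    have "s > 0" using l N2 by (simp add: s)
    have ls: "l = real N * s" using N2 by (simp add: s)
    have Nbig: "g * (6 * real m * d * K\<^sup>2) \<le> real N * \<eta>\<^sup>2 / 16"
    proof -
      have "16 * (g * (6 * real m * d * K\<^sup>2)) / \<eta>\<^sup>2 \<le> real N" using N0' N2 by linarith
      then show ?thesis using assms by (simp add: field_simps)
    qed
    define P where "P w i = x + axis a (real i * s) + (\<chi> c. s * real (w c) / real M)" for w i
    define q where "q w c = s * real (w c) / real M" for w :: "'n \<Rightarrow> nat" and c
    have Pnth: "P w i $ c = x $ c + (if c = a then real i * s else 0) + q w c" for w i c
      by (simp add: P_def q_def axis_def)
    have off: "0 \<le> q w c" "q w c \<le> s" if "w \<in> G" for w c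
    proof -
      show "0 \<le> q w c" using \<open>s > 0\<close> by (simp add: q_def)
      have "w c < M" using that by (simp add: G_def)
      then have "s * real (w c) \<le> s * real M" using \<open>s > 0\<close> by simp
      then show "q w c \<le> s" using \<open>M > 0\<close> by (simp add: q_def field_simps)
    qed
    have sl: "s \<le> l" using N2 \<open>s > 0\<close> by (simp add: ls)
    have isl: "real i * s + s \<le> l" if "i < N" for i
    proof -
      have "(real i + 1) * s \<le> real N * s" using that \<open>s > 0\<close> by (intro mult_right_mono) auto
      then show ?thesis by (simp add: ls algebra_simps)
    qed
    have Pin: "P w i \<in> cube x l" if "w \<in> G" "i < N" for w i
      using off[OF that(1)] isl[OF that(2)] sl \<open>s > 0\<close>
      unfolding cube_def mem_Collect_eq Pnth
      by (auto intro: add_nonneg_nonneg) (smt (verit) that)+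
    have x_in: "x \<in> cube x l" "x + axis a l \<in> cube x l" using l by (auto simp: cube_def axis_def)
    define u where "u j = (h j (x + axis a l) - h j x) /\<^sub>R real N" for j
    define A where "A w i j = h j (P w (Suc i)) - h j (P w i)" for w i j
    have usum: "(\<Sum>j<m. (norm (u j))\<^sup>2) = sq_incr m h x (x + axis a l) / (real N)\<^sup>2"
    proof -
      have "(norm (u j))\<^sup>2 = (norm (h j (x + axis a l) - h j x))\<^sup>2 / (real N)\<^sup>2" for j
        by (simp add: u_def divide_inverse power_mult_distrib power_inverse)
      then show ?thesis by (simp add: sq_incr_def sum_divide_distrib)
    qed
    have lipn: "norm (h j p - h j q) \<le> K * norm (p - q)" if "j < m" "p \<in> cube x l" "q \<in> cube x l" for j p q
      using lipschitz_onD[OF lip[OF that(1)] that(2,3)] by (simp add: dist_norm)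
    have u_le: "norm (u j) \<le> K * s" if "j < m" for j
    proof -
      have "norm (h j (x + axis a l) - h j x) \<le> K * l"
        using lipn[OF that x_in(2,1)] l by (simp add: norm_axis_real)
      then have "norm (u j) \<le> K * l / real N"
        by (simp add: u_def divide_inverse mult.commute mult_left_mono)
      then show ?thesis by (simp add: s)
    qed
    show "(\<exists>i u. i + 1 < N \<and> (\<forall>j<m. \<forall>z\<in>cube (x + axis a (real i * s)) s.
          norm (h j (z + axis a s) - h j z - u j) \<le> \<eta> * s)) \<or>
      (\<exists>i w. i + 1 < N \<and> (\<forall>c. w c < M) \<and>
         (let x' = x + axis a (real i * s) + (\<chi> c. s * real (w c) / real M) in
           (1 + \<kappa>) * (sq_incr m h x (x + axis a l) / l\<^sup>2) \<le> sq_incr m h x' (x' + axis a s) / s\<^sup>2))"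
    proof (rule disjCI)
      assume noB: "\<not> (\<exists>i w. i + 1 < N \<and> (\<forall>c. w c < M) \<and>
         (let x' = x + axis a (real i * s) + (\<chi> c. s * real (w c) / real M) in
           (1 + \<kappa>) * (sq_incr m h x (x + axis a l) / l\<^sup>2) \<le> sq_incr m h x' (x' + axis a s) / s\<^sup>2))"
      have PS: "P w (Suc i) = P w i + axis a s" for w i
        by (simp add: vec_eq_iff Pnth axis_def algebra_simps)
      have small: "(\<Sum>j<m. (norm (A w i j))\<^sup>2) \<le> (1 + \<kappa>) * (\<Sum>j<m. (norm (u j))\<^sup>2)" if "w \<in> G" "i < N - 1" for w i
      proof -
        have "sq_incr m h (P w i) (P w i + axis a s) / s\<^sup>2 < (1 + \<kappa>) * (sq_incr m h x (x + axis a l) / l\<^sup>2)"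
        proof (rule ccontr)
          assume "\<not> ?thesis"
          moreover have "i + 1 < N" "\<forall>c. w c < M" using that by (auto simp: G_def)
          ultimately show False using noB unfolding P_def Let_def not_less by blast
        qed
        then have "sq_incr m h (P w i) (P w i + axis a s) < (1 + \<kappa>) * (sq_incr m h x (x + axis a l) / (real N)\<^sup>2)"
          using \<open>s > 0\<close> N2 by (simp add: ls power_mult_distrib field_simps)
        then show ?thesis by (simp add: usum A_def PS sq_incr_def)
      qed
      have dev: "(\<Sum>i<N-1. \<Sum>j<m. (norm (A w i j - u j))\<^sup>2) \<le> s\<^sup>2 * (real N * \<kappa> * real m * K\<^sup>2 + 6 * real m * d * K\<^sup>2)"
        if w: "w \<in> G" for w
      proof -
        have "(\<Sum>i<N-1. \<Sum>j<m. (norm (A w i j - u j))\<^sup>2)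
            \<le> real (N-1) * \<kappa> * (real m * (K * s)\<^sup>2) + 2 * real m * (3 * d * K * s) * (K * s)"
        proof (rule sum_deviation_bound)
          fix j assume j: "j < m"
          have tele: "(\<Sum>i<N-1. A w i j) = h j (P w (N-1)) - h j (P w 0)"
            unfolding A_def by (rule sum_lessThan_telescope)
          have Nu: "(real (N-1) + 1) *\<^sub>R u j = h j (x + axis a l) - h j x"
            using N2 by (simp add: u_def of_nat_diff)
          have "(\<Sum>i<N-1. A w i j) - (real (N-1) + 1) *\<^sub>R u j
              = (h j (P w (N-1)) - h j (x + axis a l)) - (h j (P w 0) - h j x)"
            unfolding tele Nu by (simp add: algebra_simps)
          then have "norm ((\<Sum>i<N-1. A w i j) - (real (N-1) + 1) *\<^sub>R u j)
              \<le> norm (h j (P w (N-1)) - h j (x + axis a l)) + norm (h j (P w 0) - h j x)"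
            using norm_triangle_ineq4 by metis
          also have "\<dots> \<le> K * norm (P w (N-1) - (x + axis a l)) + K * norm (P w 0 - x)"
            using Pin[OF w] N2 by (intro add_mono lipn j x_in) auto
          also have "\<dots> \<le> K * (d * (2 * s)) + K * (d * s)"
          proof (intro add_mono mult_left_mono)
            show "norm (P w (N-1) - (x + axis a l)) \<le> d * (2 * s)" unfolding d_def
            proof (rule norm_le_card_bound)
              fix c
              have "real (N-1) * s = l - s" using N2 by (simp add: ls of_nat_diff algebra_simps)
              then show "\<bar>(P w (N-1) - (x + axis a l)) $ c\<bar> \<le> 2 * s"
                using off[OF w, of c] \<open>s > 0\<close> by (auto simp: Pnth axis_def abs_le_iff)
            qed
            show "norm (P w 0 - x) \<le> d * s" unfolding d_def
              by (rule norm_le_card_bound) (use off[OF w] \<open>s > 0\<close> in \<open>simp add: Pnth abs_le_iff\<close>)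
          qed (use assms in auto)
          finally show "norm ((\<Sum>i<N-1. A w i j) - (real (N-1) + 1) *\<^sub>R u j) \<le> 3 * d * K * s"
            by (simp add: algebra_simps)
        qed (use u_le small[OF w] assms \<open>s > 0\<close> \<open>\<kappa> > 0\<close> d in \<open>auto intro!: mult_nonneg_nonneg\<close>)
        also have "\<dots> \<le> real N * \<kappa> * (real m * (K * s)\<^sup>2) + 2 * real m * (3 * d * K * s) * (K * s)"
          using \<open>\<kappa> > 0\<close> by (intro add_mono mult_right_mono order_refl) auto
        finally show ?thesis by (simp add: algebra_simps power2_eq_square)
      qed
      \<comment> \<open>Summing over grid points and maps before choosing \<open>i\<close> yields
        one index that is good for all of them. The count \<open>N - 1\<close> is at least
        \<open>N / 2\<close>.\<close>
      define E where "E i = (\<Sum>w\<in>G. \<Sum>j<m. (norm (A w i j - u j))\<^sup>2)" for i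
      have "\<exists>i<N-1. E i \<le> (\<eta> * s / 2)\<^sup>2"
      proof (rule ccontr)
        assume "\<not> ?thesis"
        then have "(\<Sum>i<N-1. (\<eta> * s / 2)\<^sup>2) < (\<Sum>i<N-1. E i)"
          using N2 by (intro sum_strict_mono) (auto simp: lessThan_empty_iff)
        also have "\<dots> = (\<Sum>w\<in>G. \<Sum>i<N-1. \<Sum>j<m. (norm (A w i j - u j))\<^sup>2)"
          unfolding E_def by (rule sum.swap)
        also have "\<dots> \<le> (\<Sum>w\<in>G. s\<^sup>2 * (real N * \<kappa> * real m * K\<^sup>2 + 6 * real m * d * K\<^sup>2))"
          by (intro sum_mono dev)
        also have "\<dots> = s\<^sup>2 * (real N * (g * \<kappa> * real m * K\<^sup>2) + g * (6 * real m * d * K\<^sup>2))"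
          by (simp add: g_def algebra_simps)
        also have "\<dots> \<le> s\<^sup>2 * (real N * (\<eta>\<^sup>2 / 16) + real N * \<eta>\<^sup>2 / 16)"
          by (intro mult_left_mono add_mono g\<kappa> Nbig) auto
        also have "\<dots> = s\<^sup>2 * \<eta>\<^sup>2 / 4 * (real N / 2)" by simp
        also have "\<dots> \<le> s\<^sup>2 * \<eta>\<^sup>2 / 4 * real (N - 1)" using N2 by (intro mult_left_mono) auto
        also have "\<dots> = (\<Sum>i<N-1. (\<eta> * s / 2)\<^sup>2)" by (simp add: power_mult_distrib power_divide)
        finally show False by simp
      qed
      then obtain i where i: "i < N - 1" "E i \<le> (\<eta> * s / 2)\<^sup>2" by blast
      have Au: "norm (A w i j - u j) \<le> \<eta> * s / 2" if "w \<in> G" "j < m" for w j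
      proof -
        have "(norm (A w i j - u j))\<^sup>2 \<le> (\<Sum>j<m. (norm (A w i j - u j))\<^sup>2)"
          using that by (intro member_le_sum) auto
        also have "\<dots> \<le> E i" unfolding E_def
          using that finG by (intro member_le_sum sum_nonneg) auto
        also have "\<dots> \<le> (\<eta> * s / 2)\<^sup>2" by fact
        finally show ?thesis by (rule power2_le_imp_le) (use assms \<open>s > 0\<close> in auto)
      qed
      have "norm (h j (z + axis a s) - h j z - u j) \<le> \<eta> * s"
        if j: "j < m" and z: "z \<in> cube (x + axis a (real i * s)) s" for j z
      proof -
        define b where "b = x + axis a (real i * s)"
        have zb: "0 \<le> z $ c - b $ c" "z $ c - b $ c \<le> s" for c
          using z by (auto simp: cube_def b_def algebra_simps)
        define t where "t c = real M * (z $ c - b $ c) / s" for c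
        have t: "0 \<le> t c" "t c \<le> real M" for c
        proof -
          show "0 \<le> t c" using zb(1)[of c] \<open>s > 0\<close> by (simp add: t_def)
          have "real M * (z $ c - b $ c) \<le> real M * s" using zb(2)[of c] by (intro mult_left_mono) auto
          then show "t c \<le> real M" using \<open>s > 0\<close> by (simp add: t_def pos_divide_le_eq)
        qed
        \<comment> \<open>Points on the upper face, where \<open>t c = M\<close>, are assigned to
          the last grid point \<open>M - 1\<close>.\<close>
        define w where "w c = min (M - 1) (nat \<lfloor>t c\<rfloor>)" for c
        have "w \<in> G" using \<open>M > 0\<close> by (auto simp: G_def w_def)
        have wt: "\<bar>t c - real (w c)\<bar> \<le> 1" for c
        proof (cases "nat \<lfloor>t c\<rfloor> \<le> M - 1")
          case True
          then have "real (w c) = of_int \<lfloor>t c\<rfloor>" using t[of c] by (simp add: w_def min_def)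
          then show ?thesis by linarith
        next
          case False
          then have "w c = M - 1" "real M \<le> t c" using t(1)[of c] \<open>M > 0\<close>
            by (auto simp: w_def min_def not_le) linarith
          then show ?thesis using t(2)[of c] \<open>M > 0\<close> by (simp add: of_nat_diff)
        qed
        have zP: "norm (z - P w i) \<le> d * (s / real M)" unfolding d_def
        proof (rule norm_le_card_bound)
          fix c
          have "z $ c - b $ c = t c * (s / real M)" using \<open>s > 0\<close> \<open>M > 0\<close> by (simp add: t_def)
          then have "(z - P w i) $ c = (t c - real (w c)) * (s / real M)"
            by (simp add: P_def b_def algebra_simps)
          then have "\<bar>(z - P w i) $ c\<bar> = \<bar>t c - real (w c)\<bar> * (s / real M)"
            using \<open>s > 0\<close> by (simp add: abs_mult)
          also have "\<dots> \<le> 1 * (s / real M)" using wt[of c] \<open>s > 0\<close> by (intro mult_right_mono) auto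
          finally show "\<bar>(z - P w i) $ c\<bar> \<le> s / real M" by simp
        qed
        have iN: "i < N" "Suc i < N" using i by auto
        have z_in: "z \<in> cube x l"
          using zb isl[OF iN(1)] sl \<open>s > 0\<close> unfolding cube_def b_def
          by (auto simp: axis_def algebra_simps split: if_splits) (smt (verit) mult_nonneg_nonneg of_nat_0_le_iff)+
        have zs_in: "z + axis a s \<in> cube x l"
          using zb isl[OF iN(2)] sl \<open>s > 0\<close> unfolding cube_def b_def
          by (auto simp: axis_def algebra_simps split: if_splits) (smt (verit) mult_nonneg_nonneg of_nat_0_le_iff)+
        have "norm (h j (z + axis a s) - h j z - u j) \<le> norm (h j (z + axis a s) - h j (P w (Suc i)))
            + norm (h j z - h j (P w i)) + norm (A w i j - u j)"
        proof -
          have "h j (z + axis a s) - h j z - u j = (h j (z + axis a s) - h j (P w (Suc i)))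
            - (h j z - h j (P w i)) + (A w i j - u j)" by (simp add: A_def)
          then show ?thesis using norm_triangle_ineq norm_triangle_ineq4 by (smt (verit))
        qed
        also have "\<dots> \<le> K * norm (z + axis a s - P w (Suc i)) + K * norm (z - P w i) + \<eta> * s / 2"
          using Pin[OF \<open>w \<in> G\<close>] iN by (intro add_mono lipn j z_in zs_in Au \<open>w \<in> G\<close>) auto
        also have "\<dots> = 2 * (K * norm (z - P w i)) + \<eta> * s / 2" by (simp add: PS)
        also have "\<dots> \<le> 2 * (K * (d * (s / real M))) + \<eta> * s / 2"
          using zP assms by (intro add_mono mult_left_mono) auto
        also have "\<dots> \<le> \<eta> * s"
        proof -
          have "4 * K * d \<le> \<eta> * real M" using M assms by (simp add: field_simps)
          then have "4 * K * d * s \<le> \<eta> * real M * s" using \<open>s > 0\<close> by (intro mult_right_mono) auto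
          then show ?thesis using \<open>M > 0\<close> by (simp add: field_simps)
        qed
        finally show ?thesis .
      qed
      then show "\<exists>i u. i + 1 < N \<and> (\<forall>j<m. \<forall>z\<in>cube (x + axis a (real i * s)) s.
          norm (h j (z + axis a s) - h j z - u j) \<le> \<eta> * s)"
        using i(1) by (intro exI[of _ i] exI[of _ u]) auto
    qed
  qed
qed

section \<open>Iteration over scales\<close>

definition shifted_pair ::
    "nat \<Rightarrow> (nat \<Rightarrow> real^'n \<Rightarrow> 'b::real_normed_vector) \<Rightarrow> real \<Rightarrow> (real^'n \<Rightarrow> real) \<Rightarrow> 'n \<Rightarrow> real^'n \<Rightarrow> real \<Rightarrow> bool" where
  "shifted_pair m h \<eta> \<psi> a y s \<longleftrightarrow> 0 < s \<and>
     (\<exists>u. \<forall>j<m. \<forall>z\<in>cube y s. norm (h j (z + axis a s) - h j z - u j) \<le> \<eta> * s) \<and>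
     s ^ CARD('n) / 2 \<le> \<bar>integral (cube (y + axis a s) s) \<psi> - integral (cube y s) \<psi>\<bar>"

text \<open>Outside the support of the comb the density oscillates at scale \<open>s\<close>; on the support, which has
  small volume, it is free to oscillate at smaller scales.\<close>

lemma integral_comb_mix:
  fixes x :: "real^'n::finite" and \<psi> :: "real^'n \<Rightarrow> real"
  assumes "0 < w" "2 * w \<le> p" "x $ b = of_int q * p" "s = real M * p"
    and \<psi>: "continuous_on UNIV \<psi>" "\<And>z. \<bar>\<psi> z\<bar> \<le> 1"
    and \<tau>: "continuous_on UNIV \<tau>" "\<And>z. \<bar>\<tau> z\<bar> \<le> 1"
  shows "\<bar>integral (cube x s) (\<lambda>z. (1 - comb p w (z $ b)) * \<tau> z + comb p w (z $ b) * \<psi> z)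
      - integral (cube x s) \<tau>\<bar> \<le> 6 * (real M + 1) * w * s ^ (CARD('n) - 1)"
proof -
  let ?c = "\<lambda>z::real^'n. comb p w (z $ b)"
  have c: "continuous_on (cbox u v) ?c" for u v by (intro continuous_intros assms)
  have \<psi>c: "continuous_on (cbox u v) \<psi>" "continuous_on (cbox u v) \<tau>" for u v
    using \<psi>(1) \<tau>(1) continuous_on_subset by blast+
  have "integral (cube x s) (\<lambda>z. (1 - ?c z) * \<tau> z + ?c z * \<psi> z) - integral (cube x s) \<tau>
      = integral (cube x s) (\<lambda>z. ?c z * (\<psi> z - \<tau> z))"
    unfolding cube_eq_cbox
    by (subst integral_diff[symmetric])
       (auto intro!: integrable_continuous continuous_intros c \<psi>c integral_cong simp: algebra_simps)
  also have "norm \<dots> \<le> integral (cube x s) (\<lambda>z. 2 * ?c z)"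
  proof (rule integral_norm_bound_integral)
    show "(\<lambda>z. ?c z * (\<psi> z - \<tau> z)) integrable_on cube x s" "(\<lambda>z. 2 * ?c z) integrable_on cube x s"
      unfolding cube_eq_cbox by (intro integrable_continuous continuous_intros c \<psi>c)+
    fix z
    have "\<bar>\<psi> z - \<tau> z\<bar> \<le> 2" using \<psi>(2)[of z] \<tau>(2)[of z] by linarith
    then have "?c z * \<bar>\<psi> z - \<tau> z\<bar> \<le> ?c z * 2"
      using comb_bounds(1)[OF assms(1)] by (intro mult_left_mono)
    then show "norm (?c z * (\<psi> z - \<tau> z)) \<le> 2 * ?c z"
      using comb_bounds(1)[OF assms(1), of p "z $ b"] by (simp add: abs_mult)
  qed
  also have "\<dots> = 2 * integral (cube x s) ?c" by (rule integral_mult_right)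
  also have "\<dots> \<le> 2 * ((real M + 1) * (3 * w * s ^ (CARD('n) - 1)))"
    using integral_comb_cube[OF assms(1-4)] by linarith
  also have "\<dots> = 6 * (real M + 1) * w * s ^ (CARD('n) - 1)" by (simp add: algebra_simps)
  finally show ?thesis by (simp only: real_norm_def)
qed

text \<open>The conditions on \<open>x $ a\<close> and \<open>x $ b\<close> align the row starting at \<open>x\<close> with the periodic density \<open>\<psi>\<close>.\<close>

definition forces_pair ::
    "nat \<Rightarrow> real \<Rightarrow> real \<Rightarrow> 'n \<Rightarrow> 'n \<Rightarrow> nat \<Rightarrow> nat \<Rightarrow> real \<Rightarrow> real \<Rightarrow> (real^'n::finite \<Rightarrow> real) \<Rightarrow> bool" where
  "forces_pair m K \<eta> a b M N \<Theta> l \<psi> \<longleftrightarrow> continuous_on UNIV \<psi> \<and> (\<forall>z. \<bar>\<psi> z\<bar> \<le> 1) \<and>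
    (\<forall>(h :: nat \<Rightarrow> real^'n \<Rightarrow> real^'n) x p q.
      (\<forall>j<m. K-lipschitz_on (cube x l) (h j)) \<longrightarrow>
      x $ a = of_int p * (l / real M) \<longrightarrow> x $ b = of_int q * (l / real M) \<longrightarrow>
      \<Theta> < sq_incr m h x (x + axis a l) / l\<^sup>2 \<longrightarrow>
      (\<exists>y s. shifted_pair m h \<eta> \<psi> a y s \<and>
        cube y s \<union> cube (y + axis a s) s \<subseteq> {z \<in> cube x l. z $ b \<le> x $ b + l / real N}))"

lemma forces_pairD:
  fixes h :: "nat \<Rightarrow> real^'n::finite \<Rightarrow> real^'n"
  assumes "forces_pair m K \<eta> a b M N \<Theta> l \<psi>" "\<forall>j<m. K-lipschitz_on (cube x l) (h j)"
    "x $ a = of_int p * (l / real M)" "x $ b = of_int q * (l / real M)"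
    "\<Theta> < sq_incr m h x (x + axis a l) / l\<^sup>2"
  obtains y s where "shifted_pair m h \<eta> \<psi> a y s"
    "cube y s \<union> cube (y + axis a s) s \<subseteq> {z \<in> cube x l. z $ b \<le> x $ b + l / real N}"
  using assms unfolding forces_pair_def by blast

text \<open>Induction on \<open>r\<close>, the number of stretchings still possible. For
  \<open>r = 0\<close> the required stretch exceeds what Lipschitz maps allow. In the step, a near
  translation is met by the sine of scale \<open>s\<close>. A stretched pair starts a row of length
  \<open>s\<close> whose normalised stretch is larger by the factor \<open>1 + \<kappa>\<close>, and
  the density for \<open>r\<close> takes over there.\<close>

lemma multiscale_density:
  fixes K \<eta> :: real and m :: nat and a b :: "'n::finite"
  assumes "0 < K" "0 < \<eta>" "a \<noteq> b"
  obtains M N :: nat and \<kappa> :: real where "0 < M" "0 < \<kappa>"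
    "\<forall>r. \<forall>l>0. \<exists>\<psi>. forces_pair m K \<eta> a b M N (real m * K\<^sup>2 / (1 + \<kappa>) ^ r) l \<psi>"
proof -
  obtain M N0 :: nat and \<kappa> :: real where M: "0 < M" "0 < \<kappa>"
    and alt: "\<forall>N\<ge>N0. translates_or_stretches m K \<eta> a M \<kappa> N"
    by (rule translation_or_stretch[OF assms(1,2), of m a])
  \<comment> \<open>\<open>N\<close> is a multiple of \<open>M\<close>, so that multiples of
    \<open>l / M\<close> are multiples of the new scale \<open>s\<close>. The factor 144 gives
    \<open>72 * (M + 1) \<le> N\<close>, which limits the influence of the comb on each cube to a
    twelfth of its volume.\<close>
  define N1 where "N1 = 144 + N0"
  define N where "N = M * N1"
  have "1 \<le> M" using M(1) by simp
  then have "1 * N1 \<le> N" "M * 144 \<le> N" unfolding N_def by (intro mult_le_mono; simp add: N1_def)+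
  then have N: "N0 \<le> N" "144 * M \<le> N" "0 < N" "0 < N1" by (auto simp: N1_def)
  show thesis
  proof (rule that[OF M, of N], intro allI impI)
    fix r and l :: real
    assume "0 < l"
    then show "\<exists>\<psi>. forces_pair m K \<eta> a b M N (real m * K\<^sup>2 / (1 + \<kappa>) ^ r) l \<psi>"
    proof (induction r arbitrary: l)
      case 0
      have "\<not> real m * K\<^sup>2 < sq_incr m h x (x + axis a l) / l\<^sup>2"
        if lip: "\<forall>j<m. K-lipschitz_on (cube x l) (h j)" for h :: "nat \<Rightarrow> real^'n \<Rightarrow> real^'n" and x
      proof -
        have "x \<in> cube x l" "x + axis a l \<in> cube x l" using 0 by (auto simp: cube_def axis_def)
        then have "norm (h j (x + axis a l) - h j x) \<le> K * l" if "j < m" for j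
          using lipschitz_onD[of K "cube x l" "h j" "x + axis a l" x] lip that 0
          by (simp add: dist_norm norm_axis_real)
        then have "sq_incr m h x (x + axis a l) \<le> (\<Sum>j<m. (K * l)\<^sup>2)"
          unfolding sq_incr_def by (intro sum_mono power_mono) auto
        then show ?thesis using 0 by (simp add: not_less pos_divide_le_eq power_mult_distrib)
      qed
      then have "forces_pair m K \<eta> a b M N (real m * K\<^sup>2 / (1 + \<kappa>) ^ 0) l (\<lambda>_. 0)"
        unfolding forces_pair_def by simp
      then show ?case by blast
    next
      case (Suc r)
      define s where "s = l / real N"
      have s: "0 < s" "l = real N * s" using Suc.prems N by (auto simp: s_def)
      obtain \<psi>' where IH: "forces_pair m K \<eta> a b M N (real m * K\<^sup>2 / (1 + \<kappa>) ^ r) s \<psi>'"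
        using Suc.IH[OF s(1)] by blast
      then have \<psi>': "continuous_on UNIV \<psi>'" "\<And>z. \<bar>\<psi>' z\<bar> \<le> 1" by (auto simp: forces_pair_def)
      \<comment> \<open>The tooth width is the thickness \<open>s / N\<close> to which the inner
        scale confines its cubes, and the period \<open>s / M\<close> is the mesh of possible
        starting points. Every row of the inner scale thus lies in a tooth.\<close>
      define w where "w = s / real N"
      define p where "p = s / real M"
      have w: "0 < w" "2 * w \<le> p"
      proof -
        show "0 < w" using s N by (simp add: w_def)
        have "2 * real M \<le> real N" using N(2) by linarith
        then have "2 * real M * s \<le> real N * s" using s by (intro mult_right_mono) auto
        then show "2 * w \<le> p" using M N by (simp add: w_def p_def field_simps)
      qed
      have sM: "s = real M * p" using M by (simp add: p_def)
      define \<tau> where "\<tau> z = sin (pi * z $ a / s)" for z :: "real^'n"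
      have \<tau>: "continuous_on UNIV \<tau>" "\<And>z. \<bar>\<tau> z\<bar> \<le> 1"
        unfolding \<tau>_def by (intro continuous_intros) (use s in auto)
      define \<psi> where "\<psi> z = (1 - comb p w (z $ b)) * \<tau> z + comb p w (z $ b) * \<psi>' z" for z
      have "continuous_on UNIV \<psi>" unfolding \<psi>_def by (intro continuous_intros \<tau> \<psi>' w)
      moreover have "\<bar>\<psi> z\<bar> \<le> 1" for z
      proof -
        let ?c = "comb p w (z $ b)"
        have c: "0 \<le> ?c" "0 \<le> 1 - ?c" using comb_bounds[OF w(1), of p "z $ b"] by auto
        have "\<bar>\<psi> z\<bar> \<le> (1 - ?c) * \<bar>\<tau> z\<bar> + ?c * \<bar>\<psi>' z\<bar>"
          unfolding \<psi>_def by (rule order_trans[OF abs_triangle_ineq]) (use c in \<open>simp add: abs_mult\<close>)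
        also have "\<dots> \<le> (1 - ?c) * 1 + ?c * 1" by (intro add_mono mult_left_mono \<tau> \<psi>' c)
        finally show ?thesis by simp
      qed
      moreover have pairs: "\<exists>y t. shifted_pair m h \<eta> \<psi> a y t \<and>
          cube y t \<union> cube (y + axis a t) t \<subseteq> {z \<in> cube x l. z $ b \<le> x $ b + l / real N}"
        if lip: "\<forall>j<m. K-lipschitz_on (cube x l) (h j)"
          and xa: "x $ a = of_int pa * (l / real M)" and xb: "x $ b = of_int q * (l / real M)"
          and big: "real m * K\<^sup>2 / (1 + \<kappa>) ^ Suc r < sq_incr m h x (x + axis a l) / l\<^sup>2"
        for h :: "nat \<Rightarrow> real^'n \<Rightarrow> real^'n" and x pa q
      proof -
        have lN: "l / real N = s" by (simp add: s_def)
        have xa': "x $ a = of_int (pa * int N1) * s" using M by (simp add: xa s(2) N_def field_simps)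
        have xap: "x $ a = of_int (pa * int N) * p" by (simp add: xa s(2) p_def field_simps)
        have xbp: "x $ b = of_int (q * int N) * p" by (simp add: xb s(2) p_def field_simps)
        have step: "real i * s + 2 * s \<le> l" if "i + 1 < N" for i
        proof -
          have "(real i + 2) * s \<le> real N * s" using that s(1) by (intro mult_right_mono) auto
          then show ?thesis by (simp add: s(2) algebra_simps)
        qed
        from alt[rule_format, OF N(1), unfolded translates_or_stretches_def, rule_format, OF Suc.prems s_def, of x h] lip
        consider (A) i u where "i + 1 < N" "\<forall>j<m. \<forall>z\<in>cube (x + axis a (real i * s)) s.
            norm (h j (z + axis a s) - h j z - u j) \<le> \<eta> * s"
          | (B) i v x' where "i + 1 < N" "\<forall>c. v c < M" 
            "x' = x + axis a (real i * s) + (\<chi> c. s * real (v c) / real M)"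
            "(1 + \<kappa>) * (sq_incr m h x (x + axis a l) / l\<^sup>2) \<le> sq_incr m h x' (x' + axis a s) / s\<^sup>2"
          unfolding Let_def by blast
        then show ?thesis
        proof cases
          case A
          define y where "y = x + axis a (real i * s)"
          have ya: "y $ a = s * of_int (pa * int N1 + int i)" by (simp add: y_def xa' axis_def algebra_simps)
          have yb: "y $ b = of_int (q * int N) * p" using \<open>a \<noteq> b\<close> by (simp add: y_def xbp axis_def)
          have ya2: "(y + axis a s) $ a = s * of_int (pa * int N1 + int i + 1)" using ya by (simp add: axis_def algebra_simps)
          have yb2: "(y + axis a s) $ b = of_int (q * int N) * p" using \<open>a \<noteq> b\<close> yb by (simp add: axis_def)
          let ?V = "s ^ CARD('n)"
          have err: "6 * (real M + 1) * w * s ^ (CARD('n) - 1) \<le> ?V / 12"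
          proof -
            have "real (144 * M) \<le> real N" "real 1 \<le> real M" using N(2) \<open>1 \<le> M\<close> by (simp_all only: of_nat_le_iff)
            then have "72 * (real M + 1) \<le> real N" by simp
            then have "72 * (real M + 1) * w \<le> real N * w" using w by (intro mult_right_mono) auto
            moreover have "real N * w = s" using N by (simp add: w_def)
            ultimately have "6 * (real M + 1) * w \<le> s / 12" by linarith
            then have "6 * (real M + 1) * w * s ^ (CARD('n) - 1) \<le> s / 12 * s ^ (CARD('n) - 1)"
              using s by (intro mult_right_mono) auto
            also have "\<dots> = s * s ^ (CARD('n) - 1) / 12" by simp
            also have "s * s ^ (CARD('n) - 1) = ?V" by (metis Suc_diff_1 power_Suc zero_less_card_finite)
            finally show ?thesis .
          qed
          have I1: "\<bar>integral (cube y s) \<psi> - integral (cube y s) \<tau>\<bar> \<le> ?V / 12"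
            unfolding \<psi>_def using integral_comb_mix[OF w yb sM \<psi>' \<tau>] err by linarith
          have I2: "\<bar>integral (cube (y + axis a s) s) \<psi> - integral (cube (y + axis a s) s) \<tau>\<bar> \<le> ?V / 12"
            unfolding \<psi>_def using integral_comb_mix[OF w yb2 sM \<psi>' \<tau>] err by linarith
          have T1: "?V / 3 \<le> (if even (pa * int N1 + int i) then 1 else -1) * integral (cube y s) \<tau>"
            unfolding \<tau>_def by (rule integral_sin_cube[OF s(1) ya])
          have T2: "?V / 3 \<le> (if even (pa * int N1 + int i + 1) then 1 else -1) * integral (cube (y + axis a s) s) \<tau>"
            unfolding \<tau>_def by (rule integral_sin_cube[OF s(1) ya2])
          \<comment> \<open>The sines on neighbouring cubes contribute at least \<open>1/3\<close>
            each with opposite signs, and the comb changes each integral by at most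
            \<open>1/12\<close>: in units of \<open>?V\<close>,
            \<open>2/3 - 2/12 = 1/2\<close>.\<close>
          have "?V / 2 \<le> \<bar>integral (cube (y + axis a s) s) \<psi> - integral (cube y s) \<psi>\<bar>"
          proof (cases "even (pa * int N1 + int i)")
            case True
            then have "?V / 3 \<le> integral (cube y s) \<tau>" "?V / 3 \<le> - integral (cube (y + axis a s) s) \<tau>"
              using T1 T2 by auto
            then show ?thesis using I1 I2 by linarith
          next
            case False
            then have "?V / 3 \<le> - integral (cube y s) \<tau>" "?V / 3 \<le> integral (cube (y + axis a s) s) \<tau>"
              using T1 T2 by auto
            then show ?thesis using I1 I2 by linarith
          qed
          then have "shifted_pair m h \<eta> \<psi> a y s"
            unfolding shifted_pair_def using s(1) A(2) by (auto simp: y_def)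
          moreover have "cube y s \<union> cube (y + axis a s) s \<subseteq> {z \<in> cube x l. z $ b \<le> x $ b + l / real N}"
          proof
            fix z assume z: "z \<in> cube y s \<union> cube (y + axis a s) s"
            have zc: "x $ c \<le> z $ c \<and> z $ c \<le> x $ c + (if c = a then real i * s + 2 * s else s)" for c
            proof -
              define \<rho> where "\<rho> = real i * s"
              have "0 \<le> \<rho>" using s by (simp add: \<rho>_def)
              moreover have "y $ c = x $ c + (if c = a then \<rho> else 0)" by (simp add: y_def axis_def \<rho>_def)
              moreover have "(y + axis a s) $ c = x $ c + (if c = a then \<rho> + s else 0)"
                by (simp add: y_def axis_def \<rho>_def)
              moreover have "y $ c \<le> z $ c \<and> z $ c \<le> y $ c + s \<or>
                  (y + axis a s) $ c \<le> z $ c \<and> z $ c \<le> (y + axis a s) $ c + s"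
                using z by (auto simp: cube_def)
              ultimately show ?thesis using s(1) unfolding \<rho>_def[symmetric] by (cases "c = a") auto
            qed
            have "s \<le> l" using step[OF A(1)] s(1) by (smt (verit) mult_nonneg_nonneg of_nat_0_le_iff)
            have "x $ c \<le> z $ c \<and> z $ c \<le> x $ c + l" for c
              using zc[of c] step[OF A(1)] \<open>s \<le> l\<close> by (cases "c = a") auto
            moreover have "z $ b \<le> x $ b + s" using zc[of b] \<open>a \<noteq> b\<close> by simp
            ultimately show "z \<in> {z \<in> cube x l. z $ b \<le> x $ b + l / real N}" by (simp add: cube_def lN)
          qed
          ultimately show ?thesis by blast
        next
          case B
          have x'c: "x' $ c = x $ c + (if c = a then real i * s else 0) + real (v c) * p" for c
            by (simp add: B(3) axis_def p_def)
          have vp: "0 \<le> real (v c) * p" "real (v c) * p + p \<le> s" for c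
          proof -
            show "0 \<le> real (v c) * p" using w by simp
            have "v c < M" using B(2) by blast
            then have "(real (v c) + 1) * p \<le> real M * p" using w by (intro mult_right_mono) auto
            then show "real (v c) * p + p \<le> s" by (simp add: sM algebra_simps)
          qed
          have x'a: "x' $ a = of_int (pa * int N + int i * int M + int (v a)) * (s / real M)"
            using M by (simp add: x'c xap sM algebra_simps)
          have x'b: "x' $ b = of_int (q * int N + int (v b)) * (s / real M)"
            using \<open>a \<noteq> b\<close> M by (simp add: x'c xbp sM algebra_simps)
          have sub: "cube x' s \<subseteq> cube x l"
          proof
            fix z assume z: "z \<in> cube x' s"
            have "x $ c \<le> z $ c \<and> z $ c \<le> x $ c + l" for c
            proof -
              define \<rho> where "\<rho> = real i * s"
              define o' where "o' = real (v c) * p"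
              have "0 \<le> \<rho>" using s by (simp add: \<rho>_def)
              moreover have "\<rho> + 2 * s \<le> l" unfolding \<rho>_def by (rule step[OF B(1)])
              moreover have "0 \<le> o'" "o' + p \<le> s" unfolding o'_def by (rule vp)+
              moreover have "x' $ c = x $ c + (if c = a then \<rho> else 0) + o'" unfolding \<rho>_def o'_def by (rule x'c)
              moreover have "x' $ c \<le> z $ c" "z $ c \<le> x' $ c + s" using z by (auto simp: cube_def)
              ultimately show ?thesis using w s(1) by (cases "c = a") (simp_all only: if_True if_False simp_thms, linarith+)
            qed
            then show "z \<in> cube x l" by (simp add: cube_def)
          qed
          have lip': "\<forall>j<m. K-lipschitz_on (cube x' s) (h j)"
            using lip lipschitz_on_subset sub by blast
          have "real m * K\<^sup>2 / (1 + \<kappa>) ^ r = (1 + \<kappa>) * (real m * K\<^sup>2 / (1 + \<kappa>) ^ Suc r)" using M(2) by simp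
          also have "\<dots> < (1 + \<kappa>) * (sq_incr m h x (x + axis a l) / l\<^sup>2)"
            using big M(2) by (intro mult_strict_left_mono) auto
          also have "\<dots> \<le> sq_incr m h x' (x' + axis a s) / s\<^sup>2" by (rule B(4))
          finally have "real m * K\<^sup>2 / (1 + \<kappa>) ^ r < sq_incr m h x' (x' + axis a s) / s\<^sup>2" .
          then obtain y t where yt: "shifted_pair m h \<eta> \<psi>' a y t"
            "cube y t \<union> cube (y + axis a t) t \<subseteq> {z \<in> cube x' s. z $ b \<le> x' $ b + s / real N}"
            by (rule forces_pairD[OF IH lip' x'a x'b])
          \<comment> \<open>The new starting point has its \<open>b\<close>-coordinate at the
            beginning of a tooth, so the cut-off is 1 on the whole inner pair and only
            \<open>\<psi>'\<close> is seen there.\<close>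
          have eq: "\<psi> z = \<psi>' z" if "z \<in> cube y t \<union> cube (y + axis a t) t" for z
          proof -
            have "x' $ b \<le> z $ b" "z $ b \<le> x' $ b + w" using that yt(2) by (auto simp: cube_def w_def)
            then have "comb p w (z $ b) = 1"
              unfolding x'b p_def[symmetric] by (rule comb_eq_1)
            then show ?thesis by (simp add: \<psi>_def)
          qed
          then have "integral (cube y t) \<psi> = integral (cube y t) \<psi>'"
            "integral (cube (y + axis a t) t) \<psi> = integral (cube (y + axis a t) t) \<psi>'"
            by (auto intro!: integral_cong)
          then have "shifted_pair m h \<eta> \<psi> a y t" using yt(1) by (simp add: shifted_pair_def)
          moreover have "cube y t \<union> cube (y + axis a t) t \<subseteq> {z \<in> cube x l. z $ b \<le> x $ b + l / real N}"
          proof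
            fix z assume "z \<in> cube y t \<union> cube (y + axis a t) t"
            then have z: "z \<in> cube x' s" "z $ b \<le> x' $ b + w" using yt(2) by (auto simp: w_def)
            have "z $ b \<le> x $ b + s" using z(2) x'c[of b] vp[of b] w \<open>a \<noteq> b\<close> by simp
            then show "z \<in> {z \<in> cube x l. z $ b \<le> x $ b + l / real N}" using z(1) sub lN by auto
          qed
          ultimately show ?thesis by blast
        qed
      qed
      ultimately have "forces_pair m K \<eta> a b M N (real m * K\<^sup>2 / (1 + \<kappa>) ^ Suc r) l \<psi>"
        unfolding forces_pair_def
      proof (intro conjI allI impI, goal_cases)
        case (3 h x p q)
        then show ?case by (intro pairs)
      qed blast+
      then show ?case by blast
    qed
  qed
qed

text \<open>A lower bound for the single map \<open>h 0\<close> makes the normalised stretch of the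
  first row at least \<open>1 / K\<^sup>2\<close>. It is enough to choose \<open>r\<close> so large
  that the threshold of \<open>multiscale_density\<close> falls below this value.\<close>

theorem non_translation_density:
  fixes K \<eta> l :: real and m :: nat and a b :: "'n::finite"
  assumes "0 < K" "0 < \<eta>" "a \<noteq> b" "0 < l" "0 < m"
  obtains \<psi> where "continuous_on UNIV \<psi>" "\<And>z. \<bar>\<psi> z\<bar> \<le> 1"
    "\<And>h :: nat \<Rightarrow> real^'n \<Rightarrow> real^'n.
      (\<And>j. j < m \<Longrightarrow> K-lipschitz_on (cube 0 l) (h j)) \<Longrightarrow>
      l / K \<le> norm (h 0 (axis a l) - h 0 0) \<Longrightarrow>
      \<exists>y s. shifted_pair m h \<eta> \<psi> a y s \<and> cube y s \<union> cube (y + axis a s) s \<subseteq> cube 0 l"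
proof -
  obtain M N :: nat and \<kappa> :: real where M: "0 < M" "0 < \<kappa>" and
    J: "\<forall>r. \<forall>l>0. \<exists>\<psi>. forces_pair m K \<eta> a b M N (real m * K\<^sup>2 / (1 + \<kappa>) ^ r) l \<psi>"
    by (rule multiscale_density[OF assms(1-3), of m])
  obtain r where r: "real m * K\<^sup>2 * K\<^sup>2 < (1 + \<kappa>) ^ r"
    using real_arch_pow[of "1 + \<kappa>"] M(2) by auto
  obtain \<psi> where pair: "forces_pair m K \<eta> a b M N (real m * K\<^sup>2 / (1 + \<kappa>) ^ r) l \<psi>"
    using J assms(4) by blast
  then have \<psi>: "continuous_on UNIV \<psi>" "\<And>z. \<bar>\<psi> z\<bar> \<le> 1" by (auto simp: forces_pair_def)
  show thesis
  proof (rule that[OF \<psi>])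
    fix h :: "nat \<Rightarrow> real^'n \<Rightarrow> real^'n"
    assume lip0: "\<And>j. j < m \<Longrightarrow> K-lipschitz_on (cube 0 l) (h j)"
      and low: "l / K \<le> norm (h 0 (axis a l) - h 0 0)"
    have lip: "\<forall>j<m. K-lipschitz_on (cube 0 l) (h j)" using lip0 by blast
    have "(l / K)\<^sup>2 \<le> (norm (h 0 (axis a l) - h 0 0))\<^sup>2"
      using low assms by (intro power_mono) auto
    also have "\<dots> \<le> sq_incr m h 0 (0 + axis a l)"
      unfolding sq_incr_def using assms by (simp add: member_le_sum[of 0 "{..<m}" "\<lambda>j. (norm (h j (axis a l) - h j 0))\<^sup>2"])
    finally have "1 / K\<^sup>2 \<le> sq_incr m h 0 (0 + axis a l) / l\<^sup>2"
      using assms by (simp add: power_divide field_simps)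
    moreover have "real m * K\<^sup>2 / (1 + \<kappa>) ^ r < 1 / K\<^sup>2"
      using r M(2) assms by (simp add: field_simps)
    ultimately have "real m * K\<^sup>2 / (1 + \<kappa>) ^ r < sq_incr m h 0 (0 + axis a l) / l\<^sup>2" by linarith
    then obtain y s where "shifted_pair m h \<eta> \<psi> a y s"
        "cube y s \<union> cube (y + axis a s) s \<subseteq> {z \<in> cube 0 l. z $ b \<le> (0 :: real^'n) $ b + l / real N}"
      using forces_pairD[where h = h and x = 0 and p = 0 and q = 0, OF pair lip] by auto
    then show "\<exists>y s. shifted_pair m h \<eta> \<psi> a y s \<and> cube y s \<union> cube (y + axis a s) s \<subseteq> cube 0 l" by blast
  qed
qed

section \<open>Volumes of images under Lipschitz maps\<close>

lemma measure_lebesgue_cube: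
  fixes x :: "real^'n::finite"
  shows "0 \<le> s \<Longrightarrow> measure lebesgue (cube x s) = s ^ CARD('n)"
  using content_cube[of s x] by (simp add: cube_eq_cbox)

lemma measure_lebesgue_compact_mono:
  fixes A B :: "'a::euclidean_space set"
  assumes "compact A" "compact B" "A \<subseteq> B"
  shows "measure lebesgue A \<le> measure lebesgue B"
  using assms by (intro measure_mono_fmeasurable) (auto intro: lmeasurable_compact fmeasurableD)

text \<open>\<open>A\<close> is covered by non-overlapping cubes inside an open set of almost the
  same measure. The part of \<open>A\<close> in a cube of side \<open>t\<close> has its image in a
  cube of side \<open>2 * K * d * t\<close>, which explains the constant.\<close>

lemma lipschitz_image_measure:
  fixes h :: "real^'n::finite \<Rightarrow> real^'n"
  assumes A: "compact A" and lip: "K-lipschitz_on A h"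
  shows "measure lebesgue (h ` A) \<le> (2 * K * CARD('n)) ^ CARD('n) * measure lebesgue A"
proof -
  define d where "d = real CARD('n)"
  define c where "c = (2 * K * d) ^ CARD('n)"
  have "d \<ge> 1" unfolding d_def by (simp add: Suc_leI)
  have "K \<ge> 0" using lip lipschitz_on_nonneg by blast
  then have "c \<ge> 0" using \<open>d \<ge> 1\<close> by (simp add: c_def)
  have "A \<in> lmeasurable" using A by (rule lmeasurable_compact)
  have "measure lebesgue (h ` A) \<le> c * (measure lebesgue A + e)" if "e > 0" for e
  proof -
    obtain T where T: "open T" "A \<subseteq> T" "T \<in> lmeasurable" "measure lebesgue T < measure lebesgue A + e"
    proof -
      obtain T where T: "open T" "A \<subseteq> T" "T - A \<in> lmeasurable" "emeasure lebesgue (T - A) < ennreal e"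
        using sets_lebesgue_outer_open[OF fmeasurableD[OF \<open>A \<in> lmeasurable\<close>] \<open>e > 0\<close>] by metis
      have Teq: "T = A \<union> (T - A)" using T(2) by blast
      have "T \<in> lmeasurable" using Teq fmeasurable.Un[OF \<open>A \<in> lmeasurable\<close> T(3)] by simp
      moreover have "measure lebesgue (T - A) < e"
        using T(4) \<open>e > 0\<close> by (simp add: emeasure_eq_measure2[OF T(3)] ennreal_less_iff)
      moreover have "measure lebesgue T \<le> measure lebesgue A + measure lebesgue (T - A)"
        using measure_Un_le[OF fmeasurableD[OF \<open>A \<in> lmeasurable\<close>] fmeasurableD[OF T(3)]] Teq by simp
      ultimately show thesis using that T by force
    qed
    obtain B where B: "B > 0" "\<And>x. x \<in> A \<Longrightarrow> norm x \<le> B"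
      using compact_imp_bounded[OF A] by (auto simp: bounded_pos)
    define \<beta> :: "real^'n" where "\<beta> = (\<chi> i. B)"
    have Asub: "A \<subseteq> cbox (- \<beta>) \<beta>"
    proof
      fix x assume "x \<in> A"
      then have "\<bar>x $ i\<bar> \<le> B" for i using B(2) component_le_norm_cart[of x i] by (meson order_trans)
      then show "x \<in> cbox (- \<beta>) \<beta>" by (auto simp: mem_box_cart \<beta>_def abs_le_iff minus_le_iff)
    qed
    have "0 \<in> box (- \<beta>) \<beta>" using B by (simp add: mem_box_cart \<beta>_def)
    then have ne: "box (- \<beta>) \<beta> \<noteq> {}" by blast
    \<comment> \<open>Each cube supplied by the covering lemma contains a point of \<open>A\<close>
      whose gauge set contains the cube, which forces the cube into \<open>T\<close>;
      \<open>UNIV\<close> is a default value.\<close>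
    define g where "g x = (if x \<in> A then T else UNIV)" for x
    have "gauge g" unfolding gauge_def g_def using T by auto
    obtain \<D> where \<D>: "countable \<D>" "\<Union>\<D> \<subseteq> cbox (- \<beta>) \<beta>"
        "\<And>k. k \<in> \<D> \<Longrightarrow> interior k \<noteq> {} \<and> (\<exists>c d. k = cbox c d)"
        "pairwise (\<lambda>A B. interior A \<inter> interior B = {}) \<D>"
        "\<And>k. k \<in> \<D> \<Longrightarrow> \<exists>x \<in> A \<inter> k. k \<subseteq> g x"
        "\<And>u v. cbox u v \<in> \<D> \<Longrightarrow> \<exists>n. \<forall>i \<in> Basis. v \<bullet> i - u \<bullet> i = (\<beta> \<bullet> i - (- \<beta>) \<bullet> i) / 2^n"
        "A \<subseteq> \<Union>\<D>"
      using covering_lemma[OF Asub ne \<open>gauge g\<close>] by metis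
    have side: "\<exists>u t. k = cube u t \<and> 0 < t" if k: "k \<in> \<D>" for k
    proof -
      obtain u v where uv: "k = cbox u v" using \<D>(3)[OF k] by blast
      obtain n where n: "\<And>i. i \<in> Basis \<Longrightarrow> v \<bullet> i - u \<bullet> i = (\<beta> \<bullet> i - (- \<beta>) \<bullet> i) / 2^n"
        using \<D>(6)[of u v] k uv by blast
      have "v $ i - u $ i = 2 * B / 2^n" for i
        using n[of "axis i 1"] by (simp add: \<beta>_def inner_axis axis_in_Basis_iff)
      then have "v = (\<chi> i. u $ i + 2 * B / 2^n)" by (simp add: vec_eq_iff algebra_simps)
      then show ?thesis using uv B by (intro exI[of _ u] exI[of _ "2 * B / 2^n"]) (simp add: cube_eq_cbox)
    qed
    then obtain u t where ut: "\<And>k. k \<in> \<D> \<Longrightarrow> k = cube (u k) (t k) \<and> 0 < t k" by metis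
    obtain p where p: "\<And>k. k \<in> \<D> \<Longrightarrow> p k \<in> A \<inter> k \<and> k \<subseteq> g (p k)" using \<D>(5) by metis
    define Q where "Q k = cube (h (p k) - (\<chi> i. K * d * t k)) (2 * (K * d * t k))" for k
    have kT: "k \<subseteq> T" if "k \<in> \<D>" for k using p[OF that] by (auto simp: g_def)
    have hQ: "h ` (A \<inter> k) \<subseteq> Q k" if k: "k \<in> \<D>" for k
    proof
      fix y assume "y \<in> h ` (A \<inter> k)"
      then obtain x where x: "x \<in> A" "x \<in> k" "y = h x" by auto
      have "norm (x - p k) \<le> d * t k" unfolding d_def
      proof -
        have "\<bar>(x - p k) $ i\<bar> \<le> t k" for i
        proof -
          have "x \<in> cube (u k) (t k)" "p k \<in> cube (u k) (t k)" using ut[OF k] x p[OF k] by auto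
          then have "u k $ i \<le> x $ i" "x $ i \<le> u k $ i + t k" "u k $ i \<le> p k $ i" "p k $ i \<le> u k $ i + t k"
            by (auto simp: cube_def)
          then show ?thesis by (simp add: abs_le_iff)
        qed
        then show "norm (x - p k) \<le> CARD('n) * t k" by (rule norm_le_card_bound)
      qed
      then have "K * norm (x - p k) \<le> K * (d * t k)" using \<open>K \<ge> 0\<close> by (intro mult_left_mono)
      moreover have "norm (h x - h (p k)) \<le> K * norm (x - p k)"
        using lipschitz_onD[OF lip, of x "p k"] x p[OF k] by (auto simp: dist_norm)
      ultimately have "norm (h x - h (p k)) \<le> K * d * t k" by simp
      then have "\<bar>(h x - h (p k)) $ i\<bar> \<le> K * d * t k" for i
        using component_le_norm_cart[of "h x - h (p k)" i] by linarith
      then show "y \<in> Q k" unfolding x(3) Q_def cube_def by (auto simp: abs_le_iff algebra_simps)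
    qed
    have Qm: "Q k \<in> lmeasurable" for k unfolding Q_def by (intro lmeasurable_compact compact_cube)
    have Qk: "measure lebesgue (Q k) = c * measure lebesgue k" if k: "k \<in> \<D>" for k
    proof -
      have "measure lebesgue (Q k) = (2 * (K * d * t k)) ^ CARD('n)"
        using ut[OF k] \<open>K \<ge> 0\<close> \<open>d \<ge> 1\<close> unfolding Q_def by (intro measure_lebesgue_cube) auto
      moreover have "measure lebesgue (cube (u k) (t k)) = (t k) ^ CARD('n)"
        using ut[OF k] by (intro measure_lebesgue_cube) auto
      ultimately show ?thesis using ut[OF k] by (simp add: c_def power_mult_distrib mult_ac)
    qed
    have fin: "measure lebesgue (\<Union>k\<in>\<F>. Q k) \<le> c * measure lebesgue T" if \<F>: "\<F> \<subseteq> \<D>" "finite \<F>" for \<F>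
    proof -
      have "measure lebesgue (\<Union>k\<in>\<F>. Q k) \<le> (\<Sum>k\<in>\<F>. measure lebesgue (Q k))"
        using \<F> Qm by (intro measure_UNION_le) auto
      also have "\<dots> = c * (\<Sum>k\<in>\<F>. measure lebesgue k)"
        using Qk \<F>(1) by (simp add: subset_eq sum_distrib_left)
      also have "(\<Sum>k\<in>\<F>. measure lebesgue k) = measure lebesgue (\<Union>\<F>)"
      proof (rule measure_negligible_finite_Union[symmetric])
        show "k \<in> lmeasurable" if "k \<in> \<F>" for k
          using \<D>(3) that \<F>(1) by (metis lmeasurable_cbox subsetD)
        show "pairwise (\<lambda>S T. negligible (S \<inter> T)) \<F>"
        proof (rule pairwiseI)
          fix k k' assume k: "k \<in> \<F>" "k' \<in> \<F>" "k \<noteq> k'"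
          then have disj: "interior k \<inter> interior k' = {}" using \<D>(4) \<F>(1) by (auto simp: pairwise_def)
          obtain a b a' b' where ab: "k = cbox a b" "k' = cbox a' b'" using \<D>(3) k \<F>(1) by blast
          have "k \<inter> k' \<subseteq> (cbox a b - box a b) \<union> (cbox a' b' - box a' b')"
            using disj unfolding ab by auto
          then show "negligible (k \<inter> k')"
            using negligible_frontier_interval by (meson negligible_Un negligible_subset)
        qed
      qed fact
      also have "measure lebesgue (\<Union>\<F>) \<le> measure lebesgue T"
      proof (rule measure_mono_fmeasurable[OF _ _ T(3)])
        show "\<Union>\<F> \<subseteq> T" using kT \<F>(1) by blast
        have "k \<in> sets lebesgue" if "k \<in> \<F>" for k
          using \<D>(3) that \<F>(1) by (metis lmeasurable_cbox subsetD fmeasurableD)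
        then show "\<Union>\<F> \<in> sets lebesgue" using \<F>(2) by (intro sets.finite_Union) auto
      qed
      finally show ?thesis using \<open>c \<ge> 0\<close> by (simp add: mult_left_mono)
    qed
    have "h ` A \<subseteq> (\<Union>k\<in>\<D>. Q k)" using \<D>(7) hQ by blast
    moreover have "compact (h ` A)"
      using lip A by (intro compact_continuous_image lipschitz_on_continuous_on)
    ultimately have "measure lebesgue (h ` A) \<le> measure lebesgue (\<Union>k\<in>\<D>. Q k)"
      using fmeasurable_UN_bound[OF \<D>(1) Qm fin]
      by (intro measure_mono_fmeasurable) (auto intro: fmeasurableD lmeasurable_compact)
    also have "\<dots> \<le> c * measure lebesgue T"
      by (rule measure_UN_bound[OF \<D>(1) Qm fin])
    also have "\<dots> \<le> c * (measure lebesgue A + e)" using T(4) \<open>c \<ge> 0\<close> by (intro mult_left_mono) auto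
    finally show ?thesis .
  qed
  then have "((\<lambda>e. c * (measure lebesgue A + e)) \<longlongrightarrow> c * (measure lebesgue A + 0)) (at_right 0) \<longrightarrow>
      measure lebesgue (h ` A) \<le> c * (measure lebesgue A + 0)"
    by (intro impI tendsto_lowerbound) (auto simp: eventually_at_right_less eventually_at_filter)
  moreover have "((\<lambda>e. c * (measure lebesgue A + e)) \<longlongrightarrow> c * (measure lebesgue A + 0)) (at_right 0)"
    by (intro tendsto_intros)
  ultimately show ?thesis by (simp add: c_def d_def)
qed

text \<open>Quantitative openness at small scales. The radius is limited because a ball around a
  point of a sheet is known to stay on that sheet only while it is small compared with the gap
  between the sheets.\<close>

definition colipschitz_on :: "real \<Rightarrow> 'a::metric_space set \<Rightarrow> ('a \<Rightarrow> 'b::metric_space) \<Rightarrow> bool" where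
  "colipschitz_on K U h \<longleftrightarrow> (\<forall>x\<in>U. \<forall>r. 0 < r \<longrightarrow> r < 1 / K \<longrightarrow> ball x (K * r) \<subseteq> U \<longrightarrow> ball (h x) r \<subseteq> h ` ball x (K * r))"

text \<open>A point of the translated image, shifted back by \<open>v\<close>, is closer than
  \<open>2 * \<rho>\<close> to some \<open>h z\<close>, so by openness it is the image of a point
  within \<open>2 * K * \<rho>\<close> of \<open>z\<close>. Hence the translated image fits, up to
  the shift, into the image of a slightly enlarged cube. The Lipschitz bound controls the image of
  the shell that was added.\<close>

lemma image_measure_translate:
  fixes h :: "real^'n::finite \<Rightarrow> real^'n" and K \<rho> s :: real
  assumes lip: "K-lipschitz_on U h" and colip: "colipschitz_on K U h"
    and "0 < K" "0 < s" "0 < \<rho>" "2 * \<rho> < 1 / K"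
    and sub: "cube (y - (\<chi> i. 2 * K * \<rho>)) (s + 4 * K * \<rho>) \<subseteq> U"
    and sub': "cube (y + t) s \<subseteq> U"
    and tr: "\<And>z. z \<in> cube y s \<Longrightarrow> norm (h (z + t) - h z - v) \<le> \<rho>"
  shows "measure lebesgue (h ` cube (y + t) s) \<le> measure lebesgue (h ` cube y s) +
      (2 * K * CARD('n)) ^ CARD('n) * ((s + 4 * K * \<rho>) ^ CARD('n) - s ^ CARD('n))"
proof -
  let ?B = "cube (y - (\<chi> i. 2 * K * \<rho>)) (s + 4 * K * \<rho>)"
  let ?c = "(2 * K * CARD('n)) ^ CARD('n)"
  have K\<rho>: "K * \<rho> > 0" using assms by simp
  have contB: "continuous_on X h" if "X \<subseteq> U" for X
    using lip that lipschitz_on_subset lipschitz_on_continuous_on by blast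
  have cB: "compact (h ` X)" if "compact X" "X \<subseteq> U" for X
    using that contB by (intro compact_continuous_image) auto
  have SB: "cube y s \<subseteq> ?B"
  proof
    fix z assume "z \<in> cube y s"
    then have z: "y $ i \<le> z $ i" "z $ i \<le> y $ i + s" for i by (auto simp: cube_def)
    have "y $ i - 2 * K * \<rho> \<le> z $ i \<and> z $ i \<le> y $ i - 2 * K * \<rho> + (s + 4 * K * \<rho>)" for i
    proof -
      have "2 * K * \<rho> = 2 * (K * \<rho>)" "4 * K * \<rho> = 4 * (K * \<rho>)" by simp_all
      then show ?thesis using z[of i] K\<rho> by linarith
    qed
    then show "z \<in> ?B" by (simp add: cube_def)
  qed
  have "h ` cube (y + t) s \<subseteq> (+) v ` h ` ?B"
  proof
    fix w assume "w \<in> h ` cube (y + t) s"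
    then obtain z' where z': "z' \<in> cube (y + t) s" "w = h z'" by auto
    define z where "z = z' - t"
    have z: "z \<in> cube y s" using z'(1) by (auto simp: z_def cube_def algebra_simps)
    have zin: "z \<in> U" using z SB sub by blast
    have bB: "ball z (K * (2 * \<rho>)) \<subseteq> ?B"
    proof
      fix x assume "x \<in> ball z (K * (2 * \<rho>))"
      then have "norm (x - z) < 2 * K * \<rho>" by (simp add: dist_norm norm_minus_commute mult.commute mult.left_commute)
      then have xz: "\<bar>(x - z) $ i\<bar> \<le> 2 * K * \<rho>" for i
        using component_le_norm_cart[of "x - z" i] by linarith
      have zi: "y $ i \<le> z $ i" "z $ i \<le> y $ i + s" for i using z by (auto simp: cube_def)
      have "y $ i - 2 * K * \<rho> \<le> x $ i \<and> x $ i \<le> y $ i - 2 * K * \<rho> + (s + 4 * K * \<rho>)" for i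
        using xz[of i] zi[of i] by (auto simp: abs_le_iff)
      then show "x \<in> ?B" by (simp add: cube_def)
    qed
    have "norm (h (z + t) - h z - v) \<le> \<rho>" by (rule tr[OF z])
    then have "dist (h z) (w - v) < 2 * \<rho>"
      using \<open>0 < \<rho>\<close> z' norm_minus_commute[of "h z" "w - v"] by (simp add: z_def dist_norm algebra_simps)
    moreover have "ball (h z) (2 * \<rho>) \<subseteq> h ` ball z (K * (2 * \<rho>))"
      using colip zin assms(4-6) bB sub unfolding colipschitz_on_def by (meson mult_pos_pos order_trans zero_less_numeral)
    ultimately have "w - v \<in> h ` ?B" using bB by (meson image_mono mem_ball subsetD)
    then show "w \<in> (+) v ` h ` ?B" by (metis add.commute diff_add_cancel image_eqI)
  qed
  then have "measure lebesgue (h ` cube (y + t) s) \<le> measure lebesgue ((+) v ` h ` ?B)"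
    by (intro measure_lebesgue_compact_mono compact_translation cB compact_cube sub sub')
  also have "\<dots> = measure lebesgue (h ` ?B)" by (rule measure_translation)
  also have "h ` ?B = h ` cube y s \<union> h ` (?B - box y (\<chi> i. y $ i + s))"
    using SB by (auto simp: cube_eq_cbox dest: box_subset_cbox[THEN subsetD])
  also have "measure lebesgue \<dots> \<le> measure lebesgue (h ` cube y s) + measure lebesgue (h ` (?B - box y (\<chi> i. y $ i + s)))"
    by (intro measure_Un_le) (use sub SB in \<open>auto intro!: fmeasurableD lmeasurable_compact cB compact_cube compact_diff open_box\<close>)
  also have "measure lebesgue (h ` (?B - box y (\<chi> i. y $ i + s))) \<le> ?c * measure lebesgue (?B - box y (\<chi> i. y $ i + s))"
    by (intro lipschitz_image_measure compact_diff compact_cube open_box lipschitz_on_subset[OF lip]) (use sub in auto)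
  also have "measure lebesgue (?B - box y (\<chi> i. y $ i + s)) = (s + 4 * K * \<rho>) ^ CARD('n) - s ^ CARD('n)"
  proof -
    have "box y (\<chi> i. y $ i + s) \<subseteq> ?B" using SB box_subset_cbox unfolding cube_eq_cbox[of y s] by blast
    moreover have "emeasure lebesgue ?B \<noteq> \<infinity>"
      using fmeasurableD2[OF lmeasurable_compact[OF compact_cube]] by simp
    ultimately have "measure lebesgue (?B - box y (\<chi> i. y $ i + s)) = measure lebesgue ?B - measure lebesgue (box y (\<chi> i. y $ i + s))"
      by (intro measure_Diff) (auto intro: fmeasurableD lmeasurable_compact compact_cube)
    also have "measure lebesgue (box y (\<chi> i. y $ i + s)) = measure lebesgue (cube y s)"
      by (simp add: cube_eq_cbox measure_lborel_box_eq measure_lborel_cbox_eq)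
    finally show ?thesis using assms K\<rho> by (simp add: measure_lebesgue_cube)
  qed
  finally show ?thesis by simp
qed

section \<open>Porosity\<close>

lemma integrable_on_compact:
  fixes f :: "'a::euclidean_space \<Rightarrow> real"
  assumes "compact S" "continuous_on S f"
  shows "f integrable_on S"
  using borel_integrable_compact[OF assms] set_borel_integral_eq_integral(1)[of S f]
  by (simp add: set_integrable_def)

lemma integral_compact_close:
  fixes f g :: "'a::euclidean_space \<Rightarrow> real"
  assumes S: "compact S" and f: "continuous_on S f" and g: "continuous_on S g"
    and close: "\<And>x. x \<in> S \<Longrightarrow> \<bar>f x - g x\<bar> \<le> e"
  shows "\<bar>integral S f - integral S g\<bar> \<le> e * measure lebesgue S"
proof -
  have "integral S f - integral S g = integral S (\<lambda>x. f x - g x)"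
    using integrable_on_compact[OF S f] integrable_on_compact[OF S g] by (simp add: integral_diff)
  also have "norm \<dots> \<le> integral S (\<lambda>x. e)"
    by (rule integral_norm_bound_integral)
       (use close in \<open>auto intro!: integrable_on_compact S continuous_intros f g\<close>)
  also have "\<dots> = e * measure lebesgue S"
    using lmeasure_integral[OF lmeasurable_compact[OF S]] integral_mult_right[of S e "\<lambda>x. 1"] by simp
  finally show ?thesis by simp
qed

text \<open>The first alternative is met by the branches \<open>h j\<close> of \<open>f\<inverse>\<close> if \<open>f\<close> pushes Lebesgue measure to the
  density \<open>\<rho>\<close>, the second one by \<open>h 0 = f\<close> and \<open>h j = \<phi> j \<circ> f\<close> with the other branches \<open>\<phi> j\<close> of \<open>f\<inverse>\<close> if \<open>f\<close>
  pushes the density \<open>\<rho>\<close> to Lebesgue measure.\<close>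

definition branch_system ::
    "real \<Rightarrow> real^'n \<Rightarrow> real \<Rightarrow> nat \<Rightarrow> (real^'n::finite \<Rightarrow> real) \<Rightarrow> (nat \<Rightarrow> real^'n \<Rightarrow> real^'n) \<Rightarrow> bool" where
  "branch_system K u r m \<rho> h \<longleftrightarrow>
     (\<forall>j<m. K-lipschitz_on (ball u r) (h j)) \<and> (\<forall>j<m. colipschitz_on K (ball u r) (h j)) \<and>
     (\<forall>x\<in>ball u r. \<forall>y\<in>ball u r. dist x y \<le> K * dist (h 0 x) (h 0 y)) \<and>
     ((\<forall>S. compact S \<longrightarrow> S \<subseteq> ball u r \<longrightarrow> integral S \<rho> = (\<Sum>j<m. measure lebesgue (h j ` S))) \<or>
      (\<forall>j. 0 < j \<and> j < m \<longrightarrow> h j ` ball u r \<subseteq> cball 0 K - ball u r) \<and>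
      (\<forall>S. compact S \<longrightarrow> S \<subseteq> ball u r \<longrightarrow>
        measure lebesgue (h 0 ` S) = integral S \<rho> + (\<Sum>j\<in>{1..<m}. integral (h j ` S) \<rho>)))"

lemma cube_subset_origin_cube:
  fixes y :: "real^'n::finite"
  assumes "cube y s \<subseteq> cube 0 l" "0 \<le> s"
  shows "0 \<le> y $ c" "y $ c + s \<le> l"
proof -
  have "y \<in> cube y s" "(\<chi> i. y $ i + s) \<in> cube y s" using assms(2) by (auto simp: cube_def)
  then have "y \<in> cube 0 l" "(\<chi> i. y $ i + s) \<in> cube 0 l" using assms(1) by blast+
  then show "0 \<le> y $ c" "y $ c + s \<le> l" by (auto simp: cube_def)
qed

lemma cube_margin_subset_ball:
  fixes y u :: "real^'n::finite" and s l \<mu> r :: real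
  assumes "cube y s \<subseteq> cube 0 l" "0 < s" "0 \<le> \<mu>" "4 * \<mu> \<le> s" "2 * CARD('n) * l < r"
  shows "cube (y + u - (\<chi> i. 2 * \<mu>)) (s + 4 * \<mu>) \<subseteq> ball u r"
proof
  fix x assume x: "x \<in> cube (y + u - (\<chi> i. 2 * \<mu>)) (s + 4 * \<mu>)"
  have "\<bar>(x - u) $ c\<bar> \<le> 2 * l" for c
  proof -
    have "y $ c + u $ c - 2 * \<mu> \<le> x $ c" "x $ c \<le> y $ c + u $ c - 2 * \<mu> + (s + 4 * \<mu>)"
      using x by (auto simp: cube_def)
    moreover have "0 \<le> y $ c" "y $ c + s \<le> l" using cube_subset_origin_cube[OF assms(1), of c] assms(2) by auto
    ultimately show ?thesis using assms by (simp add: abs_le_iff)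
  qed
  then have "norm (x - u) \<le> CARD('n) * (2 * l)" by (rule norm_le_card_bound)
  then show "x \<in> ball u r" using assms(5) by (simp add: dist_norm norm_minus_commute)
qed

text \<open>\<open>image_measure_translate\<close> is used in both directions, with
  \<open>\<rho> = \<eta> * s\<close>. The shell is then a fixed proportion of the cube, so the bound
  scales like its volume.\<close>

lemma image_measure_pair:
  fixes h :: "real^'n::finite \<Rightarrow> real^'n" and K \<eta> l r s :: real
  assumes lip: "K-lipschitz_on (ball u r) h" and colip: "colipschitz_on K (ball u r) h"
    and "0 < K" "0 < \<eta>" "4 * K * \<eta> \<le> 1" "l \<le> 1" "2 * CARD('n) * l < r" "0 < s"
    and sub: "cube y s \<subseteq> cube 0 l" "cube (y + axis a s) s \<subseteq> cube 0 l"
    and tr: "\<And>z. z \<in> cube y s \<Longrightarrow> norm (h (z + axis a s + u) - h (z + u) - v) \<le> \<eta> * s"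
  shows "\<bar>measure lebesgue (h ` cube (y + axis a s + u) s) - measure lebesgue (h ` cube (y + u) s)\<bar>
      \<le> (2 * K * CARD('n)) ^ CARD('n) * ((1 + 4 * K * \<eta>) ^ CARD('n) - 1) * s ^ CARD('n)"
proof -
  let ?e = "axis a s :: real^'n"
  have "s \<le> l" using cube_subset_origin_cube[OF sub(1), of a] \<open>0 < s\<close> by simp
  have \<mu>: "0 \<le> K * (\<eta> * s)" "4 * (K * (\<eta> * s)) \<le> s"
    using assms(3-5,8) mult_right_mono[OF assms(5), of s] by (auto simp: algebra_simps)
  have M: "cube (y' - (\<chi> i. 2 * K * (\<eta> * s))) (s + 4 * K * (\<eta> * s)) \<subseteq> ball u r"
    "cube y' s \<subseteq> ball u r" if "y' = y + u \<or> y' = y + ?e + u" for y'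
  proof -
    show "cube (y' - (\<chi> i. 2 * K * (\<eta> * s))) (s + 4 * K * (\<eta> * s)) \<subseteq> ball u r"
      using that cube_margin_subset_ball[OF sub(1) \<open>0 < s\<close> \<mu> assms(7), of u]
        cube_margin_subset_ball[OF sub(2) \<open>0 < s\<close> \<mu> assms(7), of u] by (auto simp: mult.assoc)
    have zero: "(\<chi> i. 0) = (0::real^'n)" by (simp add: vec_eq_iff)
    show "cube y' s \<subseteq> ball u r"
      using that cube_margin_subset_ball[OF sub(1) \<open>0 < s\<close>, of 0 r u]
        cube_margin_subset_ball[OF sub(2) \<open>0 < s\<close>, of 0 r u] \<open>0 < s\<close> assms(7) by (auto simp: zero)
  qed
  have small: "2 * (\<eta> * s) < 1 / K"
  proof -
    have "4 * (K * (\<eta> * s)) \<le> 1" using \<mu>(2) \<open>s \<le> l\<close> \<open>l \<le> 1\<close> by linarith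
    then have "2 * (\<eta> * s) * K < 1" by (simp add: mult_ac)
    then show ?thesis using \<open>0 < K\<close> by (simp add: pos_less_divide_eq)
  qed
  have pos: "0 < \<eta> * s" using assms by simp
  have E: "(s + 4 * K * (\<eta> * s)) ^ CARD('n) - s ^ CARD('n) = ((1 + 4 * K * \<eta>) ^ CARD('n) - 1) * s ^ CARD('n)"
  proof -
    have "s + 4 * K * (\<eta> * s) = (1 + 4 * K * \<eta>) * s" by (simp add: algebra_simps)
    then show ?thesis by (simp only: power_mult_distrib left_diff_distrib mult_1_left)
  qed
  have U1: "measure lebesgue (h ` cube (y + u + ?e) s) \<le> measure lebesgue (h ` cube (y + u) s) +
      (2 * K * CARD('n)) ^ CARD('n) * ((s + 4 * K * (\<eta> * s)) ^ CARD('n) - s ^ CARD('n))"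
  proof (rule image_measure_translate[OF lip colip \<open>0 < K\<close> \<open>0 < s\<close> pos small M(1)])
    show "cube (y + u + ?e) s \<subseteq> ball u r" using M(2)[of "y + ?e + u"] by (simp add: algebra_simps)
    fix z assume "z \<in> cube (y + u) s"
    then have "z - u \<in> cube y s" by (auto simp: cube_def algebra_simps)
    from tr[OF this] show "norm (h (z + ?e) - h z - v) \<le> \<eta> * s" by (simp add: algebra_simps)
  qed simp
  have U2: "measure lebesgue (h ` cube (y + ?e + u + (- ?e)) s) \<le> measure lebesgue (h ` cube (y + ?e + u) s) +
      (2 * K * CARD('n)) ^ CARD('n) * ((s + 4 * K * (\<eta> * s)) ^ CARD('n) - s ^ CARD('n))"
  proof (rule image_measure_translate[OF lip colip \<open>0 < K\<close> \<open>0 < s\<close> pos small M(1), where v = "- v"])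
    show "cube (y + ?e + u + (- ?e)) s \<subseteq> ball u r" using M(2)[of "y + u"] by (simp add: algebra_simps)
    fix z assume "z \<in> cube (y + ?e + u) s"
    then have "z - ?e - u \<in> cube y s" by (auto simp: cube_def algebra_simps)
    from tr[OF this] have "norm (h z - h (z - ?e) - v) \<le> \<eta> * s" by (simp add: algebra_simps)
    moreover have "h (z + (- ?e)) - h z - (- v) = - (h z - h (z - ?e) - v)" by simp
    ultimately show "norm (h (z + (- ?e)) - h z - (- v)) \<le> \<eta> * s" by (metis norm_minus_cancel)
  qed simp
  have e: "y + u + ?e = y + ?e + u" "y + ?e + u + (- ?e) = y + u" by simp_all
  have R: "(2 * K * CARD('n)) ^ CARD('n) * ((1 + 4 * K * \<eta>) ^ CARD('n) - 1) * s ^ CARD('n)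
      = (2 * K * CARD('n)) ^ CARD('n) * ((s + 4 * K * (\<eta> * s)) ^ CARD('n) - s ^ CARD('n))"
    unfolding E by (rule mult.assoc)
  show ?thesis
    unfolding R using U1[unfolded e] U2[unfolded e] by (intro abs_leI) linarith+
qed

lemma small_power_gap:
  fixes K c \<theta> :: real
  assumes "0 < K" "0 < \<theta>"
  obtains \<eta> where "0 < \<eta>" "4 * K * \<eta> \<le> 1" "c * ((1 + 4 * K * \<eta>) ^ n - 1) \<le> \<theta>"
proof -
  have "((\<lambda>\<eta>. c * ((1 + 4 * K * \<eta>) ^ n - 1)) \<longlongrightarrow> c * ((1 + 4 * K * 0) ^ n - 1)) (at_right 0)"
    by (intro tendsto_intros)
  then have "eventually (\<lambda>\<eta>. c * ((1 + 4 * K * \<eta>) ^ n - 1) < \<theta>) (at_right 0)"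
    using assms(2) by (intro order_tendstoD) auto
  moreover have "eventually (\<lambda>\<eta>. 0 < \<eta> \<and> \<eta> < 1 / (4 * K)) (at_right 0)"
    using eventually_at_right_real[of 0 "1 / (4 * K)"] assms by simp
  ultimately have "eventually (\<lambda>\<eta>. c * ((1 + 4 * K * \<eta>) ^ n - 1) < \<theta> \<and> 0 < \<eta> \<and> \<eta> < 1 / (4 * K)) (at_right 0)"
    by (rule eventually_conj)
  then obtain \<eta> where "c * ((1 + 4 * K * \<eta>) ^ n - 1) < \<theta>" "0 < \<eta>" "\<eta> < 1 / (4 * K)"
    using eventually_happens'[OF trivial_limit_at_right_real] by blast
  then show thesis using that[of \<eta>] assms by (simp add: field_simps)
qed

text \<open>Here \<open>\<gamma>\<close> stands for the nearly constant value of the original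
  density near \<open>u\<close>, \<open>\<epsilon> / 2 * \<psi>\<close> for the perturbation,
  \<open>2 * \<beta>\<close> for the total tolerance and \<open>\<theta>\<close> for the relative
  discrepancy of image volumes. The pair of cubes has masses differing by about
  \<open>\<epsilon> / 4\<close> of the volume, whereas the equation of the branch system allows only
  a smaller difference, by \<open>num\<close>.\<close>

lemma branches_contradiction:
  fixes K r \<epsilon> \<beta> \<eta> l \<theta> \<gamma> M0 :: real and m :: nat and a :: "'n::finite" and u :: "real^'n"
    and \<psi> \<rho>' :: "real^'n \<Rightarrow> real"
  defines "c \<equiv> (2 * K * real CARD('n)) ^ CARD('n)"
  assumes pos: "0 < K" "0 < m" "0 < \<epsilon>" "0 \<le> \<beta>" "0 < \<eta>" "4 * K * \<eta> \<le> 1" "0 < l" "l \<le> 1" "2 * CARD('n) * l < r"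
    and gap: "c * ((1 + 4 * K * \<eta>) ^ CARD('n) - 1) \<le> \<theta>"
    and cr: "continuous_on UNIV \<rho>'" and c\<psi>: "continuous_on UNIV \<psi>"
    and pair: "\<And>h :: nat \<Rightarrow> real^'n \<Rightarrow> real^'n.
      (\<And>j. j < m \<Longrightarrow> K-lipschitz_on (cube 0 l) (h j)) \<Longrightarrow> l / K \<le> norm (h 0 (axis a l) - h 0 0) \<Longrightarrow>
      \<exists>y s. shifted_pair m h \<eta> \<psi> a y s \<and> cube y s \<union> cube (y + axis a s) s \<subseteq> cube 0 l"
    and near: "\<And>z. z \<in> cube 0 l \<Longrightarrow> \<bar>\<rho>' (z + u) - (\<gamma> + \<epsilon> / 2 * \<psi> z)\<bar> \<le> 2 * \<beta>"
    and far: "\<And>S. S \<subseteq> cball 0 K - ball u r \<Longrightarrow> (\<And>x y. x \<in> S \<Longrightarrow> y \<in> S \<Longrightarrow> dist x y \<le> K * (2 * CARD('n) * l)) \<Longrightarrow>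
       \<exists>k. \<bar>k\<bar> \<le> M0 \<and> (\<forall>x\<in>S. \<bar>\<rho>' x - k\<bar> \<le> 2 * \<beta>)"
    and num: "real m * \<theta> * (M0 + 1) + \<theta> + 4 * \<beta> * (1 + real m * c) < \<epsilon> / 4" and "0 \<le> M0"
  shows "\<not> branch_system K u r m \<rho>' h"
proof
  assume bs: "branch_system K u r m \<rho>' h"
  note bs' = bs[unfolded branch_system_def]
  have lip: "K-lipschitz_on (ball u r) (h j)" "colipschitz_on K (ball u r) (h j)" if "j < m" for j
    using bs'[THEN conjunct1] bs'[THEN conjunct2, THEN conjunct1] that by blast+
  have low: "dist x y \<le> K * dist (h 0 x) (h 0 y)" if "x \<in> ball u r" "y \<in> ball u r" for x y
    using bs'[THEN conjunct2, THEN conjunct2, THEN conjunct1] that by blast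
  note eqn = bs'[THEN conjunct2, THEN conjunct2, THEN conjunct2]
  let ?d = "CARD('n)"
  have "c \<ge> 0" unfolding c_def using pos(1) by (intro zero_le_power) simp
  have \<theta>0: "0 \<le> \<theta>"
  proof -
    have "0 \<le> c * ((1 + 4 * K * \<eta>) ^ ?d - 1)"
    proof (rule mult_nonneg_nonneg[OF \<open>c \<ge> 0\<close>])
      have "0 \<le> K * \<eta>" using pos(1,5) by simp
      then have "1 \<le> 1 + 4 * K * \<eta>" by simp
      then have "1 \<le> (1 + 4 * K * \<eta>) ^ ?d" by (rule one_le_power)
      then show "0 \<le> (1 + 4 * K * \<eta>) ^ ?d - 1" by simp
    qed
    then show ?thesis using gap by (rule order_trans)
  qed
  have cube_ball: "z + u \<in> ball u r" "norm z \<le> ?d * l" if "z \<in> cube 0 l" for z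
  proof -
    have "\<bar>z $ i\<bar> \<le> l" for i using that by (simp add: cube_def abs_le_iff)
    then show "norm z \<le> ?d * l" by (rule norm_le_card_bound)
    moreover have "0 < ?d * l" using pos(7) by simp
    moreover have "2 * (?d * l) < r" using pos(9) by (simp add: mult.assoc)
    ultimately have "norm z < r" by linarith
    then show "z + u \<in> ball u r" by (simp add: dist_norm)
  qed
  obtain y s where sp: "shifted_pair m (\<lambda>j z. h j (z + u)) \<eta> \<psi> a y s"
    and sub: "cube y s \<subseteq> cube 0 l" "cube (y + axis a s) s \<subseteq> cube 0 l"
  proof -
    have "K-lipschitz_on (cube 0 l) (\<lambda>z. h j (z + u))" if "j < m" for j
    proof (rule lipschitz_onI)
      fix x y :: "real^'n" assume "x \<in> cube 0 l" "y \<in> cube 0 l"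
      then show "dist (h j (x + u)) (h j (y + u)) \<le> K * dist x y"
        using lipschitz_onD[OF lip(1)[OF that], of "x + u" "y + u"] cube_ball by simp
    qed (use pos(1) in simp)
    moreover have "l / K \<le> norm (h 0 (axis a l + u) - h 0 (0 + u))"
    proof -
      have "axis a l \<in> cube 0 l" "0 \<in> cube (0::real^'n) l" using pos(7) by (auto simp: cube_def axis_def)
      then have "dist (axis a l + u) (0 + u) \<le> K * dist (h 0 (axis a l + u)) (h 0 (0 + u))"
        by (intro low cube_ball)
      then show ?thesis using pos(1,7) by (simp add: dist_norm norm_axis_real pos_divide_le_eq mult.commute)
    qed
    ultimately show thesis using pair[of "\<lambda>j z. h j (z + u)"] that by auto
  qed
  define S1 where "S1 = cube (y + u) s"
  define S2 where "S2 = cube (y + axis a s + u) s"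
  define V where "V = s ^ ?d"
  have "s > 0" using sp by (simp add: shifted_pair_def)
  then have "V > 0" by (simp add: V_def)
  obtain v where v: "\<And>j z. j < m \<Longrightarrow> z \<in> cube y s \<Longrightarrow> norm (h j (z + axis a s + u) - h j (z + u) - v j) \<le> \<eta> * s"
    using sp unfolding shifted_pair_def by blast
  have in_ball: "S1 \<subseteq> ball u r" "S2 \<subseteq> ball u r"
    and near12: "\<And>x. x \<in> S1 \<union> S2 \<Longrightarrow> x - u \<in> cube 0 l"
  proof -
    have "x - u \<in> cube y s" if "x \<in> S1" for x using that by (auto simp: S1_def cube_def algebra_simps)
    moreover have "x - u \<in> cube (y + axis a s) s" if "x \<in> S2" for x using that by (auto simp: S2_def cube_def algebra_simps)
    ultimately show *: "\<And>x. x \<in> S1 \<union> S2 \<Longrightarrow> x - u \<in> cube 0 l" using sub by blast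
    show "S1 \<subseteq> ball u r" "S2 \<subseteq> ball u r" using cube_ball(1)[OF *] by auto
  qed
  have cpt: "compact S1" "compact S2" by (simp_all add: S1_def S2_def compact_cube)
  have meas: "measure lebesgue S1 = V" "measure lebesgue S2 = V"
    using \<open>s > 0\<close> by (simp_all add: S1_def S2_def V_def measure_lebesgue_cube)
  have contS: "continuous_on S \<rho>'" for S using cr continuous_on_subset by blast
  have gcont: "continuous_on S (\<lambda>x. \<gamma> + \<epsilon> / 2 * \<psi> (x - u))" for S
    by (intro continuous_intros continuous_on_compose2[OF c\<psi>]) auto
  have shift: "integral (cube (p + u) s) (\<lambda>x. \<gamma> + \<epsilon> / 2 * \<psi> (x - u)) = \<gamma> * V + \<epsilon> / 2 * integral (cube p s) \<psi>" for p
  proof -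
    have c: "compact (cube p s)" by (rule compact_cube)
    have \<psi>i: "\<psi> integrable_on cube p s"
      by (intro integrable_on_compact c continuous_on_subset[OF c\<psi>]) auto
    have "(\<chi> i. p $ i + s) + u = (\<chi> i. (p + u) $ i + s)" by (simp add: vec_eq_iff)
    then have "integral (cube (p + u) s) (\<lambda>x. \<gamma> + \<epsilon> / 2 * \<psi> (x - u))
        = integral (cube p s) ((\<lambda>x. \<gamma> + \<epsilon> / 2 * \<psi> (x - u)) \<circ> (+) u)"
      by (simp only: cube_eq_cbox integral_shift_cbox_plus)
    also have "\<dots> = integral (cube p s) (\<lambda>x. \<gamma> + \<epsilon> / 2 * \<psi> x)" by (simp add: o_def)
    also have "\<dots> = integral (cube p s) (\<lambda>x. \<gamma>) + integral (cube p s) (\<lambda>x. \<epsilon> / 2 * \<psi> x)"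
      using integrable_on_mult_right[OF \<psi>i, of "\<epsilon> / 2"]
      by (intro integral_add integrable_on_compact[OF c continuous_on_const])
    also have "integral (cube p s) (\<lambda>x. \<gamma>) = \<gamma> * V"
      using lmeasure_integral[OF lmeasurable_compact[OF c]] integral_mult_right[of "cube p s" \<gamma> "\<lambda>x. 1"]
        measure_lebesgue_cube[of s p] \<open>s > 0\<close> by (simp add: V_def)
    finally show ?thesis by simp
  qed
  have close: "\<bar>integral S \<rho>' - integral S (\<lambda>x. \<gamma> + \<epsilon> / 2 * \<psi> (x - u))\<bar> \<le> 2 * \<beta> * measure lebesgue S"
    if "compact S" "S \<subseteq> S1 \<union> S2" for S
  proof (rule integral_compact_close[OF that(1) contS gcont])
    fix x assume "x \<in> S"
    then have "x - u \<in> cube 0 l" using near12 that(2) by blast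
    from near[OF this] show "\<bar>\<rho>' x - (\<gamma> + \<epsilon> / 2 * \<psi> (x - u))\<bar> \<le> 2 * \<beta>" by simp
  qed
  define I1 where "I1 = integral (cube y s) \<psi>"
  define I2 where "I2 = integral (cube (y + axis a s) s) \<psi>"
  define W where "W = integral S2 \<rho>' - integral S1 \<rho>'"
  have "V / 2 \<le> \<bar>I2 - I1\<bar>" using sp by (simp add: shifted_pair_def V_def I1_def I2_def)
  then have "\<epsilon> / 2 * (V / 2) \<le> \<epsilon> / 2 * \<bar>I2 - I1\<bar>" using pos(3) by (intro mult_left_mono) auto
  moreover have "\<epsilon> / 2 * \<bar>I2 - I1\<bar> = \<bar>\<epsilon> / 2 * I2 - \<epsilon> / 2 * I1\<bar>"
    using pos(3) by (simp only: right_diff_distrib[symmetric] abs_mult)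
  moreover have "\<bar>W - (\<epsilon> / 2 * I2 - \<epsilon> / 2 * I1)\<bar> \<le> 4 * \<beta> * V"
    using close[OF cpt(1)] close[OF cpt(2)] shift[of y] shift[of "y + axis a s"]
    unfolding W_def meas I1_def I2_def by (simp add: S1_def S2_def) 
  \<comment> \<open>Each of the two masses may be off by \<open>2 * \<beta> * V\<close>.\<close>
  ultimately have Wlow: "\<epsilon> / 4 * V - 4 * \<beta> * V \<le> \<bar>W\<bar>" by linarith
  have vol: "\<bar>measure lebesgue (h j ` S2) - measure lebesgue (h j ` S1)\<bar> \<le> \<theta> * V" if "j < m" for j
  proof -
    have "\<bar>measure lebesgue (h j ` S2) - measure lebesgue (h j ` S1)\<bar> \<le> c * ((1 + 4 * K * \<eta>) ^ ?d - 1) * V"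
      unfolding S1_def S2_def V_def c_def
      by (rule image_measure_pair[OF lip[OF that] pos(1,5,6,8,9) \<open>s > 0\<close> sub v[OF that]])
    also have "\<dots> \<le> \<theta> * V" using gap \<open>V > 0\<close> by (intro mult_right_mono) auto
    finally show ?thesis .
  qed
  have upper: "measure lebesgue (h j ` S) \<le> c * measure lebesgue S" if "j < m" "compact S" "S \<subseteq> ball u r" for j S
    unfolding c_def by (intro lipschitz_image_measure that lipschitz_on_subset[OF lip(1)[OF that(1)]])
  have hcpt: "compact (h j ` S)" if "j < m" "compact S" "S \<subseteq> ball u r" for j S
    using lip(1)[OF that(1)] that lipschitz_on_subset lipschitz_on_continuous_on
    by (intro compact_continuous_image) blast+
  have "\<bar>W\<bar> \<le> (real m * \<theta> * (M0 + 1) + \<theta> + 4 * \<beta> * (real m * c)) * V"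
    using eqn
  proof
    assume "\<forall>S. compact S \<longrightarrow> S \<subseteq> ball u r \<longrightarrow> integral S \<rho>' = (\<Sum>j<m. measure lebesgue (h j ` S))"
    then have "W = (\<Sum>j<m. measure lebesgue (h j ` S2) - measure lebesgue (h j ` S1))"
      using cpt in_ball by (simp add: W_def sum_subtractf)
    also have "\<bar>\<dots>\<bar> \<le> (\<Sum>j<m. \<theta> * V)" by (intro order_trans[OF sum_abs] sum_mono vol) auto
    also have "\<dots> = real m * \<theta> * 1 * V" by simp
    also have "\<dots> \<le> (real m * \<theta> * (M0 + 1) + \<theta> + 4 * \<beta> * (real m * c)) * V"
    proof (rule mult_right_mono)
      have "real m * \<theta> * 1 \<le> real m * \<theta> * (M0 + 1)" using \<theta>0 \<open>0 \<le> M0\<close> by (intro mult_left_mono) auto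
      moreover have "0 \<le> 4 * \<beta> * (real m * c)" using pos(4) \<open>c \<ge> 0\<close> by simp
      ultimately show "real m * \<theta> * 1 \<le> real m * \<theta> * (M0 + 1) + \<theta> + 4 * \<beta> * (real m * c)" using \<theta>0 by linarith
    qed (use \<open>V > 0\<close> in simp)
    finally show ?thesis .
  next
    assume far_eqn: "(\<forall>j. 0 < j \<and> j < m \<longrightarrow> h j ` ball u r \<subseteq> cball 0 K - ball u r) \<and>
      (\<forall>S. compact S \<longrightarrow> S \<subseteq> ball u r \<longrightarrow>
        measure lebesgue (h 0 ` S) = integral S \<rho>' + (\<Sum>j\<in>{1..<m}. integral (h j ` S) \<rho>'))"
    then have "W = (measure lebesgue (h 0 ` S2) - measure lebesgue (h 0 ` S1))
        - (\<Sum>j\<in>{1..<m}. integral (h j ` S2) \<rho>' - integral (h j ` S1) \<rho>')"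
      using cpt in_ball by (simp add: W_def sum_subtractf)
    moreover have "\<bar>integral (h j ` S2) \<rho>' - integral (h j ` S1) \<rho>'\<bar> \<le> (M0 * \<theta> + 4 * \<beta> * c) * V"
      if j: "j \<in> {1..<m}" for j
    proof -
      have jm: "j < m" "0 < j" using j by auto
      \<comment> \<open>The same constant \<open>k\<close> serves both images, so that the
        difference of the integrals reduces, up to the tolerance, to \<open>k\<close> times the
        difference of the volumes.\<close>
      have "\<exists>k. \<bar>k\<bar> \<le> M0 \<and> (\<forall>x\<in>h j ` (S1 \<union> S2). \<bar>\<rho>' x - k\<bar> \<le> 2 * \<beta>)"
      proof (rule far)
        show "h j ` (S1 \<union> S2) \<subseteq> cball 0 K - ball u r" using far_eqn jm in_ball by blast
        fix p q assume "p \<in> h j ` (S1 \<union> S2)" "q \<in> h j ` (S1 \<union> S2)"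
        then obtain x z where xz: "x \<in> S1 \<union> S2" "z \<in> S1 \<union> S2" "p = h j x" "q = h j z" by blast
        then have "dist p q \<le> K * dist x z" using lipschitz_onD[OF lip(1)[OF jm(1)], of x z] in_ball by blast
        also have "\<dots> \<le> K * (2 * ?d * l)"
        proof (rule mult_left_mono)
          have "dist x z \<le> norm (x - u) + norm (z - u)"
            using dist_triangle2[of x z u] by (simp add: dist_norm)
          then show "dist x z \<le> 2 * ?d * l"
            using cube_ball(2)[OF near12[OF xz(1)]] cube_ball(2)[OF near12[OF xz(2)]] by simp
        qed (use pos(1) in simp)
        finally show "dist p q \<le> K * (2 * ?d * l)" .
      qed
      then obtain k where k: "\<bar>k\<bar> \<le> M0" "\<And>x. x \<in> h j ` S1 \<union> h j ` S2 \<Longrightarrow> \<bar>\<rho>' x - k\<bar> \<le> 2 * \<beta>"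
        by (auto simp: image_Un)
      have one: "\<bar>integral (h j ` S) \<rho>' - k * measure lebesgue (h j ` S)\<bar> \<le> 2 * \<beta> * c * V"
        if S: "S = S1 \<or> S = S2" for S
      proof -
        have SS: "compact S" "S \<subseteq> ball u r" "measure lebesgue S = V" using S cpt in_ball meas by auto
        have cS: "compact (h j ` S)" by (rule hcpt[OF jm(1) SS(1,2)])
        have "\<bar>integral (h j ` S) \<rho>' - integral (h j ` S) (\<lambda>x. k)\<bar> \<le> 2 * \<beta> * measure lebesgue (h j ` S)"
          by (rule integral_compact_close[OF cS contS continuous_on_const]) (use k(2) S in blast)
        moreover have "integral (h j ` S) (\<lambda>x. k) = k * measure lebesgue (h j ` S)"
          using lmeasure_integral[OF lmeasurable_compact[OF cS]] integral_mult_right[of "h j ` S" k "\<lambda>x. 1"] by simp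
        moreover have "2 * \<beta> * measure lebesgue (h j ` S) \<le> 2 * \<beta> * (c * V)"
          using upper[OF jm(1) SS(1,2)] SS(3) pos(4) by (intro mult_left_mono) auto
        ultimately show ?thesis by (simp add: mult_ac)
      qed
      have "\<bar>k * (measure lebesgue (h j ` S2) - measure lebesgue (h j ` S1))\<bar> \<le> M0 * (\<theta> * V)"
        unfolding abs_mult using k(1) vol[OF jm(1)] \<open>0 \<le> M0\<close> by (intro mult_mono) auto
      then have "\<bar>k * measure lebesgue (h j ` S2) - k * measure lebesgue (h j ` S1)\<bar> \<le> M0 * (\<theta> * V)"
        by (simp add: right_diff_distrib)
      moreover have "(M0 * \<theta> + 4 * \<beta> * c) * V = M0 * (\<theta> * V) + 2 * \<beta> * c * V + 2 * \<beta> * c * V"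
        by (simp add: algebra_simps)
      ultimately show ?thesis using one[of S1, OF disjI1[OF refl]] one[of S2, OF disjI2[OF refl]] by linarith
    qed
    then have "\<bar>\<Sum>j\<in>{1..<m}. integral (h j ` S2) \<rho>' - integral (h j ` S1) \<rho>'\<bar> \<le> (\<Sum>j\<in>{1..<m}. (M0 * \<theta> + 4 * \<beta> * c) * V)"
      by (intro order_trans[OF sum_abs] sum_mono)
    moreover have "(\<Sum>j\<in>{1..<m}. (M0 * \<theta> + 4 * \<beta> * c) * V) \<le> real m * ((M0 * \<theta> + 4 * \<beta> * c) * V)"
      using \<theta>0 \<open>0 \<le> M0\<close> \<open>c \<ge> 0\<close> pos(4) \<open>V > 0\<close> by (simp add: mult_right_mono)
    ultimately have "\<bar>W\<bar> \<le> \<theta> * V + real m * ((M0 * \<theta> + 4 * \<beta> * c) * V)"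
      using vol[OF \<open>0 < m\<close>] by linarith
    also have "\<dots> = (real m * \<theta> * M0 + \<theta> + 4 * \<beta> * (real m * c)) * V" by (simp add: algebra_simps)
    also have "\<dots> \<le> (real m * \<theta> * (M0 + 1) + \<theta> + 4 * \<beta> * (real m * c)) * V"
      using \<theta>0 \<open>V > 0\<close> by (intro mult_right_mono add_mono order_refl mult_left_mono) auto
    finally show ?thesis .
  qed
  then have "\<epsilon> / 4 * V \<le> (real m * \<theta> * (M0 + 1) + \<theta> + 4 * \<beta> * (1 + real m * c)) * V"
    using Wlow by (simp add: algebra_simps)
  then have "\<epsilon> / 4 \<le> real m * \<theta> * (M0 + 1) + \<theta> + 4 * \<beta> * (1 + real m * c)" using \<open>V > 0\<close> by simp
  then show False using num by linarith
qed

text \<open>The ratio \<open>\<alpha>\<close> is fixed by \<open>K\<close>, \<open>m\<close> and the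
  dimension. The length \<open>l\<close>, the closeness \<open>\<eta>\<close> and the density
  \<open>\<psi>\<close> are chosen after \<open>\<rho>\<close> and
  \<open>\<epsilon>\<close>.\<close>

theorem porous_at_branch_system:
  fixes K r :: real and m :: nat and u :: "real^'n::finite" and \<rho> :: "(real^'n) \<Rightarrow>\<^sub>C real"
  assumes "CARD('n) \<ge> 2" "0 < K" "0 < r" "0 < m"
  shows "porous_at {\<rho>. \<exists>h. branch_system K u r m (apply_bcontfun \<rho>) h} \<rho>"
proof -
  obtain a b :: 'n where "a \<noteq> b"
  proof -
    have "\<not> card (UNIV :: 'n set) \<le> Suc 0" using assms(1) by simp
    then show thesis using that card_le_Suc0_iff_eq[of "UNIV :: 'n set"] by auto
  qed
  define d where "d = real CARD('n)"
  have "d > 0" by (simp add: d_def)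
  define c where "c = (2 * K * d) ^ CARD('n)"
  have "c \<ge> 0" unfolding c_def using \<open>0 < K\<close> \<open>d > 0\<close> by (intro zero_le_power) simp
  \<comment> \<open>With \<open>\<beta> = \<alpha> * \<epsilon>\<close> the tolerance terms in
    \<open>num\<close> amount to \<open>\<epsilon> / 16\<close>. Together with
    \<open>\<epsilon> / 32\<close> from the volume discrepancy \<open>\<theta>\<close> this stays
    below \<open>\<epsilon> / 4\<close>.\<close>
  define \<alpha> where "\<alpha> = 1 / (64 * (1 + real m * c))"
  have den: "1 \<le> 1 + real m * c" using \<open>c \<ge> 0\<close> by simp
  have \<alpha>: "0 < \<alpha>" "\<alpha> < 1" "4 * \<alpha> * (1 + real m * c) = 1/16" using den by (simp_all add: \<alpha>_def)
  show ?thesis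
    unfolding porous_at_def
  proof (intro exI[of _ 1] conjI bexI[of _ \<alpha>] ballI)
    fix \<epsilon> :: real assume "\<epsilon> \<in> {0<..<1}"
    then have \<epsilon>: "0 < \<epsilon>" by simp
    define \<beta> where "\<beta> = \<alpha> * \<epsilon>"
    have \<beta>: "0 < \<beta>" using \<alpha> \<epsilon> by (simp add: \<beta>_def)
    define M0 where "M0 = norm \<rho>"
    have M0: "0 \<le> M0" "\<And>x. \<bar>apply_bcontfun \<rho> x\<bar> \<le> M0" using norm_bounded[of \<rho>] by (auto simp: M0_def)
    define T where "T = 1 + real m * (M0 + 1)"
    have T: "1 \<le> T" using M0 by (simp add: T_def)
    define \<theta> where "\<theta> = \<epsilon> / (32 * T)"
    have \<theta>: "0 < \<theta>" "\<theta> * T = \<epsilon> / 32" using \<epsilon> T by (simp_all add: \<theta>_def)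
    have num: "real m * \<theta> * (M0 + 1) + \<theta> + 4 * \<beta> * (1 + real m * c) < \<epsilon> / 4"
    proof -
      have "real m * \<theta> * (M0 + 1) + \<theta> = \<theta> * T" by (simp add: T_def algebra_simps)
      moreover have "4 * \<beta> * (1 + real m * c) = (4 * \<alpha> * (1 + real m * c)) * \<epsilon>" by (simp add: \<beta>_def)
      ultimately show ?thesis using \<theta>(2) \<epsilon> unfolding \<alpha>(3) by linarith
    qed
    obtain \<eta> where \<eta>: "0 < \<eta>" "4 * K * \<eta> \<le> 1" "c * ((1 + 4 * K * \<eta>) ^ CARD('n) - 1) \<le> \<theta>"
      by (rule small_power_gap[OF \<open>0 < K\<close> \<theta>(1)])
    have "uniformly_continuous_on (cball 0 K) (apply_bcontfun \<rho>)"
      by (intro compact_uniformly_continuous) auto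
    then obtain \<delta>1 where \<delta>1: "0 < \<delta>1" "\<And>x x'. x \<in> cball 0 K \<Longrightarrow> x' \<in> cball 0 K \<Longrightarrow> dist x' x < \<delta>1 \<Longrightarrow>
        dist (apply_bcontfun \<rho> x') (apply_bcontfun \<rho> x) < \<beta>"
      using \<beta> unfolding uniformly_continuous_on_def by metis
    have "isCont (apply_bcontfun \<rho>) u"
      using continuous_on_apply_bcontfun[of UNIV \<rho>] continuous_on_eq_continuous_at[of UNIV] by blast
    then obtain \<delta>2 where \<delta>2: "0 < \<delta>2" "\<And>x. dist x u < \<delta>2 \<Longrightarrow> dist (apply_bcontfun \<rho> x) (apply_bcontfun \<rho> u) < \<beta>"
      using \<beta> unfolding continuous_at by (metis LIM_def dist_self)
    \<comment> \<open>The three bounds keep the perturbation inside \<open>ball u r\<close>, make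
      \<open>\<rho>\<close> nearly constant on the cube at \<open>u\<close>, and make it nearly
      constant on the images of the cube under the other maps, which have diameter at most
      \<open>K * (2 * d * l)\<close>.\<close>
    define q where "q = min r (min \<delta>2 (\<delta>1 / K))"
    have q: "0 < q" "q \<le> r" "q \<le> \<delta>2" "q \<le> \<delta>1 / K" using assms \<delta>1(1) \<delta>2(1) by (auto simp: q_def)
    define l where "l = min 1 (q / (4 * d))"
    have l: "0 < l" "l \<le> 1" using q \<open>d > 0\<close> by (auto simp: l_def)
    have "l \<le> q / (4 * d)" by (simp add: l_def)
    then have "l * (4 * d) \<le> q" using \<open>d > 0\<close> by (simp add: pos_le_divide_eq)
    then have dl: "4 * (d * l) \<le> q" by (simp add: mult_ac)
    have dl0: "0 < d * l" using l \<open>d > 0\<close> by simp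
    have dlr: "2 * d * l < r" "d * l < \<delta>2" using dl dl0 q by auto
    have dl\<delta>: "K * (2 * d * l) < \<delta>1"
    proof -
      have "4 * (d * l) \<le> \<delta>1 / K" using dl q by linarith
      then have "4 * (d * l) * K \<le> \<delta>1" using \<open>0 < K\<close> by (simp add: pos_le_divide_eq)
      moreover have "0 < d * l * K" using dl0 \<open>0 < K\<close> by simp
      ultimately show ?thesis by (simp add: mult_ac)
    qed
    obtain \<psi> where \<psi>: "continuous_on UNIV \<psi>" "\<And>z. \<bar>\<psi> z\<bar> \<le> 1"
      and pair: "\<And>h :: nat \<Rightarrow> real^'n \<Rightarrow> real^'n.
      (\<And>j. j < m \<Longrightarrow> K-lipschitz_on (cube 0 l) (h j)) \<Longrightarrow> l / K \<le> norm (h 0 (axis a l) - h 0 0) \<Longrightarrow>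
      \<exists>y s. shifted_pair m h \<eta> \<psi> a y s \<and> cube y s \<union> cube (y + axis a s) s \<subseteq> cube 0 l"
      using non_translation_density[OF \<open>0 < K\<close> \<eta>(1) \<open>a \<noteq> b\<close> l(1) \<open>0 < m\<close>] by metis
    \<comment> \<open>The cut-off is 1 on a ball containing the cube at \<open>u\<close> and 0
      outside \<open>ball u r\<close>; the other images avoid \<open>ball u r\<close>, so
      \<open>\<rho>\<close> is unchanged on them.\<close>
    define g where "g x = max 0 (min 1 (2 - dist x u / (d * l)))" for x
    have g: "0 \<le> g x" "g x \<le> 1" for x by (auto simp: g_def)
    have g1: "g x = 1" if "dist x u \<le> d * l" for x
    proof -
      have "dist x u / (d * l) \<le> 1" using that dl0 by simp
      then show ?thesis by (simp add: g_def)
    qed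
    have g0: "g x = 0" if "r \<le> dist x u" for x
    proof -
      have "2 * (d * l) \<le> dist x u" using that dlr(1) by (simp add: mult.assoc)
      then have "2 \<le> dist x u / (d * l)" using dl0 by (simp add: pos_le_divide_eq)
      then show ?thesis by (simp add: g_def)
    qed
    define F where "F x = apply_bcontfun \<rho> x + \<epsilon> / 2 * (g x * \<psi> (x - u))" for x
    have pert: "\<bar>\<epsilon> / 2 * (g x * \<psi> (x - u))\<bar> \<le> \<epsilon> / 2" for x
    proof -
      have "g x * \<bar>\<psi> (x - u)\<bar> \<le> 1 * 1" using g \<psi>(2) by (intro mult_mono) auto
      then show ?thesis using \<epsilon> g(1)[of x] by (simp add: abs_mult)
    qed
    have "F \<in> bcontfun"
    proof (rule bcontfun_normI)
      have "continuous_on UNIV (\<lambda>x. \<psi> (x - u))"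
        by (intro continuous_on_compose2[OF \<psi>(1)] continuous_intros) auto
      then show "continuous_on UNIV F"
        unfolding F_def g_def using dl0 by (intro continuous_intros) auto
      show "norm (F x) \<le> M0 + \<epsilon> / 2" for x
        unfolding F_def real_norm_def by (rule order_trans[OF abs_triangle_ineq]) (intro add_mono M0 pert)
    qed
    define \<rho>1 where "\<rho>1 = Bcontfun F"
    have \<rho>1: "apply_bcontfun \<rho>1 = F" unfolding \<rho>1_def by (rule Bcontfun_inverse) fact
    show "\<exists>y. norm (y - \<rho>) < \<epsilon> \<and> ball y (\<alpha> * \<epsilon>) \<inter> {\<rho>. \<exists>h. branch_system K u r m (apply_bcontfun \<rho>) h} = {}"
    proof (intro exI[of _ \<rho>1] conjI equals0I)
      have "dist \<rho>1 \<rho> \<le> \<epsilon> / 2"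
        by (rule dist_bound) (use pert in \<open>simp add: \<rho>1 F_def dist_real_def\<close>)
      then show "norm (\<rho>1 - \<rho>) < \<epsilon>" using \<epsilon> by (simp add: dist_norm)
      fix \<rho>2 assume "\<rho>2 \<in> ball \<rho>1 (\<alpha> * \<epsilon>) \<inter> {\<rho>. \<exists>h. branch_system K u r m (apply_bcontfun \<rho>) h}"
      then obtain h where h: "branch_system K u r m (apply_bcontfun \<rho>2) h" and "dist \<rho>1 \<rho>2 < \<beta>"
        by (auto simp: \<beta>_def)
      then have close: "\<bar>apply_bcontfun \<rho>2 x - F x\<bar> \<le> \<beta>" for x
        using dist_bounded[of \<rho>2 x \<rho>1] by (simp add: \<rho>1 dist_real_def dist_commute)
      have "\<not> branch_system K u r m (apply_bcontfun \<rho>2) h"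
      proof (rule branches_contradiction[where \<epsilon> = \<epsilon> and \<beta> = \<beta> and \<eta> = \<eta> and l = l and \<theta> = \<theta> and \<gamma> = "apply_bcontfun \<rho> u"
            and ?M0.0 = M0 and \<psi> = \<psi> and a = a])
        show "real (2 * CARD('n)) * l < r" using dlr(1) by (simp add: d_def)
        show "(2 * K * real CARD('n)) ^ CARD('n) * ((1 + 4 * K * \<eta>) ^ CARD('n) - 1) \<le> \<theta>"
          using \<eta>(3) by (simp only: c_def d_def)
        show "real m * \<theta> * (M0 + 1) + \<theta> + 4 * \<beta> * (1 + real m * (2 * K * real CARD('n)) ^ CARD('n)) < \<epsilon> / 4"
          using num by (simp only: c_def d_def)
        show "\<bar>apply_bcontfun \<rho>2 (z + u) - (apply_bcontfun \<rho> u + \<epsilon> / 2 * \<psi> z)\<bar> \<le> 2 * \<beta>" if "z \<in> cube 0 l" for z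
        proof -
          have "\<bar>z $ i\<bar> \<le> l" for i using that by (simp add: cube_def abs_le_iff)
          then have "norm z \<le> d * l" unfolding d_def by (rule norm_le_card_bound)
          then have "dist (z + u) u \<le> d * l" by (simp add: dist_norm)
          then have "F (z + u) = apply_bcontfun \<rho> (z + u) + \<epsilon> / 2 * \<psi> z"
            "dist (apply_bcontfun \<rho> (z + u)) (apply_bcontfun \<rho> u) < \<beta>"
            using g1[of "z + u"] \<delta>2(2)[of "z + u"] dlr(2) by (simp_all add: F_def)
          then show ?thesis using close[of "z + u"] by (simp add: dist_real_def)
        qed
        show "\<exists>k. \<bar>k\<bar> \<le> M0 \<and> (\<forall>x\<in>S. \<bar>apply_bcontfun \<rho>2 x - k\<bar> \<le> 2 * \<beta>)"
          if S: "S \<subseteq> cball 0 K - ball u r" "\<And>x y. x \<in> S \<Longrightarrow> y \<in> S \<Longrightarrow> dist x y \<le> K * (real (2 * CARD('n)) * l)" for S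
        proof (cases "S = {}")
          case True
          then show ?thesis using M0 by (intro exI[of _ 0]) auto
        next
          case False
          then obtain x0 where x0: "x0 \<in> S" by blast
          have "\<bar>apply_bcontfun \<rho>2 x - apply_bcontfun \<rho> x0\<bar> \<le> 2 * \<beta>" if x: "x \<in> S" for x
          proof -
            have "r \<le> dist x u" using S(1) x by (auto simp: dist_commute)
            then have "F x = apply_bcontfun \<rho> x" using g0 by (simp add: F_def)
            moreover have "dist x x0 < \<delta>1" using S(2)[OF x x0] dl\<delta> by (simp add: d_def)
            then have "dist (apply_bcontfun \<rho> x) (apply_bcontfun \<rho> x0) < \<beta>"
              using S(1) x x0 by (intro \<delta>1(2)) auto
            ultimately show ?thesis using close[of x] by (simp add: dist_real_def)
          qed
          then show ?thesis using M0 by blast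
        qed
      qed (use assms \<epsilon> \<beta> \<eta> l \<psi> pair M0 in auto)
      then show False using h by blast
    qed
  qed (use \<alpha> in auto)
qed

section \<open>The two equations\<close>

lemma measure_density_compact:
  fixes g :: "'a::euclidean_space \<Rightarrow> real"
  assumes S: "compact S" and g: "continuous_on UNIV g" "\<And>x. 0 \<le> g x"
  shows "measure (density lborel (\<lambda>x. ennreal (g x))) S = integral S g"
proof -
  have gS: "continuous_on S g" using g(1) continuous_on_subset by blast
  have int: "integrable lborel (\<lambda>x. indicator S x *\<^sub>R g x)" by (rule borel_integrable_compact[OF S gS])
  have gm: "g \<in> borel_measurable borel" by (rule borel_measurable_continuous_onI[OF g(1)])
  have Sb: "S \<in> sets borel" using S by (simp add: borel_compact)
  have "emeasure (density lborel (\<lambda>x. ennreal (g x))) S = (\<integral>\<^sup>+x. ennreal (g x) * indicator S x \<partial>lborel)"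
    using gm Sb by (intro emeasure_density) auto
  also have "\<dots> = (\<integral>\<^sup>+x. ennreal (indicator S x *\<^sub>R g x) \<partial>lborel)"
    by (intro nn_integral_cong) (simp add: indicator_def)
  also have "\<dots> = ennreal (\<integral>x. indicator S x *\<^sub>R g x \<partial>lborel)"
    using g(2) by (intro nn_integral_eq_integral[OF int]) (auto simp: indicator_def)
  also have "(\<integral>x. indicator S x *\<^sub>R g x \<partial>lborel) = integral S g"
    using set_borel_integral_eq_integral(2)[of S g] int by (simp add: set_integrable_def set_lebesgue_integral_def)
  finally have "emeasure (density lborel (\<lambda>x. ennreal (g x))) S = ennreal (integral S g)" .
  moreover have "0 \<le> integral S g"
    by (rule integral_nonneg) (use integrable_on_compact[OF S gS] g(2) in auto)
  ultimately show ?thesis by (simp add: measure_def)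
qed

lemma integral_pos_minus_neg:
  fixes g :: "'a::euclidean_space \<Rightarrow> real"
  assumes S: "compact S" and g: "continuous_on UNIV g"
  shows "measure (pos_measure g) S - measure (neg_measure g) S = integral S g"
proof -
  have c: "continuous_on UNIV (\<lambda>x. max (g x) 0)" "continuous_on UNIV (\<lambda>x. max (- g x) 0)"
    by (intro continuous_intros g)+
  have cS: "continuous_on S (\<lambda>x. max (g x) 0)" "continuous_on S (\<lambda>x. max (- g x) 0)"
    using c continuous_on_subset by blast+
  have "integral S (\<lambda>x. max (g x) 0) - integral S (\<lambda>x. max (- g x) 0)
      = integral S (\<lambda>x. max (g x) 0 - max (- g x) 0)"
    using integrable_on_compact[OF S cS(1)] integrable_on_compact[OF S cS(2)] by (simp add: integral_diff)
  also have "(\<lambda>x. max (g x) 0 - max (- g x) 0) = g" by (auto simp: max_def)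
  finally show ?thesis
    unfolding pos_measure_def neg_measure_def using measure_density_compact[OF S c(1)] measure_density_compact[OF S c(2)] by simp
qed

text \<open>Compact sets are bounded Borel sets, so on them the nonnegative and the signed reading
  of the equation give the same formula.\<close>

lemma pushes_lebesgue_to_density_compact:
  fixes f :: "'a::euclidean_space \<Rightarrow> 'a"
  assumes p: "pushes_lebesgue_to_density f \<rho>" and f: "continuous_on UNIV f" and \<rho>: "continuous_on UNIV \<rho>"
    and S: "compact S"
  shows "measure lborel (f -` S) = integral S \<rho>"
proof -
  have fm: "f \<in> borel_measurable borel" by (rule borel_measurable_continuous_onI[OF f])
  have Sb: "S \<in> sets borel" "bounded S" using S by (simp_all add: borel_compact compact_imp_bounded)
  have "measure (distr lborel borel f) S = measure lborel (f -` S)"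
    using fm Sb by (subst measure_distr) auto
  moreover have "measure (distr lborel borel f) S = integral S \<rho>"
  proof (cases "\<forall>x. 0 \<le> \<rho> x")
    case True
    then have "distr lborel borel f = density lborel (\<lambda>x. ennreal (\<rho> x))"
      using p by (simp add: pushes_lebesgue_to_density_def)
    then show ?thesis using measure_density_compact[OF S \<rho>] True by simp
  next
    case False
    then have "measure (distr lborel borel f) S = measure (pos_measure \<rho>) S - measure (neg_measure \<rho>) S"
      using p Sb by (simp add: pushes_lebesgue_to_density_def)
    then show ?thesis using integral_pos_minus_neg[OF S \<rho>] by simp
  qed
  ultimately show ?thesis by simp
qed

text \<open>Compactness of the preimage makes the positive and the negative part finite, so that
  their difference is the integral of \<open>\<rho>\<close>; the finitely many sheets provide
  it.\<close>

lemma pushes_density_to_lebesgue_compact: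
  fixes f :: "'a::euclidean_space \<Rightarrow> 'a"
  assumes p: "pushes_density_to_lebesgue f \<rho>" and f: "continuous_on UNIV f" and \<rho>: "continuous_on UNIV \<rho>"
    and S: "compact S" and pre: "compact (f -` S)"
  shows "measure lborel S = integral (f -` S) \<rho>"
proof -
  have fm: "f \<in> borel_measurable borel" by (rule borel_measurable_continuous_onI[OF f])
  have Sb: "S \<in> sets borel" "bounded S" using S by (simp_all add: borel_compact compact_imp_bounded)
  have d: "measure (distr (density lborel g) borel f) S = measure (density lborel g) (f -` S)" for g
    using fm Sb by (subst measure_distr) (auto simp: measurable_def)
  show ?thesis
  proof (cases "\<forall>x. 0 \<le> \<rho> x")
    case True
    then have "distr (density lborel (\<lambda>x. ennreal (\<rho> x))) borel f = lborel"
      using p by (simp add: pushes_density_to_lebesgue_def)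
    then show ?thesis using d[of "\<lambda>x. ennreal (\<rho> x)"] measure_density_compact[OF pre \<rho>] True by simp
  next
    case False
    then have "measure (distr (pos_measure \<rho>) borel f) S - measure (distr (neg_measure \<rho>) borel f) S = measure lborel S"
      using p Sb by (simp add: pushes_density_to_lebesgue_def)
    then show ?thesis
      using integral_pos_minus_neg[OF pre \<rho>] d unfolding pos_measure_def neg_measure_def by simp
  qed
qed

lemma integral_disjoint_compact_UN:
  fixes T :: "nat \<Rightarrow> 'a::euclidean_space set" and g :: "'a \<Rightarrow> real"
  assumes "\<And>j. j < m \<Longrightarrow> compact (T j)" "continuous_on UNIV g"
    and disj: "\<And>i j. i < m \<Longrightarrow> j < m \<Longrightarrow> i \<noteq> j \<Longrightarrow> T i \<inter> T j = {}"
  shows "integral (\<Union>j<m. T j) g = (\<Sum>j<m. integral (T j) g)"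
proof (rule integral_unique)
  show "(g has_integral (\<Sum>j<m. integral (T j) g)) (\<Union>j<m. T j)"
  proof (rule has_integral_UN)
    fix j assume "j \<in> {..<m}"
    then show "(g has_integral integral (T j) g) (T j)"
      using assms by (intro integrable_integral integrable_on_compact continuous_on_subset[OF assms(2)]) auto
  next
    show "pairwise (\<lambda>i j. negligible (T i \<inter> T j)) {..<m}"
      using disj by (auto simp: pairwise_def)
  qed simp
qed

lemma measure_disjoint_compact_UN:
  fixes T :: "nat \<Rightarrow> 'a::euclidean_space set"
  assumes c: "\<And>j. j < m \<Longrightarrow> compact (T j)"
    and disj: "\<And>i j. i < m \<Longrightarrow> j < m \<Longrightarrow> i \<noteq> j \<Longrightarrow> T i \<inter> T j = {}"
  shows "measure lebesgue (\<Union>j<m. T j) = (\<Sum>j<m. measure lebesgue (T j))"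
  by (rule measure_negligible_finite_Union_image)
     (use disj c in \<open>auto simp: pairwise_def intro: lmeasurable_compact\<close>)

section \<open>Branch systems from the two equations\<close>

locale lipschitz_branches = branches +
  fixes L :: real
  assumes lip: "L-lipschitz_on UNIV f"
begin

lemma cont: "continuous_on S f"
  using lipschitz_on_continuous_on[OF lip] continuous_on_subset by blast

lemma L0: "0 \<le> L" using lip lipschitz_on_nonneg by blast

lemma f_dist: "dist (f x) (f x') \<le> L * dist x x'"
  using lipschitz_onD[OF lip] by simp

lemma \<phi>_lip: "C'-lipschitz_on (ball y \<delta>) (\<phi> j)" if "j < m"
  using that \<phi>_dist pos by (intro lipschitz_onI) auto

lemma \<phi>_compact: "compact (\<phi> j ` S)" if "j < m" "compact S" "S \<subseteq> ball y \<delta>"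
  using that lipschitz_on_continuous_on[OF lipschitz_on_subset[OF \<phi>_lip]] by (intro compact_continuous_image) auto

lemma vimage_eq: "f -` S = (\<Union>j<m. \<phi> j ` S)" if "S \<subseteq> ball y \<delta>"
proof
  show "f -` S \<subseteq> (\<Union>j<m. \<phi> j ` S)"
  proof
    fix x assume x: "x \<in> f -` S"
    then have "f x \<in> ball y \<delta>" using that by blast
    then obtain j where j: "j < m" "x = \<phi> j (f x)" using cover by blast
    then have "x \<in> \<phi> j ` S" using x by blast
    then show "x \<in> (\<Union>j<m. \<phi> j ` S)" using j by blast
  qed
  show "(\<Union>j<m. \<phi> j ` S) \<subseteq> f -` S" using inv that by auto
qed

lemma \<phi>_disjoint: "\<phi> i ` S \<inter> \<phi> j ` S = {}" if "i < m" "j < m" "i \<noteq> j" "S \<subseteq> ball y \<delta>"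
proof (rule ccontr)
  assume "\<phi> i ` S \<inter> \<phi> j ` S \<noteq> {}"
  then obtain v w where "v \<in> S" "w \<in> S" "\<phi> i v = \<phi> j w" by blast
  moreover from this have "v \<in> ball y \<delta>" "w \<in> ball y \<delta>" using that(4) by blast+
  ultimately show False using sep[OF that(1-3), of v w] pos(3) by simp
qed

text \<open>Every point over the ball lies on some sheet, and a point closer than
  \<open>\<sigma>\<close> to sheet \<open>j\<close> can lie on no other.\<close>

lemma branch_eqI: "x = \<phi> j (f x)" if "f x \<in> ball y \<delta>" "j < m" "v \<in> ball y \<delta>" "dist x (\<phi> j v) < \<sigma>"
proof -
  from cover[OF that(1)] obtain i where i: "i < m" "x = \<phi> i (f x)" by blast
  have "i = j"
  proof (rule ccontr)
    assume "i \<noteq> j"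
    then have "\<sigma> \<le> dist (\<phi> i (f x)) (\<phi> j v)" using sep i that by blast
    then show False using i that(4) by simp
  qed
  then show ?thesis using i by simp
qed

text \<open>The openness of \<open>\<phi> j\<close> is the Lipschitz continuity of \<open>f\<close>:
  a point near \<open>\<phi> j x\<close> is on the same sheet because
  \<open>1 / K \<le> \<sigma>\<close>, and \<open>f\<close> sends it close to \<open>x\<close>. The
  volume formula holds because the preimage of \<open>S\<close> is the disjoint union of its
  lifts.\<close>

lemma branch_system_target:
  assumes p: "pushes_lebesgue_to_density f \<rho>" and \<rho>: "continuous_on UNIV \<rho>"
    and K: "0 < K" "L \<le> K" "C' \<le> K" "1 / K \<le> \<sigma>" and ur: "ball u r \<subseteq> ball y \<delta>"
  shows "branch_system K u r m \<rho> \<phi>"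
  unfolding branch_system_def
proof (intro conjI allI impI ballI)
  show "K-lipschitz_on (ball u r) (\<phi> j)" if "j < m" for j
    using lipschitz_on_subset[OF lipschitz_on_mono[OF \<phi>_lip[OF that] _ K(3)] ur] by simp
  show "colipschitz_on K (ball u r) (\<phi> j)" if j: "j < m" for j
    unfolding colipschitz_on_def
  proof (intro ballI allI impI subsetI)
    fix x q z assume x: "x \<in> ball u r" and q: "0 < q" "q < 1 / K" "ball x (K * q) \<subseteq> ball u r" and z: "z \<in> ball (\<phi> j x) q"
    have xV: "x \<in> ball y \<delta>" using x ur by blast
    have zq: "dist z (\<phi> j x) < q" using z by (simp add: dist_commute)
    have "dist (f z) x \<le> L * dist z (\<phi> j x)" using f_dist[of z "\<phi> j x"] inv[OF j xV] by simp
    also have "\<dots> \<le> K * dist z (\<phi> j x)" using K by (intro mult_right_mono) auto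
    also have "\<dots> < K * q" using zq K by simp
    finally have fz: "f z \<in> ball x (K * q)" by (simp add: dist_commute)
    then have fzV: "f z \<in> ball y \<delta>" using q(3) ur by blast
    have "z = \<phi> j (f z)" using zq q(2) K(4) by (intro branch_eqI[OF fzV j xV]) simp
    then show "z \<in> \<phi> j ` ball x (K * q)" using fz by (rule image_eqI)
  qed
  show "dist x x' \<le> K * dist (\<phi> 0 x) (\<phi> 0 x')" if "x \<in> ball u r" "x' \<in> ball u r" for x x'
  proof -
    have "dist x x' \<le> L * dist (\<phi> 0 x) (\<phi> 0 x')"
      using f_dist[of "\<phi> 0 x" "\<phi> 0 x'"] inv[of 0] that ur pos(2) by (simp add: subset_iff)
    also have "\<dots> \<le> K * dist (\<phi> 0 x) (\<phi> 0 x')" using K by (intro mult_right_mono) auto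
    finally show ?thesis .
  qed
  show "(\<forall>S. compact S \<longrightarrow> S \<subseteq> ball u r \<longrightarrow> integral S \<rho> = (\<Sum>j<m. measure lebesgue (\<phi> j ` S))) \<or>
      (\<forall>j. 0 < j \<and> j < m \<longrightarrow> \<phi> j ` ball u r \<subseteq> cball 0 K - ball u r) \<and>
      (\<forall>S. compact S \<longrightarrow> S \<subseteq> ball u r \<longrightarrow>
        measure lebesgue (\<phi> 0 ` S) = integral S \<rho> + (\<Sum>j\<in>{1..<m}. integral (\<phi> j ` S) \<rho>))"
  proof (intro disjI1 allI impI)
    fix S assume S: "compact S" "S \<subseteq> ball u r"
    then have SV: "S \<subseteq> ball y \<delta>" using ur by blast
    have "compact (f -` S)" unfolding vimage_eq[OF SV] using \<phi>_compact[OF _ S(1) SV] by (intro compact_UN) auto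
    then have "measure lborel (f -` S) = measure lebesgue (f -` S)" by (simp add: borel_compact)
    then show "integral S \<rho> = (\<Sum>j<m. measure lebesgue (\<phi> j ` S))"
      using pushes_lebesgue_to_density_compact[OF p cont \<rho> S(1)]
        measure_disjoint_compact_UN[of m "\<lambda>j. \<phi> j ` S", OF \<phi>_compact[OF _ S(1) SV] \<phi>_disjoint[OF _ _ _ SV]]
      by (simp add: vimage_eq[OF SV])
  qed
qed

lemma branch_system_source:
  assumes p: "pushes_density_to_lebesgue f \<rho>" and \<rho>: "continuous_on UNIV \<rho>"
    and K: "0 < K" "L \<le> K" "C' \<le> K" "C' * L \<le> K" "1 / K \<le> \<sigma>" "1 / K \<le> \<delta> / 2" "L / K \<le> \<delta> / 2"
      "\<And>j v. j < m \<Longrightarrow> v \<in> ball y \<delta> \<Longrightarrow> norm (\<phi> j v) \<le> K"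
    and ur: "ball u r \<subseteq> f -` ball y (\<delta> / 2) \<inter> ball (\<phi> 0 y) \<sigma>"
  shows "branch_system K u r m \<rho> (\<lambda>j. if j = 0 then f else \<phi> j \<circ> f)"
proof -
  let ?h = "\<lambda>j. if j = 0 then f else \<phi> j \<circ> f"
  have yV: "y \<in> ball y \<delta>" using pos by simp
  have fV2: "dist y (f x) < \<delta> / 2" if "x \<in> ball u r" for x using ur that by auto
  have fV: "f x \<in> ball y \<delta>" if "x \<in> ball u r" for x using fV2[OF that] pos by simp
  have \<phi>0: "\<phi> 0 (f x) = x" if "x \<in> ball u r" for x
  proof -
    have "dist x (\<phi> 0 y) < \<sigma>" using ur that by (auto simp: dist_commute)
    then show ?thesis using branch_eqI[OF fV[OF that] pos(2) yV] by simp
  qed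
  show ?thesis
    unfolding branch_system_def
  proof (intro conjI allI impI ballI)
    show "K-lipschitz_on (ball u r) (?h j)" if j: "j < m" for j
    proof (rule lipschitz_onI)
      fix x x' assume x: "x \<in> ball u r" "x' \<in> ball u r"
      have 1: "dist (f x) (f x') \<le> K * dist x x'"
        using f_dist[of x x'] mult_right_mono[OF K(2), of "dist x x'"] by simp
      have "dist (\<phi> j (f x)) (\<phi> j (f x')) \<le> C' * dist (f x) (f x')" using \<phi>_dist[OF j] fV x by blast
      also have "\<dots> \<le> C' * (L * dist x x')" using f_dist pos by (intro mult_left_mono) auto
      also have "\<dots> \<le> K * dist x x'" using mult_right_mono[OF K(4), of "dist x x'"] by (simp add: mult.assoc)
      finally show "dist (?h j x) (?h j x') \<le> K * dist x x'" using 1 by simp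
    qed (use K in simp)
    show "colipschitz_on K (ball u r) (?h j)" if j: "j < m" for j
      unfolding colipschitz_on_def
    proof (intro ballI allI impI subsetI)
      fix x q z assume x: "x \<in> ball u r" and q: "0 < q" "q < 1 / K" "ball x (K * q) \<subseteq> ball u r" and z: "z \<in> ball (?h j x) q"
      show "z \<in> ?h j ` ball x (K * q)"
      proof (cases "j = 0")
        case True
        then have zq: "dist z (f x) < q" using z by (simp add: dist_commute)
        have zV: "z \<in> ball y \<delta>" using fV2[OF x] zq q K(6) dist_triangle[of y z "f x"] by (simp add: dist_commute)
        have "dist (\<phi> 0 z) (\<phi> 0 (f x)) \<le> C' * dist z (f x)" by (rule \<phi>_dist[OF pos(2) zV fV[OF x]])
        also have "\<dots> \<le> K * dist z (f x)" using K by (intro mult_right_mono) auto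
        also have "\<dots> < K * q" using zq K by simp
        finally have "\<phi> 0 z \<in> ball x (K * q)" by (simp add: \<phi>0[OF x] dist_commute)
        moreover have "z = f (\<phi> 0 z)" using inv[OF pos(2) zV] by simp
        ultimately show ?thesis using True by auto
      next
        case False
        then have zq: "dist z (\<phi> j (f x)) < q" using z by (simp add: dist_commute)
        have fzx: "dist (f z) (f x) \<le> L * dist z (\<phi> j (f x))"
          using f_dist[of z "\<phi> j (f x)"] inv[OF j fV[OF x]] by simp
        also have "\<dots> \<le> L * (1 / K)" using zq q L0 by (intro mult_left_mono) auto
        also have "\<dots> = L / K" by simp
        also have "\<dots> \<le> \<delta> / 2" by (rule K(7))
        finally have "dist (f z) (f x) \<le> \<delta> / 2" .
        then have fzV: "f z \<in> ball y \<delta>" using fV2[OF x] dist_triangle[of y "f z" "f x"] by (simp add: dist_commute)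
        have zz: "z = \<phi> j (f z)" using zq q K(5) by (intro branch_eqI[OF fzV j fV[OF x]]) simp
        have "dist (\<phi> 0 (f z)) (\<phi> 0 (f x)) \<le> C' * dist (f z) (f x)" by (rule \<phi>_dist[OF pos(2) fzV fV[OF x]])
        also have "\<dots> \<le> C' * (L * dist z (\<phi> j (f x)))" using fzx pos by (intro mult_left_mono) auto
        also have "\<dots> \<le> K * dist z (\<phi> j (f x))"
          using mult_right_mono[OF K(4), of "dist z (\<phi> j (f x))"] by (simp add: mult.assoc)
        also have "\<dots> < K * q" using zq K by simp
        finally have "\<phi> 0 (f z) \<in> ball x (K * q)" by (simp add: \<phi>0[OF x] dist_commute)
        moreover have "z = (\<phi> j \<circ> f) (\<phi> 0 (f z))" using inv[OF pos(2) fzV] zz by simp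
        ultimately have "z \<in> (\<phi> j \<circ> f) ` ball x (K * q)" by blast
        then show ?thesis using False by simp
      qed
    qed
    show "dist x x' \<le> K * dist (?h 0 x) (?h 0 x')" if x: "x \<in> ball u r" "x' \<in> ball u r" for x x'
    proof -
      have "dist x x' \<le> C' * dist (f x) (f x')" using \<phi>_dist[OF pos(2) fV[OF x(1)] fV[OF x(2)]] \<phi>0 x by simp
      also have "\<dots> \<le> K * dist (f x) (f x')" using K by (intro mult_right_mono) auto
      finally show ?thesis by simp
    qed
    show "(\<forall>S. compact S \<longrightarrow> S \<subseteq> ball u r \<longrightarrow> integral S \<rho> = (\<Sum>j<m. measure lebesgue (?h j ` S))) \<or>
      (\<forall>j. 0 < j \<and> j < m \<longrightarrow> ?h j ` ball u r \<subseteq> cball 0 K - ball u r) \<and>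
      (\<forall>S. compact S \<longrightarrow> S \<subseteq> ball u r \<longrightarrow>
        measure lebesgue (?h 0 ` S) = integral S \<rho> + (\<Sum>j\<in>{1..<m}. integral (?h j ` S) \<rho>))"
    proof (intro disjI2 conjI allI impI subsetI)
      fix j w assume j: "0 < j \<and> j < m" and "w \<in> ?h j ` ball u r"
      then obtain x where x: "x \<in> ball u r" "w = \<phi> j (f x)" by auto
      have "w \<in> cball 0 K" using K(8)[of j "f x"] j fV[OF x(1)] x(2) by simp
      \<comment> \<open>A point of \<open>ball u r\<close> is on sheet 0, while \<open>w\<close> is
        on sheet \<open>j\<close> over the same value; the gap between the sheets excludes
        this.\<close>
      moreover have "w \<notin> ball u r"
      proof
        assume "w \<in> ball u r"
        then have "\<phi> 0 (f w) = w" by (rule \<phi>0)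
        moreover have "f w = f x" using inv[of j "f x"] j fV[OF x(1)] x(2) by simp
        ultimately have "w = \<phi> 0 (f x)" by simp
        moreover have "\<sigma> \<le> dist (\<phi> j (f x)) (\<phi> 0 (f x))" using j pos(2) fV[OF x(1)] by (intro sep) auto
        ultimately show False using x(2) pos(3) by simp
      qed
      ultimately show "w \<in> cball 0 K - ball u r" by blast
    next
      fix S assume S: "compact S" "S \<subseteq> ball u r"
      have fS: "compact (f ` S)" by (rule compact_continuous_image[OF cont S(1)])
      have fSV: "f ` S \<subseteq> ball y \<delta>" using fV S(2) by blast
      have pre: "compact (f -` (f ` S))"
        unfolding vimage_eq[OF fSV] using \<phi>_compact[OF _ fS fSV] by (intro compact_UN) auto
      have "measure lebesgue (f ` S) = measure lborel (f ` S)" using fS by (simp add: borel_compact)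
      also have "\<dots> = integral (f -` (f ` S)) \<rho>" by (rule pushes_density_to_lebesgue_compact[OF p cont \<rho> fS pre])
      also have "\<dots> = (\<Sum>j<m. integral (\<phi> j ` f ` S) \<rho>)"
        unfolding vimage_eq[OF fSV]
        by (rule integral_disjoint_compact_UN[OF \<phi>_compact[OF _ fS fSV] \<rho> \<phi>_disjoint[OF _ _ _ fSV]])
      also have "{..<m} = insert 0 {1..<m}" using pos(2) by auto
      also have "(\<Sum>j\<in>insert 0 {1..<m}. integral (\<phi> j ` f ` S) \<rho>)
          = integral (\<phi> 0 ` f ` S) \<rho> + (\<Sum>j\<in>{1..<m}. integral (\<phi> j ` f ` S) \<rho>)" by simp
      also have "\<phi> 0 ` f ` S = S" using \<phi>0 S(2) by (force simp: image_image)
      also have "(\<Sum>j\<in>{1..<m}. integral (\<phi> j ` f ` S) \<rho>) = (\<Sum>j\<in>{1..<m}. integral (?h j ` S) \<rho>)"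
        by (intro sum.cong) (auto simp: image_comp)
      finally show "measure lebesgue (?h 0 ` S) = integral S \<rho> + (\<Sum>j\<in>{1..<m}. integral (?h j ` S) \<rho>)" by simp
    qed
  qed
qed

end

text \<open>The open set, \<open>m\<close> and \<open>K0\<close> are fixed first; then every large
  \<open>K\<close> and every ball in the open set are admissible. This freedom allows
  \<open>K\<close>, \<open>u\<close> and \<open>r\<close> to be taken from countable sets.\<close>

lemma branch_system_exists:
  fixes f :: "real^'n::finite \<Rightarrow> real^'n"
  assumes reg: "lipschitz_regular f" and \<rho>: "continuous_on UNIV \<rho>"
    and push: "pushes_density_to_lebesgue f \<rho> \<or> pushes_lebesgue_to_density f \<rho>"
  obtains U m K0 where "open U" "U \<noteq> {}" "0 < (m::nat)"
    "\<forall>K u r. 0 < K \<longrightarrow> K0 \<le> K \<longrightarrow> ball u r \<subseteq> U \<longrightarrow> (\<exists>h. branch_system K u r m \<rho> h)"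
proof -
  obtain L where L: "L-lipschitz_on UNIV f" using reg by (auto simp: lipschitz_regular_def)
  obtain C where C: "regular_with C f"
    using reg unfolding lipschitz_regular_def regular_with_def by blast
  have cf: "continuous_on UNIV f" by (rule lipschitz_on_continuous_on[OF L])
  obtain y \<delta> m \<phi> \<sigma> where br: "branches f (4 * (real C)\<^sup>2) y \<delta> m \<phi> \<sigma>"
    by (rule regular_branches[OF cf C])
  define C' where "C' = 4 * (real C)\<^sup>2"
  interpret lipschitz_branches f C' y \<delta> m \<phi> \<sigma> L
    using br L by (simp add: lipschitz_branches_def lipschitz_branches_axioms_def C'_def)
  \<comment> \<open>A bound for all sheets: the other images must stay in a fixed compact ball, on
    which \<open>\<rho>\<close> is uniformly continuous.\<close>
  define B where "B = (\<Sum>j<m. norm (\<phi> j y)) + C' * \<delta>"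
  have B: "norm (\<phi> j v) \<le> B" if "j < m" "v \<in> ball y \<delta>" for j v
  proof -
    have "norm (\<phi> j v) \<le> norm (\<phi> j y) + dist (\<phi> j v) (\<phi> j y)"
      using norm_triangle_sub[of "\<phi> j v" "\<phi> j y"] by (simp add: dist_norm)
    also have "dist (\<phi> j v) (\<phi> j y) \<le> C' * dist v y" using \<phi>_dist[OF that] pos by simp
    also have "\<dots> \<le> C' * \<delta>" using that pos by (intro mult_left_mono) (auto simp: dist_commute)
    also have "norm (\<phi> j y) \<le> (\<Sum>j<m. norm (\<phi> j y))" using that by (intro member_le_sum) auto
    finally show ?thesis by (simp add: B_def)
  qed
  have "B \<ge> 0" using pos by (auto simp: B_def intro!: add_nonneg_nonneg sum_nonneg)
  \<comment> \<open>All summands are nonnegative, so \<open>K0 \<le> K\<close> bounds each of them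
    by \<open>K\<close>.\<close>
  define K0 where "K0 = L + C' + C' * L + 1 / \<sigma> + 2 / \<delta> + 2 * L / \<delta> + B"
  have nonneg: "0 \<le> L" "0 \<le> C'" "0 \<le> C' * L" "0 \<le> 1 / \<sigma>" "0 \<le> 2 / \<delta>" "0 \<le> 2 * L / \<delta>"
    using L0 pos by auto
  have K: "L \<le> K" "C' \<le> K" "C' * L \<le> K" "1 / K \<le> \<sigma>" "1 / K \<le> \<delta> / 2" "L / K \<le> \<delta> / 2" "B \<le> K"
    if "0 < K" "K0 \<le> K" for K
  proof -
    have *: "L \<le> K" "C' \<le> K" "C' * L \<le> K" "1 / \<sigma> \<le> K" "2 / \<delta> \<le> K" "2 * L / \<delta> \<le> K" "B \<le> K"
      using nonneg \<open>B \<ge> 0\<close> that(2) unfolding K0_def by linarith+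
    then show "L \<le> K" "C' \<le> K" "C' * L \<le> K" "B \<le> K" by blast+
    have "1 \<le> K * \<sigma>" "2 \<le> K * \<delta>" "2 * L \<le> K * \<delta>" using * pos by (simp_all add: pos_divide_le_eq)
    then show "1 / K \<le> \<sigma>" "1 / K \<le> \<delta> / 2" "L / K \<le> \<delta> / 2"
      using that(1) by (simp_all add: pos_divide_le_eq mult.commute)
  qed
  show thesis
  proof (cases "pushes_lebesgue_to_density f \<rho>")
    case True
    show thesis
    proof (rule that[of "ball y \<delta>" m K0])
      show "\<forall>K u r. 0 < K \<longrightarrow> K0 \<le> K \<longrightarrow> ball u r \<subseteq> ball y \<delta> \<longrightarrow> (\<exists>h. branch_system K u r m \<rho> h)"
        using branch_system_target[OF True \<rho>] K by blast
    qed (use pos in auto)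
  next
    case False
    then have p: "pushes_density_to_lebesgue f \<rho>" using push by blast
    let ?U = "f -` ball y (\<delta> / 2) \<inter> ball (\<phi> 0 y) \<sigma>"
    show thesis
    proof (rule that[of ?U m K0])
      show "open ?U" using cf by (intro open_Int open_vimage) auto
      have "\<phi> 0 y \<in> ?U" using inv[of 0 y] pos by simp
      then show "?U \<noteq> {}" by blast
      show "\<forall>K u r. 0 < K \<longrightarrow> K0 \<le> K \<longrightarrow> ball u r \<subseteq> ?U \<longrightarrow> (\<exists>h. branch_system K u r m \<rho> h)"
      proof (intro allI impI)
        fix K u r assume "0 < K" "K0 \<le> K" and ur: "ball u r \<subseteq> ?U"
        note K' = K[OF this(1,2)]
        have "branch_system K u r m \<rho> (\<lambda>j. if j = 0 then f else \<phi> j \<circ> f)"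
          by (rule branch_system_source[OF p \<rho> \<open>0 < K\<close> K'(1-6) _ ur]) (use B K'(7) in force)
        then show "\<exists>h. branch_system K u r m \<rho> h" by blast
      qed
    qed (use pos in auto)
  qed
qed

lemma porous_at_mono:
  assumes "porous_at P x" "Q \<subseteq> P"
  shows "porous_at Q x"
  using assms unfolding porous_at_def by (meson disjoint_iff subsetD)

theorem theorem1p11:
  assumes "CARD('n::finite) \<ge> 2"
  shows "sigma_porous {\<rho> :: (real^'n) \<Rightarrow>\<^sub>C real.
           \<exists>f :: real^'n \<Rightarrow> real^'n. lipschitz_regular f \<and>
             (pushes_density_to_lebesgue f (apply_bcontfun \<rho>) \<or>
              pushes_lebesgue_to_density f (apply_bcontfun \<rho>))}"
proof -
  let ?E = "{\<rho> :: (real^'n) \<Rightarrow>\<^sub>C real.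
           \<exists>f :: real^'n \<Rightarrow> real^'n. lipschitz_regular f \<and>
             (pushes_density_to_lebesgue f (apply_bcontfun \<rho>) \<or>
              pushes_lebesgue_to_density f (apply_bcontfun \<rho>))}"
  obtain D :: "(real^'n) set" where D: "countable D" "\<And>X. open X \<Longrightarrow> X \<noteq> {} \<Longrightarrow> \<exists>d\<in>D. d \<in> X"
    using countable_dense_exists by blast
  \<comment> \<open>Centres come from a countable dense set, Lipschitz constants and inverse radii
    from the positive integers; \<open>Suc\<close> ensures positivity, also of the number of
    maps.\<close>
  define P :: "nat \<Rightarrow> real^'n \<Rightarrow> nat \<Rightarrow> nat \<Rightarrow> ((real^'n) \<Rightarrow>\<^sub>C real) set" where
    "P k u n m = {\<rho>. \<exists>h. branch_system (real (Suc k)) u (1 / real (Suc n)) (Suc m) (apply_bcontfun \<rho>) h}" for k u n m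
  \<comment> \<open>A branch system need not come from a Lipschitz regular map. Intersecting with
    the set in question makes the union equal to it, and porosity passes to subsets.\<close>
  define F where "F = (\<lambda>(k, u, n, m). P k u n m \<inter> ?E) ` (UNIV \<times> D \<times> UNIV \<times> UNIV)"
  have "countable F" unfolding F_def using D(1) by (intro countable_image countable_SIGMA) auto
  moreover have "porous Q" if Q: "Q \<in> F" for Q
  proof -
    obtain k u n m where "Q = P k u n m \<inter> ?E" using Q by (auto simp: F_def)
    moreover have "porous_at (P k u n m) \<rho>" for \<rho>
      unfolding P_def by (rule porous_at_branch_system[OF assms]) auto
    ultimately show ?thesis unfolding porous_def using porous_at_mono by blast
  qed
  moreover have "?E \<subseteq> \<Union>F"
  proof
    fix \<rho> assume \<rho>: "\<rho> \<in> ?E"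
    then obtain f :: "real^'n \<Rightarrow> real^'n" where f: "lipschitz_regular f"
      "pushes_density_to_lebesgue f (apply_bcontfun \<rho>) \<or> pushes_lebesgue_to_density f (apply_bcontfun \<rho>)" by blast
    obtain U m K0 where U: "open U" "U \<noteq> {}" "0 < (m::nat)"
      "\<forall>K u r. 0 < K \<longrightarrow> K0 \<le> K \<longrightarrow> ball u r \<subseteq> U \<longrightarrow> (\<exists>h. branch_system K u r m (apply_bcontfun \<rho>) h)"
      by (rule branch_system_exists[OF f(1) continuous_on_apply_bcontfun f(2)])
    obtain x e where x: "x \<in> U" "0 < e" "ball x e \<subseteq> U" using U(1,2) open_contains_ball by blast
    \<comment> \<open>Half of \<open>e\<close> leaves room for moving the centre from
      \<open>x\<close> to a point \<open>u\<close> of the dense set.\<close>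
    obtain n where n: "1 / real (Suc n) < e / 2" using nat_approx_posE[of "e / 2"] x(2) by auto
    have "ball x (1 / real (Suc n)) \<noteq> {}" by simp
    then obtain u where u: "u \<in> D" "u \<in> ball x (1 / real (Suc n))" using D(2)[OF open_ball] by blast
    have "ball u (1 / real (Suc n)) \<subseteq> ball x e"
    proof
      fix z assume "z \<in> ball u (1 / real (Suc n))"
      then show "z \<in> ball x e" using u(2) n dist_triangle[of x z u] by simp
    qed
    then have "ball u (1 / real (Suc n)) \<subseteq> U" using x(3) by blast
    moreover obtain k :: nat where "K0 \<le> real k" using real_arch_simple by blast
    then have "K0 \<le> real (Suc k)" by simp
    ultimately have "\<exists>h. branch_system (real (Suc k)) u (1 / real (Suc n)) m (apply_bcontfun \<rho>) h"
      using U(4) by (metis of_nat_0_less_iff zero_less_Suc)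
    moreover obtain m' where "m = Suc m'" using U(3) gr0_implies_Suc by blast
    ultimately have "\<rho> \<in> P k u n m'" by (simp add: P_def)
    then have "\<rho> \<in> P k u n m' \<inter> ?E" using \<rho> by blast
    moreover have "P k u n m' \<inter> ?E \<in> F" unfolding F_def using u(1) by (intro image_eqI[of _ _ "(k, u, n, m')"]) auto
    ultimately show "\<rho> \<in> \<Union>F" by blast
  qed
  moreover have "\<Union>F \<subseteq> ?E" by (auto simp: F_def)
  ultimately show ?thesis unfolding sigma_porous_def by (intro exI[of _ F]) blast
qed

end
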